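(* For every $k\in\mathbb{N}$, $$H^{k}_{W,V}(\mathbb{T})=\overline{C^{\infty}_{W,V}(\mathbb{T})}^{\,\|\cdot\|_{k,W,V}},$$ i.e. $H^k_{W,V}(\mathbb{T})$ is the closure of $C^\infty_{W,V}(\mathbb{T})$ in the norm $\|\cdot\|_{k,W,V}$.
   Context: $W,V:\mathbb{R}\to\mathbb{R}$ are strictly increasing, $W$ càdlàg, $V$ càglàd, $W(x+1)-W(x)=W(1)-W(0)$ and $V(x+1)-V(x)=V(1)-V(0)$ for all $x$, both are continuous at $0$ and $W(0)=V(0)=0$. $\mathbb{T}=\mathbb{R}/\mathbb{Z}$; $dW((a,b])=W(b)-W(a)$, $dV([a,b))=V(b)-V(a)$; $L^2_V(\mathbb{T}),L^2_W(\mathbb{T})$ are the corresponding $L^2$ spaces with norms $\|\cdot\|_V,\|\cdot\|_W$. Strong one-sided derivatives: $D^{-}_{W}f(x)=\lim_{h\to0^-}\frac{f(x+h)-f(x)}{W(x+h)-W(x)}$, $D^{+}_{V}g(x)=\lim_{h\to0^+}\frac{g(x+h)-g(x)}{V(x+h)-V(x)}$. $D^{(n)}_{W,V}$ is the alternating composition of $n$ derivatives with $D^-_W$ applied first ($D^-_W$, $D^+_VD^-_W$, $D^-_WD^+_VD^-_W$, ...). $C_0(\mathbb{T})$: càdlàg $f:\mathbb{T}\to\mathbb{R}$ with $\int f\,dV=0$; $C_1(\mathbb{T})$: càglàd $f:\mathbb{T}\to\mathbb{R}$ with $\int f\,dW=0$. $C^\infty_{W,V}(\mathbb{T})$ is the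 direct sum of the constants and the set of $f\in C_0(\mathbb{T})$ such that for all $n\ge1$ $D^{(n)}_{W,V}f$ exists everywhere and lies in $C_1(\mathbb{T})$ ($n$ odd) or $C_0(\mathbb{T})$ ($n$ even). $C^\infty_{V,W}(\mathbb{T})$ is the analogue with roles exchanged: constants plus $g\in C_1(\mathbb{T})$ whose alternating derivatives $D^+_Vg\in C_0(\mathbb{T})$, $D^-_WD^+_Vg\in C_1(\mathbb{T})$, ... all exist. Weak derivatives: $f\in L^2_V(\mathbb{T})$ has weak derivative $D^-_Wf=F\in L^2_W(\mathbb{T})$ if $\int_{\mathbb{T}}f\,D^+_Vg\,dV=-\int_{\mathbb{T}}Fg\,dW$ for all $g\in C^\infty_{V,W}(\mathbb{T})$; $h\in L^2_W(\mathbb{T})$ has weak derivative $D^+_Vh=H\in L^2_V(\mathbb{T})$ if $\int_{\mathbb{T}}h\,D^-_Wg\,dW=-\int_{\mathbb{T}}Hg\,dV$ for all $g\in C^\infty_{W,V}(\mathbb{T})$. $H^k_{W,V}(\mathbb{T})$ is the set of $f\in L^2_V(\mathbb{T})$ for which the weak $D^{(n)}_{W,V}f$ exists in $L^2_{\kappa(n)}(\mathbb{T})$ for $n=1,\dots,k$, with $\kappa(n)=W$ for $n$ odd and $V$ for $n$ even, and norm $\|f\|_{k,W,V}=\big(\|f\|_V^2+\sum_{i=1}^k\|D^{(i)}_{W,V}f\|^2_{\kappa(i)}\big)^{1/2}$. *)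

theory Defs
  imports "HOL-Analysis.Analysis"
begin

text \<open>Functions on the circle \<open>\<real>/\<int>\<close> are represented by functions on the line with period 1.\<close>

definition circle_fun :: "(real \<Rightarrow> real) \<Rightarrow> bool" where
  "circle_fun f \<longleftrightarrow> (\<forall>x. f (x + 1) = f x)"

definition cadlag :: "(real \<Rightarrow> real) \<Rightarrow> bool" where
  "cadlag f \<longleftrightarrow> (\<forall>x. continuous (at_right x) f \<and> (\<exists>l. (f \<longlongrightarrow> l) (at_left x)))"

definition caglad :: "(real \<Rightarrow> real) \<Rightarrow> bool" where
  "caglad f \<longleftrightarrow> (\<forall>x. continuous (at_left x) f \<and> (\<exists>l. (f \<longlongrightarrow> l) (at_right x)))"


subsection \<open>The measures \<open>dW\<close> and \<open>dV\<close>\<close>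

text \<open>The library's \<^const>\<open>interval_measure\<close> is the Stieltjes measure of a right-continuous function,
  with value \<open>F b - F a\<close> on \<open>(a, b]\<close>. For a left-continuous function we reflect it, which
  gives the value \<open>F b - F a\<close> on \<open>[a, b)\<close>.\<close>

definition left_interval_measure :: "(real \<Rightarrow> real) \<Rightarrow> real measure" where
  "left_interval_measure F = distr (interval_measure (\<lambda>x. - F (- x))) borel uminus"

lemma emeasure_left_interval_measure_Ico:
  assumes "a \<le> b" and mono: "\<And>x y. x \<le> y \<Longrightarrow> F x \<le> F y"
    and cont: "\<And>x. continuous (at_left x) F"
  shows "emeasure (left_interval_measure F) {a..<b} = ennreal (F b - F a)"
proof -
  have rc: "continuous (at_right x) (\<lambda>x. - F (- x))" for x
  proof -
    have "(F \<longlongrightarrow> F (- x)) (at_left (- x))"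
      using cont[of "- x"] by (simp add: continuous_within)
    then have "((\<lambda>x. F (- x)) \<longlongrightarrow> F (- x)) (at_right x)"
      by (simp add: at_left_minus filterlim_filtermap)
    then show ?thesis
      by (simp add: continuous_within tendsto_minus)
  qed
  have vi: "uminus -` {a..<b} = {- b<..- a}"
    by (auto simp: image_iff)
  have "emeasure (left_interval_measure F) {a..<b}
      = emeasure (interval_measure (\<lambda>x. - F (- x))) {- b<..- a}"
    unfolding left_interval_measure_def by (subst emeasure_distr) (auto simp: vi)
  also have "\<dots> = ennreal (F b - F a)"
    using assms(1) rc by (subst emeasure_interval_measure_Ioc) (auto intro: mono)
  finally show ?thesis .
qed

text \<open>On the circle the measures live on a fundamental domain; since \<open>W\<close> and \<open>V\<close> will be continuous
  at \<open>0\<close>, the integers carry no mass and the choice of end points is immaterial.\<close>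

definition dW :: "(real \<Rightarrow> real) \<Rightarrow> real measure" where
  "dW W = restrict_space (interval_measure W) {0<..1}"

definition dV :: "(real \<Rightarrow> real) \<Rightarrow> real measure" where
  "dV V = restrict_space (left_interval_measure V) {0..<1}"

text \<open>Elements of \<open>L\<^sup>2\<close> are represented by functions; the weak derivatives,
  Sobolev spaces and norms below do not depend on the representative.\<close>

definition L2_circle :: "real measure \<Rightarrow> (real \<Rightarrow> real) set" where
  "L2_circle M = {f \<in> borel_measurable borel. circle_fun f \<and> integrable M (\<lambda>x. (f x)\<^sup>2)}"

definition L2_norm :: "real measure \<Rightarrow> (real \<Rightarrow> real) \<Rightarrow> real" where
  "L2_norm M f = sqrt (\<integral>x. (f x)\<^sup>2 \<partial>M)"


subsection \<open>Strong one-sided derivatives\<close>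

definition diff_quotient :: "(real \<Rightarrow> real) \<Rightarrow> (real \<Rightarrow> real) \<Rightarrow> real \<Rightarrow> real \<Rightarrow> real" where
  "diff_quotient U f x h = (f (x + h) - f x) / (U (x + h) - U x)"

definition left_diff :: "(real \<Rightarrow> real) \<Rightarrow> (real \<Rightarrow> real) \<Rightarrow> bool" where
  "left_diff W f \<longleftrightarrow> (\<forall>x. \<exists>l. (diff_quotient W f x \<longlongrightarrow> l) (at_left 0))"

definition left_deriv :: "(real \<Rightarrow> real) \<Rightarrow> (real \<Rightarrow> real) \<Rightarrow> real \<Rightarrow> real" where
  "left_deriv W f x = Lim (at_left 0) (diff_quotient W f x)"

definition right_diff :: "(real \<Rightarrow> real) \<Rightarrow> (real \<Rightarrow> real) \<Rightarrow> bool" where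
  "right_diff V g \<longleftrightarrow> (\<forall>x. \<exists>l. (diff_quotient V g x \<longlongrightarrow> l) (at_right 0))"

definition right_deriv :: "(real \<Rightarrow> real) \<Rightarrow> (real \<Rightarrow> real) \<Rightarrow> real \<Rightarrow> real" where
  "right_deriv V g x = Lim (at_right 0) (diff_quotient V g x)"

primrec strong_D_WV :: "(real \<Rightarrow> real) \<Rightarrow> (real \<Rightarrow> real) \<Rightarrow> nat \<Rightarrow> (real \<Rightarrow> real) \<Rightarrow> real \<Rightarrow> real" where
  "strong_D_WV W V 0 f = f"
| "strong_D_WV W V (Suc n) f =
     (if even n then left_deriv W (strong_D_WV W V n f) else right_deriv V (strong_D_WV W V n f))"

primrec strong_D_VW :: "(real \<Rightarrow> real) \<Rightarrow> (real \<Rightarrow> real) \<Rightarrow> nat \<Rightarrow> (real \<Rightarrow> real) \<Rightarrow> real \<Rightarrow> real" where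
  "strong_D_VW V W 0 g = g"
| "strong_D_VW V W (Suc n) g =
     (if even n then right_deriv V (strong_D_VW V W n g) else left_deriv W (strong_D_VW V W n g))"


subsection \<open>Smooth functions\<close>

definition C0 :: "(real \<Rightarrow> real) \<Rightarrow> (real \<Rightarrow> real) set" where
  "C0 V = {f. circle_fun f \<and> cadlag f \<and> (\<integral>x. f x \<partial>dV V) = 0}"

definition C1 :: "(real \<Rightarrow> real) \<Rightarrow> (real \<Rightarrow> real) set" where
  "C1 W = {f. circle_fun f \<and> caglad f \<and> (\<integral>x. f x \<partial>dW W) = 0}"

definition Cinf_WV :: "(real \<Rightarrow> real) \<Rightarrow> (real \<Rightarrow> real) \<Rightarrow> (real \<Rightarrow> real) set" where
  "Cinf_WV W V = {\<lambda>x. c + f x | c f. f \<in> C0 V \<and>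
     (\<forall>n. if even n
          then left_diff W (strong_D_WV W V n f) \<and> strong_D_WV W V (Suc n) f \<in> C1 W
          else right_diff V (strong_D_WV W V n f) \<and> strong_D_WV W V (Suc n) f \<in> C0 V)}"

definition Cinf_VW :: "(real \<Rightarrow> real) \<Rightarrow> (real \<Rightarrow> real) \<Rightarrow> (real \<Rightarrow> real) set" where
  "Cinf_VW V W = {\<lambda>x. c + g x | c g. g \<in> C1 W \<and>
     (\<forall>n. if even n
          then right_diff V (strong_D_VW V W n g) \<and> strong_D_VW V W (Suc n) g \<in> C0 V
          else left_diff W (strong_D_VW V W n g) \<and> strong_D_VW V W (Suc n) g \<in> C1 W)}"


subsection \<open>Weak derivatives and Sobolev spaces\<close>

definition has_weak_deriv_W ::
    "(real \<Rightarrow> real) \<Rightarrow> (real \<Rightarrow> real) \<Rightarrow> (real \<Rightarrow> real) \<Rightarrow> (real \<Rightarrow> real) \<Rightarrow> bool" where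
  "has_weak_deriv_W W V f F \<longleftrightarrow> f \<in> L2_circle (dV V) \<and> F \<in> L2_circle (dW W) \<and>
     (\<forall>g \<in> Cinf_VW V W. (\<integral>x. f x * right_deriv V g x \<partial>dV V) = - (\<integral>x. F x * g x \<partial>dW W))"

definition has_weak_deriv_V ::
    "(real \<Rightarrow> real) \<Rightarrow> (real \<Rightarrow> real) \<Rightarrow> (real \<Rightarrow> real) \<Rightarrow> (real \<Rightarrow> real) \<Rightarrow> bool" where
  "has_weak_deriv_V W V h H \<longleftrightarrow> h \<in> L2_circle (dW W) \<and> H \<in> L2_circle (dV V) \<and>
     (\<forall>g \<in> Cinf_WV W V. (\<integral>x. h x * left_deriv W g x \<partial>dW W) = - (\<integral>x. H x * g x \<partial>dV V))"

primrec has_weak_D ::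
    "(real \<Rightarrow> real) \<Rightarrow> (real \<Rightarrow> real) \<Rightarrow> nat \<Rightarrow> (real \<Rightarrow> real) \<Rightarrow> (real \<Rightarrow> real) \<Rightarrow> bool" where
  "has_weak_D W V 0 f F \<longleftrightarrow> f \<in> L2_circle (dV V) \<and> F = f"
| "has_weak_D W V (Suc n) f F \<longleftrightarrow>
     (\<exists>G. has_weak_D W V n f G \<and>
          (if even n then has_weak_deriv_W W V G F else has_weak_deriv_V W V G F))"

text \<open>Weak derivatives are unique up to null sets, so any choice yields a representative of the class.\<close>

definition weak_D :: "(real \<Rightarrow> real) \<Rightarrow> (real \<Rightarrow> real) \<Rightarrow> nat \<Rightarrow> (real \<Rightarrow> real) \<Rightarrow> real \<Rightarrow> real" where
  "weak_D W V n f = (SOME F. has_weak_D W V n f F)"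

definition kappa :: "(real \<Rightarrow> real) \<Rightarrow> (real \<Rightarrow> real) \<Rightarrow> nat \<Rightarrow> real measure" where
  "kappa W V n = (if odd n then dW W else dV V)"

definition sobolev :: "(real \<Rightarrow> real) \<Rightarrow> (real \<Rightarrow> real) \<Rightarrow> nat \<Rightarrow> (real \<Rightarrow> real) set" where
  "sobolev W V k = {f \<in> L2_circle (dV V). \<forall>n\<in>{1..k}. \<exists>F. has_weak_D W V n f F}"

definition sobolev_norm :: "(real \<Rightarrow> real) \<Rightarrow> (real \<Rightarrow> real) \<Rightarrow> nat \<Rightarrow> (real \<Rightarrow> real) \<Rightarrow> real" where
  "sobolev_norm W V k f =
     sqrt ((L2_norm (dV V) f)\<^sup>2 + (\<Sum>i=1..k. (L2_norm (kappa W V i) (weak_D W V i f))\<^sup>2))"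

text \<open>The norm topology on \<open>H\<^sup>k\<close>. Working with representatives, the norm is only a seminorm, so the
  topology identifies functions that agree almost everywhere.\<close>

definition sobolev_topology ::
    "(real \<Rightarrow> real) \<Rightarrow> (real \<Rightarrow> real) \<Rightarrow> nat \<Rightarrow> (real \<Rightarrow> real) topology" where
  "sobolev_topology W V k = topology (\<lambda>U. U \<subseteq> sobolev W V k \<and>
     (\<forall>f\<in>U. \<exists>e>0. \<forall>g\<in>sobolev W V k. sobolev_norm W V k (\<lambda>x. g x - f x) < e \<longrightarrow> g \<in> U))"

lemma openin_sobolev_topology:
  "openin (sobolev_topology W V k) U \<longleftrightarrow> U \<subseteq> sobolev W V k \<and>
     (\<forall>f\<in>U. \<exists>e>0. \<forall>g\<in>sobolev W V k. sobolev_norm W V k (\<lambda>x. g x - f x) < e \<longrightarrow> g \<in> U)"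
proof -
  let ?B = "\<lambda>U. U \<subseteq> sobolev W V k \<and>
     (\<forall>f\<in>U. \<exists>e>0. \<forall>g\<in>sobolev W V k. sobolev_norm W V k (\<lambda>x. g x - f x) < e \<longrightarrow> g \<in> U)"
  have "istopology ?B"
    unfolding istopology_def
  proof (intro conjI allI impI)
    fix S T assume S: "?B S" and T: "?B T"
    show "S \<inter> T \<subseteq> sobolev W V k" using S by blast
    show "\<forall>f\<in>S \<inter> T. \<exists>e>0. \<forall>g\<in>sobolev W V k.
        sobolev_norm W V k (\<lambda>x. g x - f x) < e \<longrightarrow> g \<in> S \<inter> T"
    proof
      fix f assume f: "f \<in> S \<inter> T"
      obtain d where d: "d > 0"
          "\<forall>g\<in>sobolev W V k. sobolev_norm W V k (\<lambda>x. g x - f x) < d \<longrightarrow> g \<in> S"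
        using S f by blast
      obtain e where e: "e > 0"
          "\<forall>g\<in>sobolev W V k. sobolev_norm W V k (\<lambda>x. g x - f x) < e \<longrightarrow> g \<in> T"
        using T f by blast
      show "\<exists>e>0. \<forall>g\<in>sobolev W V k. sobolev_norm W V k (\<lambda>x. g x - f x) < e \<longrightarrow> g \<in> S \<inter> T"
        using d e by (intro exI[of _ "min d e"]) auto
    qed
  next
    fix K assume K: "\<forall>S\<in>K. ?B S"
    show "\<Union>K \<subseteq> sobolev W V k" using K by blast
    show "\<forall>f\<in>\<Union>K. \<exists>e>0. \<forall>g\<in>sobolev W V k.
        sobolev_norm W V k (\<lambda>x. g x - f x) < e \<longrightarrow> g \<in> \<Union>K"
      using K by (meson UnionE UnionI)
  qed
  then show ?thesis
    unfolding sobolev_topology_def by (simp add: topology_inverse')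
qed

lemma topspace_sobolev_topology: "topspace (sobolev_topology W V k) = sobolev W V k"
proof
  show "topspace (sobolev_topology W V k) \<subseteq> sobolev W V k"
    using openin_sobolev_topology openin_topspace by blast
  have "openin (sobolev_topology W V k) (sobolev W V k)"
    unfolding openin_sobolev_topology by (auto intro: exI[of _ 1])
  then show "sobolev W V k \<subseteq> topspace (sobolev_topology W V k)"
    by (rule openin_subset)
qed

end

theory Submission
  imports Defs
begin

text \<open>
  Arrange the mean-zero functions in levels: at even levels they lie in \<open>L\<^sup>2(dV)\<close>, at odd levels in
  \<open>L\<^sup>2(dW)\<close>. The strong derivatives raise the level by one, and each has a right inverse, the mean-zero
  primitive, which lowers it by one. A primitive is bounded uniformly by the \<open>L\<^sup>2\<close> norm of the function
  that is integrated, and the primitives of two consecutive levels are adjoint to each other up to sign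
  (\<open>integration_by_parts\<close>). No correction for common atoms of \<open>dW\<close> and \<open>dV\<close> appears because the cadlag
  and caglad conventions count the diagonal on exactly one side.

  By the fundamental theorem of calculus for one-sided derivatives (\<open>fundamental_theorem\<close>) a smooth
  function is a constant plus the first member of a chain \<open>x\<^sub>0, x\<^sub>1, \<dots>\<close> in which every \<open>x\<^sub>n\<close> is the
  primitive of \<open>x\<^sub>n\<^sub>+\<^sub>1\<close>. The heart of the proof is that chains are dense: at every level, every mean-zero
  \<open>L\<^sup>2\<close> function is approximated by the members of chains at that level (\<open>smooth_chains_dense\<close>). Two facts
  give this. The primitives of regular functions are dense (\<open>int_W_range_dense\<close>), because steep ramps
  approximate step functions; and in an inverse system of maps with dense range the elements that can
  be lifted through all levels are dense, by the Mittag-Leffler argument. The spectral theory of the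
  second-order operator is thus avoided, and so is the completeness of \<open>L\<^sup>2\<close>, since all limits that occur
  are uniform.

  Density of the chains makes the test functions numerous enough to conclude that \<open>F\<close> is a weak
  derivative of \<open>f\<close> exactly if \<open>F\<close> has mean zero and \<open>f\<close> is almost everywhere a constant plus the
  primitive of \<open>F\<close> (\<open>weak_step_imp_primitive\<close>, \<open>weak_step_primitive\<close>). Hence smooth functions belong to
  every Sobolev space. Conversely, given \<open>f\<close> in the \<open>k\<close>-th one, approximate its \<open>k\<close>-th weak derivative by
  the \<open>k\<close>-th member of a chain and integrate down \<open>k\<close> times: every primitive is bounded, so all lower
  derivatives, and \<open>f\<close> itself up to its mean, are approximated as well.

  Reflection of the circle turns the pair \<open>(W, V)\<close> into a pair of the same kind with the roles of the two
  functions exchanged, so that what concerns one of them need only be proved for \<open>W\<close>.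
\<close>

section \<open>Square-integrable functions on a finite measure space\<close>

definition sq_integrable :: "'a measure \<Rightarrow> ('a \<Rightarrow> real) set" where
  "sq_integrable M = {f \<in> borel_measurable M. integrable M (\<lambda>x. (f x)\<^sup>2)}"

lemma sq_integrable_mult:
  assumes "f \<in> sq_integrable M" "g \<in> sq_integrable M"
  shows "integrable M (\<lambda>x. f x * g x)"
proof (rule Bochner_Integration.integrable_bound)
  show "integrable M (\<lambda>x. (f x)\<^sup>2 + (g x)\<^sup>2)"
    using assms by (auto simp: sq_integrable_def)
  show "(\<lambda>x. f x * g x) \<in> borel_measurable M"
    using assms by (auto simp: sq_integrable_def)
  have "\<bar>f x * g x\<bar> \<le> (f x)\<^sup>2 + (g x)\<^sup>2" for x
    using sum_squares_bound[of "\<bar>f x\<bar>" "\<bar>g x\<bar>"] mult_nonneg_nonneg[OF abs_ge_zero[of "f x"] abs_ge_zero[of "g x"]]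
    unfolding abs_mult power2_abs by linarith
  then show "AE x in M. norm (f x * g x) \<le> norm ((f x)\<^sup>2 + (g x)\<^sup>2)"
    by auto
qed

lemma sq_integrable_add:
  assumes "f \<in> sq_integrable M" "g \<in> sq_integrable M"
  shows "(\<lambda>x. f x + g x) \<in> sq_integrable M"
proof -
  have "integrable M (\<lambda>x. (f x)\<^sup>2 + (g x)\<^sup>2 + 2 * (f x * g x))"
    using assms sq_integrable_mult[OF assms] by (auto simp: sq_integrable_def)
  then show ?thesis
    using assms by (auto simp: sq_integrable_def power2_sum algebra_simps)
qed

lemma sq_integrable_cmult:
  "f \<in> sq_integrable M \<Longrightarrow> (\<lambda>x. c * f x) \<in> sq_integrable M"
  by (auto simp: sq_integrable_def power_mult_distrib)

lemma sq_integrable_diff: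
  assumes "f \<in> sq_integrable M" "g \<in> sq_integrable M"
  shows "(\<lambda>x. f x - g x) \<in> sq_integrable M"
  using sq_integrable_add[OF assms(1) sq_integrable_cmult[OF assms(2), of "-1"]] by simp

lemma L2_norm_nonneg [simp]: "0 \<le> L2_norm M f"
  by (simp add: L2_norm_def)

lemma L2_norm_power2: "(L2_norm M f)\<^sup>2 = (\<integral>x. (f x)\<^sup>2 \<partial>M)"
  by (simp add: L2_norm_def)

lemma L2_norm_cmult: "L2_norm M (\<lambda>x. c * f x) = \<bar>c\<bar> * L2_norm M f"
  by (simp add: L2_norm_def power_mult_distrib real_sqrt_mult)

lemma L2_norm_minus_commute: "L2_norm M (\<lambda>x. f x - g x) = L2_norm M (\<lambda>x. g x - f x)"
  by (simp add: L2_norm_def power2_commute)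

lemma L2_norm_cong_AE:
  assumes "f \<in> borel_measurable M" "g \<in> borel_measurable M" "AE x in M. f x = g x"
  shows "L2_norm M f = L2_norm M g"
  unfolding L2_norm_def
  by (rule arg_cong[where f=sqrt], rule integral_cong_AE) (use assms in auto)

text \<open>The quadratic \<open>t \<mapsto> \<parallel>f + t g\<parallel>\<^sup>2\<close> is nonnegative, so its discriminant is not positive.\<close>

lemma L2_Cauchy_Schwarz:
  assumes f: "f \<in> sq_integrable M" and g: "g \<in> sq_integrable M"
  shows "\<bar>\<integral>x. f x * g x \<partial>M\<bar> \<le> L2_norm M f * L2_norm M g"
proof -
  define a b c where "a = (\<integral>x. (g x)\<^sup>2 \<partial>M)" and "b = (\<integral>x. f x * g x \<partial>M)"
    and "c = (\<integral>x. (f x)\<^sup>2 \<partial>M)"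
  have if2: "integrable M (\<lambda>x. (f x)\<^sup>2)" and ig2: "integrable M (\<lambda>x. (g x)\<^sup>2)"
    using f g by (auto simp: sq_integrable_def)
  have q: "0 \<le> c + 2 * t * b + t\<^sup>2 * a" for t
  proof -
    have "0 \<le> (\<integral>x. (f x + t * g x)\<^sup>2 \<partial>M)" by simp
    also have "\<dots> = (\<integral>x. (f x)\<^sup>2 + 2 * t * (f x * g x) + t\<^sup>2 * (g x)\<^sup>2 \<partial>M)"
      by (simp add: power2_sum power_mult_distrib algebra_simps)
    also have "\<dots> = c + 2 * t * b + t\<^sup>2 * a"
      using if2 ig2 sq_integrable_mult[OF f g] by (simp add: a_def b_def c_def)
    finally show ?thesis .
  qed
  have a0: "0 \<le> a" and c0: "0 \<le> c" by (simp_all add: a_def c_def)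
  have "b\<^sup>2 \<le> a * c"
  proof (cases "a = 0")
    case True
    have "b = 0"
    proof (rule ccontr)
      assume "b \<noteq> 0"
      with q[of "- (c + 1) / (2 * b)"] True show False by (simp add: field_simps)
    qed
    with True show ?thesis by simp
  next
    case False
    with a0 have "0 < a" by simp
    with q[of "- b / a"] show ?thesis
      by (simp add: field_simps power2_eq_square)
  qed
  then have "\<bar>b\<bar> \<le> sqrt (a * c)"
    by (metis real_sqrt_abs real_sqrt_le_iff)
  then show ?thesis
    by (simp add: L2_norm_def a_def b_def c_def real_sqrt_mult mult.commute)
qed

lemma L2_norm_triangle:
  assumes f: "f \<in> sq_integrable M" and g: "g \<in> sq_integrable M"
  shows "L2_norm M (\<lambda>x. f x + g x) \<le> L2_norm M f + L2_norm M g"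
proof (rule power2_le_imp_le)
  have "(L2_norm M (\<lambda>x. f x + g x))\<^sup>2 = (\<integral>x. (f x)\<^sup>2 + (g x)\<^sup>2 + 2 * (f x * g x) \<partial>M)"
    by (simp add: L2_norm_power2 power2_sum algebra_simps)
  also have "\<dots> = (L2_norm M f)\<^sup>2 + (L2_norm M g)\<^sup>2 + 2 * (\<integral>x. f x * g x \<partial>M)"
    using f g sq_integrable_mult[OF f g] by (simp add: L2_norm_power2 sq_integrable_def)
  also have "\<dots> \<le> (L2_norm M f + L2_norm M g)\<^sup>2"
    using L2_Cauchy_Schwarz[OF f g] by (simp add: power2_sum abs_le_iff)
  finally show "(L2_norm M (\<lambda>x. f x + g x))\<^sup>2 \<le> (L2_norm M f + L2_norm M g)\<^sup>2" .
qed simp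

lemma L2_norm_triangle_diff:
  assumes "f \<in> sq_integrable M" "g \<in> sq_integrable M" "h \<in> sq_integrable M"
  shows "L2_norm M (\<lambda>x. f x - h x) \<le> L2_norm M (\<lambda>x. f x - g x) + L2_norm M (\<lambda>x. g x - h x)"
  using L2_norm_triangle[OF sq_integrable_diff[OF assms(1,2)] sq_integrable_diff[OF assms(2,3)]]
  by simp

lemma L2_norm_eq_0_AE:
  assumes "f \<in> sq_integrable M" "L2_norm M f = 0"
  shows "AE x in M. f x = 0"
proof -
  have "(\<integral>x. (f x)\<^sup>2 \<partial>M) = 0" using assms(2) by (simp add: L2_norm_def)
  then have "AE x in M. (f x)\<^sup>2 = 0"
    using assms(1) by (subst (asm) integral_nonneg_eq_0_iff_AE) (auto simp: sq_integrable_def)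
  then show ?thesis by simp
qed

locale finite_real_measure = finite_measure M for M :: "real measure"
begin

lemma sq_integrable_bounded:
  assumes "f \<in> borel_measurable M" "\<And>x. x \<in> space M \<Longrightarrow> \<bar>f x\<bar> \<le> B"
  shows "f \<in> sq_integrable M"
proof -
  have "norm ((f x)\<^sup>2) \<le> B\<^sup>2" if "x \<in> space M" for x
    using assms(2)[OF that] by (auto simp: power2_le_iff_abs_le intro: order_trans[OF abs_ge_zero])
  then show ?thesis
    using assms(1) by (auto simp: sq_integrable_def intro!: integrable_const_bound[of _ "B\<^sup>2"] AE_I2)
qed

lemma sq_integrable_const [simp]: "(\<lambda>x. c) \<in> sq_integrable M"
  by (rule sq_integrable_bounded[of _ "\<bar>c\<bar>"]) auto

lemma sq_integrable_imp_integrable: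
  "f \<in> sq_integrable M \<Longrightarrow> integrable M f"
  using sq_integrable_mult[of f M "\<lambda>_. 1"] by simp

lemma L2_norm_le_sup:
  assumes "f \<in> borel_measurable M" "\<And>x. x \<in> space M \<Longrightarrow> \<bar>f x\<bar> \<le> B" "0 \<le> B"
  shows "L2_norm M f \<le> sqrt (measure M (space M)) * B"
proof -
  have sq: "(f x)\<^sup>2 \<le> B\<^sup>2" if "x \<in> space M" for x
    using assms(2)[OF that] assms(3) by (simp add: power2_le_iff_abs_le)
  have "(\<integral>x. (f x)\<^sup>2 \<partial>M) \<le> (\<integral>x. B\<^sup>2 \<partial>M)"
    using sq_integrable_bounded[OF assms(1,2)] sq
    by (intro integral_mono) (auto simp: sq_integrable_def)
  also have "\<dots> = measure M (space M) * B\<^sup>2" by simp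
  finally show ?thesis
    using assms(3) by (auto simp: L2_norm_def real_sqrt_mult dest: real_sqrt_le_mono)
qed

lemma integral_abs_le_L2_norm:
  assumes "f \<in> sq_integrable M"
  shows "(\<integral>x. \<bar>f x\<bar> \<partial>M) \<le> sqrt (measure M (space M)) * L2_norm M f"
proof -
  have "(\<lambda>x. \<bar>f x\<bar>) \<in> sq_integrable M" using assms by (auto simp: sq_integrable_def)
  from L2_Cauchy_Schwarz[OF this sq_integrable_const[of 1]]
  have "\<bar>\<integral>x. \<bar>f x\<bar> \<partial>M\<bar> \<le> L2_norm M (\<lambda>x. \<bar>f x\<bar>) * L2_norm M (\<lambda>x. 1)" by simp
  then show ?thesis by (simp add: L2_norm_def mult.commute)
qed

text \<open>This is the induction behind density statements in \<open>L\<^sup>2\<close>: the sets whose indicators lie in a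
  closed subspace with the constants form a Dynkin system, and simple functions are dense.\<close>

lemma closed_subspace_eq_sq_integrable:
  fixes A :: "(real \<Rightarrow> real) set"
  assumes gen: "sets M = sigma_sets (space M) E" "Int_stable E" "E \<subseteq> Pow (space M)"
    and ind: "\<And>S. S \<in> E \<Longrightarrow> indicator S \<in> A"
    and one: "(\<lambda>x. 1) \<in> A"
    and add: "\<And>f g. f \<in> A \<Longrightarrow> g \<in> A \<Longrightarrow> (\<lambda>x. f x + g x) \<in> A"
    and scale: "\<And>f c. f \<in> A \<Longrightarrow> (\<lambda>x. c * f x) \<in> A"
    and closed: "\<And>f. f \<in> sq_integrable M \<Longrightarrow>
      (\<And>e. 0 < e \<Longrightarrow> \<exists>g\<in>A. g \<in> sq_integrable M \<and> L2_norm M (\<lambda>x. f x - g x) < e) \<Longrightarrow> f \<in> A"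
    and f: "f \<in> sq_integrable M"
  shows "f \<in> A"
proof -
  have cl: "f \<in> A" if f: "f \<in> sq_integrable M" and s: "\<And>i::nat. s i \<in> A" "\<And>i. s i \<in> sq_integrable M"
    and lim: "\<And>x. x \<in> space M \<Longrightarrow> (\<lambda>i. s i x) \<longlonglongrightarrow> f x" 
    and bd: "\<And>i x. x \<in> space M \<Longrightarrow> \<bar>s i x - f x\<bar> \<le> \<bar>h x\<bar>" and h: "h \<in> sq_integrable M" for f s h
  proof (rule closed[OF f])
    fix e :: real assume e: "0 < e"
    have "(\<lambda>i. \<integral>x. (f x - s i x)\<^sup>2 \<partial>M) \<longlonglongrightarrow> (\<integral>x. 0 \<partial>M)"
    proof (rule integral_dominated_convergence[where w="\<lambda>x. (h x)\<^sup>2"])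
      show "integrable M (\<lambda>x. (h x)\<^sup>2)" using h by (simp add: sq_integrable_def)
      show "(\<lambda>x. (f x - s i x)\<^sup>2) \<in> borel_measurable M" for i
        using f s(2)[of i] by (auto simp: sq_integrable_def)
      have "norm ((f x - s i x)\<^sup>2) \<le> (h x)\<^sup>2" if "x \<in> space M" for x i
        using bd[OF that, of i] by (simp add: power2_le_iff_abs_le power2_commute abs_le_square_iff[symmetric])
      then show "AE x in M. norm ((f x - s i x)\<^sup>2) \<le> (h x)\<^sup>2" for i by auto
      have "(\<lambda>i. (f x - s i x)\<^sup>2) \<longlonglongrightarrow> 0" if "x \<in> space M" for x
        using tendsto_power[OF tendsto_diff[OF tendsto_const lim[OF that]], of "f x" 2] by simp
      then show "AE x in M. (\<lambda>i. (f x - s i x)\<^sup>2) \<longlonglongrightarrow> 0" by auto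
    qed auto
    then have "(\<lambda>i. L2_norm M (\<lambda>x. f x - s i x)) \<longlonglongrightarrow> 0"
      unfolding L2_norm_def using tendsto_real_sqrt by fastforce
    then obtain i where "L2_norm M (\<lambda>x. f x - s i x) < e"
      using e by (metis (no_types, lifting) eventually_sequentially order_tendstoD(2) order_refl)
    then show "\<exists>g\<in>A. g \<in> sq_integrable M \<and> L2_norm M (\<lambda>x. f x - g x) < e"
      using s by auto
  qed
  have ind_sq: "indicator S \<in> sq_integrable M" if "S \<in> sets M" for S
    by (rule sq_integrable_bounded[of _ 1]) (use that in \<open>auto split: split_indicator\<close>)
  have zero: "(\<lambda>x. 0) \<in> A" using scale[OF one, of 0] by simp
  have indA: "indicator S \<in> A" if "S \<in> sets M" for S
    using gen(2,3) that[unfolded gen(1)]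
  proof (induction rule: sigma_sets_induct_disjoint)
    case (basic S) then show ?case by (rule ind)
  next
    case empty then show ?case using zero by (simp add: indicator_def[abs_def])
  next
    case (compl S)
    then have S: "S \<in> sets M" by (simp add: gen(1))
    have g: "(\<lambda>x. 1 + (-1) * indicator S x) \<in> A"
      using add[OF one scale[OF compl(2), of "-1"]] .
    show ?case
    proof (rule cl[where s="\<lambda>_ x. 1 + (-1) * indicator S x" and h="\<lambda>_. 0"])
      show "indicator (space M - S) \<in> sq_integrable M" using S by (intro ind_sq) auto
      show "(\<lambda>x. 1 + (-1) * indicator S x) \<in> sq_integrable M"
        using S by (intro sq_integrable_add sq_integrable_cmult ind_sq) auto
    qed (use g in \<open>auto split: split_indicator\<close>)
  next
    case (union S)
    then have S: "S i \<in> sets M" for i by (auto simp: gen(1))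
    show ?case
    proof (rule cl[where s="\<lambda>n x. \<Sum>i<n. indicator (S i) x" and h="\<lambda>_. 1"])
      show "indicator (\<Union>i. S i) \<in> sq_integrable M" using S by (intro ind_sq) auto
      show "(\<lambda>x. \<Sum>i<n. indicator (S i) x) \<in> A" for n
        by (induction n) (use zero union add in auto)
      show "(\<lambda>x. \<Sum>i<n. indicator (S i) x) \<in> sq_integrable M" for n
        by (induction n) (use S in \<open>auto intro!: sq_integrable_add ind_sq\<close>)
      have eq: "(\<Sum>i<n. indicator (S i) x) = (indicator (\<Union>i<n. S i) x :: real)" for n x
        by (subst indicator_UN_disjoint)
          (use union(1) in \<open>auto simp: disjoint_family_on_def\<close>)
      show "(\<lambda>n. \<Sum>i<n. indicator (S i) x) \<longlonglongrightarrow> (indicator (\<Union>i. S i) x :: real)" for x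
        unfolding eq by (rule LIMSEQ_indicator_UN)
      show "\<bar>(\<Sum>i<n. indicator (S i) x) - indicator (\<Union>i. S i) x\<bar> \<le> \<bar>1::real\<bar>" for n x
        unfolding eq by (auto split: split_indicator)
    qed auto
  qed
  have simple: "g \<in> A" if g: "simple_function M g" for g :: "real \<Rightarrow> real"
  proof -
    have fin: "finite (g ` space M)" using g by (simp add: simple_function_def)
    have msr: "g -` {y} \<inter> space M \<in> sets M" for y using g by (rule simple_functionD)
    let ?s = "\<lambda>x. \<Sum>y\<in>g ` space M. y * indicator (g -` {y} \<inter> space M) x"
    have eq: "?s x = g x" if "x \<in> space M" for x
    proof -
      have "?s x = (\<Sum>y\<in>g ` space M. if y = g x then y else 0)"
        using that by (intro sum.cong) (auto simp: indicator_def)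
      then show ?thesis using fin that by simp
    qed
    show ?thesis
    proof (rule cl[where s="\<lambda>_. ?s" and h="\<lambda>_. 0"])
      show "?s \<in> A"
        using fin
      proof (induction rule: finite_induct)
        case (insert y F)
        have "(\<lambda>x. y * indicator (g -` {y} \<inter> space M) x
            + (\<Sum>y\<in>F. y * indicator (g -` {y} \<inter> space M) x)) \<in> A"
          by (intro add scale indA msr insert.IH)
        then show ?case by (simp only: sum.insert[OF insert.hyps])
      qed (use zero in simp)
      show s: "?s \<in> sq_integrable M"
        using fin
      proof (induction rule: finite_induct)
        case (insert y F)
        have "(\<lambda>x. y * indicator (g -` {y} \<inter> space M) x
            + (\<Sum>y\<in>F. y * indicator (g -` {y} \<inter> space M) x)) \<in> sq_integrable M"
          by (intro sq_integrable_add sq_integrable_cmult ind_sq msr insert.IH)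
        then show ?case by (simp only: sum.insert[OF insert.hyps])
      qed (use sq_integrable_const[of 0] in simp)
      show "g \<in> sq_integrable M"
        using fin g by (intro sq_integrable_bounded[of _ "Max (abs ` g ` space M)"])
          (auto intro: borel_measurable_simple_function)
    qed (simp_all add: eq)
  qed
  have "f \<in> borel_measurable M" using f by (simp add: sq_integrable_def)
  from borel_measurable_implies_sequence_metric[OF this, of 0]
  obtain s where s: "\<And>i. simple_function M (s i)"
    "\<And>x. x \<in> space M \<Longrightarrow> (\<lambda>i. s i x) \<longlonglongrightarrow> f x"
    "\<And>i x. x \<in> space M \<Longrightarrow> norm (s i x) \<le> 2 * norm (f x)"
    unfolding dist_real_def by (metis diff_zero real_norm_def)
  show ?thesis
  proof (rule cl[OF f, where s=s and h="\<lambda>x. 3 * f x"])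
    show "s i \<in> sq_integrable M" for i
      using s(1)[of i] by (intro sq_integrable_bounded[of _ "Max (abs ` s i ` space M)"])
        (auto intro: borel_measurable_simple_function simp: simple_function_def)
    show "\<bar>s i x - f x\<bar> \<le> \<bar>3 * f x\<bar>" if "x \<in> space M" for i x
      using s(3)[OF that, of i] by (auto simp: abs_mult)
    show "(\<lambda>x. 3 * f x) \<in> sq_integrable M" by (rule sq_integrable_cmult[OF f])
  qed (use s simple in auto)
qed

end

section \<open>One-sided continuous periodic functions and reflection\<close>

definition refl_fun :: "(real \<Rightarrow> real) \<Rightarrow> real \<Rightarrow> real" where
  "refl_fun f = (\<lambda>x. f (- x))"

definition flip :: "(real \<Rightarrow> real) \<Rightarrow> real \<Rightarrow> real" where
  "flip U = (\<lambda>x. - U (- x))"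

lemma refl_fun_refl_fun [simp]: "refl_fun (refl_fun f) = f"
  by (simp add: refl_fun_def)

lemma flip_flip [simp]: "flip (flip U) = U"
  by (simp add: flip_def)

lemma refl_fun_diff: "refl_fun (\<lambda>x. f x - g x) = (\<lambda>x. refl_fun f x - refl_fun g x)"
  by (simp add: refl_fun_def)

lemma refl_fun_measurable [simp]: "refl_fun f \<in> borel_measurable borel \<longleftrightarrow> f \<in> borel_measurable borel"
proof -
  have "f \<in> borel_measurable borel \<Longrightarrow> refl_fun f \<in> borel_measurable borel" for f
    unfolding refl_fun_def
    by (rule measurable_compose[where g=f and f=uminus]) simp_all
  from this[of f] this[of "refl_fun f"] show ?thesis by (metis refl_fun_refl_fun)
qed

lemma circle_fun_refl [simp]: "circle_fun (refl_fun f) \<longleftrightarrow> circle_fun f"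
proof -
  have "circle_fun (refl_fun f)" if "circle_fun f" for f
    unfolding circle_fun_def refl_fun_def
  proof
    fix x :: real
    have "f (- x - 1 + 1) = f (- x - 1)"
      using that unfolding circle_fun_def by blast
    then show "f (- (x + 1)) = f (- x)" by (metis add.commute diff_add_cancel minus_add_distrib uminus_add_conv_diff)
  qed
  from this[of f] this[of "refl_fun f"] show ?thesis by (metis refl_fun_refl_fun)
qed

lemma tendsto_at_left_refl: "(f \<longlongrightarrow> l) (at_left x) \<longleftrightarrow> (refl_fun f \<longlongrightarrow> l) (at_right (- x))"
  by (simp add: refl_fun_def filterlim_at_left_to_right)

lemma tendsto_at_right_refl: "(f \<longlongrightarrow> l) (at_right x) \<longleftrightarrow> (refl_fun f \<longlongrightarrow> l) (at_left (- x))"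
  using tendsto_at_left_refl[of "refl_fun f" l "- x"] by simp

lemma cadlag_refl [simp]: "cadlag (refl_fun f) \<longleftrightarrow> caglad f"
proof -
  have "cadlag (refl_fun f) \<longleftrightarrow> (\<forall>x. (refl_fun f \<longlongrightarrow> f (- x)) (at_right x) \<and> (\<exists>l. (refl_fun f \<longlongrightarrow> l) (at_left x)))"
    by (simp add: cadlag_def continuous_within refl_fun_def)
  also have "\<dots> \<longleftrightarrow> (\<forall>x. (refl_fun f \<longlongrightarrow> f x) (at_right (- x)) \<and> (\<exists>l. (refl_fun f \<longlongrightarrow> l) (at_left (- x))))"
    by (metis minus_minus)
  also have "\<dots> \<longleftrightarrow> caglad f"
    by (simp add: caglad_def continuous_within tendsto_at_left_refl[symmetric] tendsto_at_right_refl[symmetric])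
  finally show ?thesis .
qed

lemma caglad_refl [simp]: "caglad (refl_fun f) \<longleftrightarrow> cadlag f"
  using cadlag_refl[of "refl_fun f"] by simp

lemma cadlag_diff: "cadlag f \<Longrightarrow> cadlag g \<Longrightarrow> cadlag (\<lambda>x. f x - g x)"
  by (auto simp: cadlag_def intro!: continuous_diff) (blast intro: tendsto_diff)

lemma caglad_diff: "caglad f \<Longrightarrow> caglad g \<Longrightarrow> caglad (\<lambda>x. f x - g x)"
  by (auto simp: caglad_def intro!: continuous_diff) (blast intro: tendsto_diff)

lemma cadlag_const [simp]: "cadlag (\<lambda>x. c)"
  by (auto simp: cadlag_def intro: tendsto_const)

lemma caglad_const [simp]: "caglad (\<lambda>x. c)"
  by (auto simp: caglad_def intro: tendsto_const)

lemma caglad_cmult: "caglad f \<Longrightarrow> caglad (\<lambda>x. c * f x)"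
  by (auto simp: caglad_def intro!: continuous_mult_left) (blast intro: tendsto_mult_left)

lemma cadlag_cmult: "cadlag f \<Longrightarrow> cadlag (\<lambda>x. c * f x)"
  by (auto simp: cadlag_def intro!: continuous_mult_left) (blast intro: tendsto_mult_left)

text \<open>A left-continuous function is the pointwise limit of the step functions that sample it at the
  last point of a grid strictly to the left.\<close>

lemma caglad_borel_measurable:
  assumes "caglad f"
  shows "f \<in> borel_measurable borel"
proof (rule borel_measurable_LIMSEQ_real)
  define z where "z n x = real_of_int (\<lceil>real (Suc n) * x\<rceil> - 1) / real (Suc n)" for n x
  have lt: "z n x < x" and gt: "x - 1 / real (Suc n) \<le> z n x" for n x
  proof -
    have c: "real (Suc n) * x \<le> real_of_int \<lceil>real (Suc n) * x\<rceil>"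
      "real_of_int \<lceil>real (Suc n) * x\<rceil> < real (Suc n) * x + 1"
      by linarith+
    show "z n x < x" using c(2) by (simp add: z_def divide_less_eq mult.commute)
    have "z n x - (x - 1 / real (Suc n)) = (real_of_int \<lceil>real (Suc n) * x\<rceil> - real (Suc n) * x) / real (Suc n)"
      by (simp add: z_def diff_divide_distrib del: of_nat_Suc)
    also have "0 \<le> \<dots>" using c(1) by simp
    finally show "x - 1 / real (Suc n) \<le> z n x" by simp
  qed
  show "(\<lambda>n. f (z n x)) \<longlonglongrightarrow> f x" for x
  proof -
    have "(\<lambda>n. x - 1 / real (Suc n)) \<longlonglongrightarrow> x - 0"
      by (intro tendsto_diff tendsto_const LIMSEQ_Suc[OF lim_1_over_n])
    then have lim: "(\<lambda>n. x - 1 / real (Suc n)) \<longlonglongrightarrow> x" by simp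
    have "(\<lambda>n. z n x) \<longlonglongrightarrow> x"
    proof (rule tendsto_sandwich[OF _ _ lim tendsto_const])
      show "\<forall>\<^sub>F n in sequentially. x - 1 / real (Suc n) \<le> z n x" using gt by simp
      show "\<forall>\<^sub>F n in sequentially. z n x \<le> x" using lt by (simp add: less_imp_le)
    qed
    then have "filterlim (\<lambda>n. z n x) (at_left x) sequentially"
      using lt by (auto simp: filterlim_at intro!: always_eventually less_imp_neq)
    moreover have "(f \<longlongrightarrow> f x) (at_left x)"
      using assms by (simp add: caglad_def continuous_within)
    ultimately show ?thesis by (rule filterlim_compose[rotated])
  qed
  show "(\<lambda>x. f (z n x)) \<in> borel_measurable borel" for n
  proof -
    have "(\<lambda>x. \<lceil>real (Suc n) * x\<rceil>) \<in> measurable borel (count_space UNIV)"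
      by measurable
    from measurable_compose[OF this, of "\<lambda>k. f (real_of_int (k - 1) / real (Suc n))" borel]
    show ?thesis by (simp add: z_def)
  qed
qed

lemma cadlag_borel_measurable: "cadlag f \<Longrightarrow> f \<in> borel_measurable borel"
  using caglad_borel_measurable[of "refl_fun f"] by simp

lemma circle_fun_add_int:
  assumes "circle_fun f"
  shows "f (x + of_int n) = f x"
proof -
  have *: "f (x + real k) = f x" for k x
  proof (induction k)
    case (Suc k)
    have "f (x + real k + 1) = f (x + real k)" using assms by (simp add: circle_fun_def)
    with Suc show ?case by (simp add: algebra_simps)
  qed simp
  show ?thesis
  proof (cases "0 \<le> n")
    case True
    then show ?thesis using *[of x "nat n"] by simp
  next
    case False
    then show ?thesis using *[of "x + of_int n" "nat (- n)"] by simp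
  qed
qed

lemma circle_fun_frac: "circle_fun f \<Longrightarrow> f (frac x) = f x"
  using circle_fun_add_int[of f x "- \<lfloor>x\<rfloor>"] by (simp add: frac_def)

lemma circle_fun_from_unit_interval:
  assumes "circle_fun f" "\<And>x. 0 \<le> x \<Longrightarrow> x < 1 \<Longrightarrow> P (f x)"
  shows "P (f x)"
  using assms(2)[of "frac x"] circle_fun_frac[OF assms(1), of x] frac_lt_1[of x] by simp

text \<open>One-sided limits bound the function near every point; compactness of the period does the rest.\<close>

lemma circle_cadlag_bounded:
  assumes "circle_fun f" "cadlag f"
  obtains B where "0 \<le> B" "\<And>x. \<bar>f x\<bar> \<le> B"
proof -
  have loc: "\<exists>e>0. \<exists>B. \<forall>y\<in>ball x e. \<bar>f y\<bar> \<le> B" for x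
  proof -
    obtain l where l: "(f \<longlongrightarrow> l) (at_left x)" using assms by (auto simp: cadlag_def)
    have r: "(f \<longlongrightarrow> f x) (at_right x)" using assms by (simp add: cadlag_def continuous_within)
    from tendstoD[OF l zero_less_one] obtain a where a: "a < x" "\<And>y. a < y \<Longrightarrow> y < x \<Longrightarrow> dist (f y) l < 1"
      unfolding eventually_at_left_field by auto
    from tendstoD[OF r zero_less_one] obtain b where b: "x < b" "\<And>y. x < y \<Longrightarrow> y < b \<Longrightarrow> dist (f y) (f x) < 1"
      unfolding eventually_at_right_field by auto
    show ?thesis
    proof (intro exI conjI ballI)
      show "0 < min (x - a) (b - x)" using a b by simp
      fix y assume "y \<in> ball x (min (x - a) (b - x))"
      then have y: "a < y" "y < b" by (auto simp: dist_real_def)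
      show "\<bar>f y\<bar> \<le> \<bar>l\<bar> + \<bar>f x\<bar> + 1"
        using a(2)[of y] b(2)[of y] y by (cases x y rule: linorder_cases) (auto simp: dist_real_def)
    qed
  qed
  then obtain e B where eB: "\<And>x. 0 < e x" "\<And>x y. y \<in> ball x (e x) \<Longrightarrow> \<bar>f y\<bar> \<le> B x"
    by metis
  have "{0..1::real} \<subseteq> (\<Union>x\<in>{0..1}. ball x (e x))" using eB(1) by force
  then obtain D where D: "D \<subseteq> {0..1}" "finite D" "{0..1} \<subseteq> (\<Union>x\<in>D. ball x (e x))"
    by (rule compactE_image[OF compact_Icc, rotated]) auto
  show ?thesis
  proof (rule that[of "\<Sum>x\<in>D. \<bar>B x\<bar>"])
    show "0 \<le> (\<Sum>x\<in>D. \<bar>B x\<bar>)" by (simp add: sum_nonneg)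
    have "\<bar>f y\<bar> \<le> (\<Sum>x\<in>D. \<bar>B x\<bar>)" if y: "0 \<le> y" "y < 1" for y
    proof -
      from y D(3) obtain x where x: "x \<in> D" "y \<in> ball x (e x)" by force
      have "\<bar>f y\<bar> \<le> \<bar>B x\<bar>" using eB(2)[OF x(2)] by simp
      also have "\<dots> \<le> (\<Sum>x\<in>D. \<bar>B x\<bar>)" using x D(2) by (intro member_le_sum) auto
      finally show ?thesis .
    qed
    then show "\<bar>f y\<bar> \<le> (\<Sum>x\<in>D. \<bar>B x\<bar>)" for y
      by (rule circle_fun_from_unit_interval[OF assms(1)])
  qed
qed

lemma circle_caglad_bounded:
  assumes "circle_fun f" "caglad f"
  obtains B where "0 \<le> B" "\<And>x. \<bar>f x\<bar> \<le> B"
proof -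
  obtain B where "0 \<le> B" "\<And>x. \<bar>refl_fun f x\<bar> \<le> B"
    using circle_cadlag_bounded[of "refl_fun f"] assms by auto
  then show ?thesis using that[of B] by (metis minus_minus refl_fun_def)
qed

lemma uniform_limit_has_limit:
  fixes f :: "nat \<Rightarrow> real \<Rightarrow> real"
  assumes u: "uniform_limit UNIV f g sequentially" and lim: "\<And>n. \<exists>l. (f n \<longlongrightarrow> l) F" and "F \<noteq> bot"
  shows "\<exists>l. (g \<longlongrightarrow> l) F"
proof -
  obtain l where l: "\<And>n. (f n \<longlongrightarrow> l n) F" using lim by metis
  have "Cauchy l"
  proof (rule metric_CauchyI)
    fix e :: real assume "0 < e"
    then have "\<forall>\<^sub>F n in sequentially. \<forall>x\<in>UNIV. dist (f n x) (g x) < e / 4"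
      using u by (intro uniform_limitD) auto
    then obtain N where N: "\<And>n x. N \<le> n \<Longrightarrow> dist (f n x) (g x) < e / 4"
      by (auto simp: eventually_sequentially)
    show "\<exists>N. \<forall>m\<ge>N. \<forall>n\<ge>N. dist (l m) (l n) < e"
    proof (intro exI allI impI)
      fix m n assume mn: "N \<le> m" "N \<le> n"
      have "dist (f m x) (f n x) \<le> e / 2" for x
        using N[OF mn(1), of x] N[OF mn(2), of x] dist_triangle2[of "f m x" "f n x" "g x"] by simp
      moreover have "((\<lambda>x. dist (f m x) (f n x)) \<longlongrightarrow> dist (l m) (l n)) F"
        by (intro tendsto_dist l)
      ultimately have "dist (l m) (l n) \<le> e / 2"
        using \<open>F \<noteq> bot\<close> by (intro tendsto_upperbound) auto
      then show "dist (l m) (l n) < e" using \<open>0 < e\<close> by simp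
    qed
  qed
  then obtain k where "l \<longlonglongrightarrow> k" by (auto simp: Cauchy_convergent_iff convergent_def)
  then have "(g \<longlongrightarrow> k) F"
    by (rule swap_uniform_limit'[OF _ _ u, rotated]) (use l in \<open>auto intro!: always_eventually\<close>)
  then show ?thesis ..
qed

lemma cadlag_uniform_limit:
  assumes u: "uniform_limit UNIV f g sequentially" and f: "\<And>n. cadlag (f n)"
  shows "cadlag g"
  unfolding cadlag_def
proof (intro allI conjI)
  fix x :: real
  have "(\<lambda>n. f n x) \<longlonglongrightarrow> g x" using tendsto_uniform_limitI[OF u] by simp
  then have "(g \<longlongrightarrow> g x) (at_right x)"
    by (rule swap_uniform_limit'[OF _ _ u, rotated]) (use f in \<open>auto simp: cadlag_def continuous_within\<close>)
  then show "continuous (at_right x) g" by (simp add: continuous_within)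
  show "\<exists>l. (g \<longlongrightarrow> l) (at_left x)"
    by (rule uniform_limit_has_limit[OF u]) (use f in \<open>auto simp: cadlag_def\<close>)
qed

lemma uniform_limit_refl:
  assumes "uniform_limit UNIV f g F"
  shows "uniform_limit UNIV (\<lambda>n. refl_fun (f n)) (refl_fun g) F"
proof (rule uniform_limitI)
  fix e :: real assume "0 < e"
  with assms have "\<forall>\<^sub>F n in F. \<forall>x\<in>UNIV. dist (f n x) (g x) < e"
    by (rule uniform_limitD)
  then show "\<forall>\<^sub>F n in F. \<forall>x\<in>UNIV. dist (refl_fun (f n) x) (refl_fun g x) < e"
    by eventually_elim (simp add: refl_fun_def)
qed

lemma caglad_uniform_limit:
  assumes u: "uniform_limit UNIV f g sequentially" and f: "\<And>n. caglad (f n)"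
  shows "caglad g"
  using cadlag_uniform_limit[OF uniform_limit_refl[OF u]] f by simp

lemma circle_fun_uniform_limit:
  assumes u: "uniform_limit UNIV f g sequentially" and f: "\<And>n. circle_fun (f n)"
  shows "circle_fun g"
  unfolding circle_fun_def
proof
  fix x :: real
  have "(\<lambda>n. f n x) \<longlonglongrightarrow> g x" "(\<lambda>n. f n (x + 1)) \<longlonglongrightarrow> g (x + 1)"
    using tendsto_uniform_limitI[OF u] by auto
  moreover have "f n (x + 1) = f n x" for n using f by (simp add: circle_fun_def)
  ultimately show "g (x + 1) = g x" by (simp add: LIMSEQ_unique)
qed

lemma mono_has_left_limit:
  fixes f :: "real \<Rightarrow> real"
  assumes "mono f"
  shows "\<exists>l. (f \<longlongrightarrow> l) (at_left x)"
proof
  let ?l = "SUP y\<in>{..<x}. f y"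
  have bdd: "bdd_above (f ` {..<x})"
    by (rule bdd_aboveI[of _ "f x"]) (use assms in \<open>auto simp: mono_def\<close>)
  show "(f \<longlongrightarrow> ?l) (at_left x)"
  proof (rule increasing_tendsto)
    show "\<forall>\<^sub>F y in at_left x. f y \<le> ?l"
      unfolding eventually_at_left_field
      by (intro exI[of _ "x - 1"]) (auto intro!: cSUP_upper bdd)
    fix z assume "z < ?l"
    then obtain y where y: "y < x" "z < f y"
      by (subst (asm) less_cSUP_iff[OF _ bdd]) auto
    show "\<forall>\<^sub>F u in at_left x. z < f u"
      unfolding eventually_at_left_field
      using y assms by (intro exI[of _ y]) (auto simp: mono_def intro: less_le_trans)
  qed
qed

section \<open>Primitives with respect to a periodic Stieltjes measure\<close>

text \<open>The value at negative arguments has the sign that makes every increment over \<open>(a, b]\<close> the integral over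
  \<open>(a, b]\<close>, so that periodicity and derivatives can be studied on the whole line.\<close>

definition primitive :: "(real \<Rightarrow> real) \<Rightarrow> (real \<Rightarrow> real) \<Rightarrow> real \<Rightarrow> real" where
  "primitive W F x = (if 0 \<le> x then LINT t:{0<..x}|interval_measure W. F t
     else - (LINT t:{x<..0}|interval_measure W. F t))"

locale stieltjes_circle =
  fixes W :: "real \<Rightarrow> real"
  assumes strict: "strict_mono W" and cadlag: "cadlag W"
    and periodic_increments: "\<And>x. W (x + 1) - W x = W 1 - W 0"
begin

abbreviation \<mu> where "\<mu> \<equiv> interval_measure W"

lemma mono: "x \<le> y \<Longrightarrow> W x \<le> W y"
  using strict by (simp add: strict_mono_less_eq)

lemma less: "x < y \<Longrightarrow> W x < W y"
  using strict by (simp add: strict_mono_less)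

lemma right_continuous: "continuous (at_right x) W"
  using cadlag by (simp add: cadlag_def)

lemma emeasure_Ioc: "a \<le> b \<Longrightarrow> emeasure \<mu> {a<..b} = ennreal (W b - W a)"
  using mono right_continuous by (intro emeasure_interval_measure_Ioc) auto

lemma measure_Ioc: "a \<le> b \<Longrightarrow> measure \<mu> {a<..b} = W b - W a"
  using mono right_continuous by (intro measure_interval_measure_Ioc) auto

text \<open>Half-open intervals determine the measure, and a shift by a period preserves the increments of \<open>W\<close>.\<close>

lemma distr_shift: "distr \<mu> borel (\<lambda>x. x + 1) = \<mu>"
proof (rule measure_eqI_generator_eq[where E="range (\<lambda>(a, b). {a<..b::real})"
      and \<Omega>=UNIV and A="\<lambda>i. {- real i<..real i}"])
  show "Int_stable (range (\<lambda>(a, b). {a<..b::real}))"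
    by (force simp: Int_stable_def)
  have "W (b - 1) - W (a - 1) = W b - W a" for a b
    using periodic_increments[of "a - 1"] periodic_increments[of "b - 1"] by simp
  moreover have "(\<lambda>x. x + 1) -` {a<..b} = {a - 1<..b - 1}" for a b :: real by auto
  ultimately have "emeasure (distr \<mu> borel (\<lambda>x. x + 1)) {a<..b} = emeasure \<mu> {a<..b}" for a b
    by (cases "a \<le> b") (simp_all add: emeasure_distr emeasure_Ioc)
  then show "X \<in> range (\<lambda>(a, b). {a<..b}) \<Longrightarrow> emeasure (distr \<mu> borel (\<lambda>x. x + 1)) X = emeasure \<mu> X" for X
    by auto
  show "sets (distr \<mu> borel (\<lambda>x. x + 1)) = sigma_sets UNIV (range (\<lambda>(a, b). {a<..b}))"
    "sets \<mu> = sigma_sets UNIV (range (\<lambda>(a, b). {a<..b}))"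
    by (simp_all add: borel_sigma_sets_Ioc)
  show "(\<Union>i. {- real i<..real i}) = UNIV"
  proof (intro set_eqI iffI UNIV_I)
    fix x :: real
    obtain n where "\<bar>x\<bar> < real n" using reals_Archimedean2 by blast
    then have "x \<in> {- real n<..real n}" by auto
    then show "x \<in> (\<Union>i. {- real i<..real i})" by blast
  qed
  have "emeasure (distr \<mu> borel (\<lambda>x. x + 1)) {- real i<..real i} = emeasure \<mu> {- real i<..real i}" for i
    by fact
  then show "emeasure (distr \<mu> borel (\<lambda>x. x + 1)) {- real i<..real i} \<noteq> \<infinity>" for i
    by (simp add: emeasure_Ioc)
qed auto

lemma set_integral_shift:
  assumes F: "circle_fun F" and [measurable]: "F \<in> borel_measurable borel"
  shows "(LINT x:{a + 1<..b + 1}|\<mu>. F x) = (LINT x:{a<..b}|\<mu>. F x)"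
    and "set_integrable \<mu> {a + 1<..b + 1} F \<longleftrightarrow> set_integrable \<mu> {a<..b} F"
proof -
  have eq: "indicator {a + 1<..b + 1} (x + 1) *\<^sub>R F (x + 1) = indicator {a<..b} x *\<^sub>R F x" for x
    using F by (auto simp: circle_fun_def split: split_indicator)
  have "(LINT x:{a + 1<..b + 1}|\<mu>. F x)
      = (LINT x|distr \<mu> borel (\<lambda>x. x + 1). indicator {a + 1<..b + 1} x *\<^sub>R F x)"
    by (simp add: distr_shift set_lebesgue_integral_def)
  then show "(LINT x:{a + 1<..b + 1}|\<mu>. F x) = (LINT x:{a<..b}|\<mu>. F x)"
    by (simp add: integral_distr eq[unfolded real_scaleR_def] set_lebesgue_integral_def)
  have "set_integrable \<mu> {a + 1<..b + 1} F
      \<longleftrightarrow> integrable (distr \<mu> borel (\<lambda>x. x + 1)) (\<lambda>x. indicator {a + 1<..b + 1} x *\<^sub>R F x)"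
    by (simp add: distr_shift set_integrable_def)
  then show "set_integrable \<mu> {a + 1<..b + 1} F \<longleftrightarrow> set_integrable \<mu> {a<..b} F"
    by (simp add: integrable_distr_eq eq[unfolded real_scaleR_def] set_integrable_def)
qed

lemma integral_dW:
  fixes f :: "real \<Rightarrow> real"
  shows "(\<integral>x. f x \<partial>dW W) = (LINT x:{0<..1}|\<mu>. f x)"
  unfolding dW_def set_lebesgue_integral_def by (rule integral_restrict_space) simp

lemma integrable_dW:
  fixes f :: "real \<Rightarrow> real"
  shows "integrable (dW W) f \<longleftrightarrow> set_integrable \<mu> {0<..1} f"
  unfolding dW_def set_integrable_def by (rule integrable_restrict_space) simp

lemma space_dW [simp]: "space (dW W) = {0<..1}"
  by (simp add: dW_def space_restrict_space)

lemma measurable_dW: "f \<in> borel_measurable borel \<Longrightarrow> f \<in> borel_measurable (dW W)"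
  unfolding dW_def by (rule measurable_restrict_space1) simp

lemma measure_dW: "measure (dW W) {0<..1} = W 1 - W 0"
  by (simp add: dW_def measure_restrict_space measure_Ioc)

lemma finite_real_measure_dW: "finite_real_measure (dW W)"
  unfolding finite_real_measure_def
  by (rule finite_measureI) (simp add: dW_def emeasure_restrict_space emeasure_Ioc space_restrict_space)

sublocale dW: finite_real_measure "dW W"
  by (rule finite_real_measure_dW)

lemma mass_pos: "0 < W 1 - W 0"
  using less[of 0 1] by simp

lemma set_integrable_period:
  assumes F: "circle_fun F" "F \<in> borel_measurable borel" and int: "integrable (dW W) F"
  shows "set_integrable \<mu> {a<..b} F"
proof -
  have up: "set_integrable \<mu> {real n<..real n + 1} F" for n
  proof (induction n)
    case 0 then show ?case using int by (simp add: integrable_dW)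
  next
    case (Suc n)
    have e: "real (Suc n) = real n + 1" by simp
    show ?case unfolding e set_integral_shift(2)[OF F] by (rule Suc)
  qed
  have down: "set_integrable \<mu> {- real n<..- real n + 1} F" for n
  proof (induction n)
    case 0 then show ?case using int by (simp add: integrable_dW)
  next
    case (Suc n)
    have e: "- real n = - real (Suc n) + 1" by simp
    from Suc show ?case unfolding e set_integral_shift(2)[OF F] .
  qed
  have "set_integrable \<mu> {- real n<..real n} F" for n
  proof (induction n)
    case 0 then show ?case by (simp add: set_integrable_def)
  next
    case (Suc n)
    have e: "{- real (Suc n)<..real (Suc n)}
        = {- real (Suc n)<..- real (Suc n) + 1} \<union> {- real n<..real n} \<union> {real n<..real n + 1}"
      unfolding set_eq_iff Un_iff greaterThanAtMost_iff of_nat_Suc by (intro allI) linarith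
    show ?case
      unfolding e by (rule set_integrable_Un[OF set_integrable_Un[OF down Suc] up]) simp_all
  qed
  note sym = this
  obtain n where n: "max \<bar>a\<bar> \<bar>b\<bar> < real n" using reals_Archimedean2 by blast
  have "{a<..b} \<subseteq> {- real n<..real n}"
    using n by (intro subsetI) (simp add: abs_less_iff)
  then show ?thesis
    by (intro set_integrable_subset[OF sym[of n]]) simp_all
qed

definition locally_integrable :: "(real \<Rightarrow> real) \<Rightarrow> bool" where
  "locally_integrable F \<longleftrightarrow> F \<in> borel_measurable borel \<and> (\<forall>a b. set_integrable \<mu> {a<..b} F)"

lemma locally_integrableI:
  "circle_fun F \<Longrightarrow> F \<in> borel_measurable borel \<Longrightarrow> integrable (dW W) F \<Longrightarrow> locally_integrable F"
  by (simp add: locally_integrable_def set_integrable_period)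

lemma locally_integrable_caglad:
  assumes "circle_fun F" "caglad F"
  shows "locally_integrable F"
proof -
  obtain B where "\<And>x. \<bar>F x\<bar> \<le> B" using circle_caglad_bounded[OF assms] by metis
  then have "integrable (dW W) F"
    using caglad_borel_measurable[OF assms(2)]
    by (intro dW.integrable_const_bound[of _ B]) (auto intro: measurable_dW)
  then show ?thesis using assms caglad_borel_measurable by (intro locally_integrableI) auto
qed

lemma locally_integrable_abs: "locally_integrable F \<Longrightarrow> locally_integrable (\<lambda>x. \<bar>F x\<bar>)"
  by (auto simp: locally_integrable_def intro: set_integrable_abs)

lemma locally_integrable_const: "locally_integrable (\<lambda>_. c)"
  by (rule locally_integrable_caglad) (auto simp: circle_fun_def)

lemma set_integral_split:
  assumes "locally_integrable F" "a \<le> b" "b \<le> c"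
  shows "(LINT x:{a<..c}|\<mu>. F x) = (LINT x:{a<..b}|\<mu>. F x) + (LINT x:{b<..c}|\<mu>. F x)"
proof -
  have "{a<..c} = {a<..b} \<union> {b<..c}" using assms by auto
  then show ?thesis
    using assms(1) by (auto simp: locally_integrable_def intro!: set_integral_Un)
qed

lemma primitive_diff:
  assumes F: "locally_integrable F" and "a \<le> b"
  shows "primitive W F b - primitive W F a = (LINT x:{a<..b}|\<mu>. F x)"
  using set_integral_split[OF F, of 0 a b] set_integral_split[OF F, of a 0 b]
    set_integral_split[OF F, of a b 0] assms(2)
  by (auto simp: primitive_def)

lemma primitive_0 [simp]: "primitive W F 0 = 0"
  by (simp add: primitive_def set_lebesgue_integral_def)

lemma set_integral_lower_bound:
  assumes F: "locally_integrable F" and "a \<le> b" and "\<And>x. a < x \<Longrightarrow> x \<le> b \<Longrightarrow> l \<le> F x"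
  shows "l * (W b - W a) \<le> (LINT x:{a<..b}|\<mu>. F x)"
proof -
  have "(LINT x:{a<..b}|\<mu>. l) = l * (W b - W a)"
    using assms(2) by (subst set_integral_const) (auto simp: emeasure_Ioc measure_Ioc)
  moreover have "(LINT x:{a<..b}|\<mu>. l) \<le> (LINT x:{a<..b}|\<mu>. F x)"
    using F locally_integrable_const[of l] assms(3)
    by (intro set_integral_mono) (auto simp: locally_integrable_def)
  ultimately show ?thesis by simp
qed

lemma set_integral_upper_bound:
  assumes F: "locally_integrable F" and "a \<le> b" and "\<And>x. a < x \<Longrightarrow> x \<le> b \<Longrightarrow> F x \<le> u"
  shows "(LINT x:{a<..b}|\<mu>. F x) \<le> u * (W b - W a)"
proof -
  have "(LINT x:{a<..b}|\<mu>. u) = u * (W b - W a)"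
    using assms(2) by (subst set_integral_const) (auto simp: emeasure_Ioc measure_Ioc)
  moreover have "(LINT x:{a<..b}|\<mu>. F x) \<le> (LINT x:{a<..b}|\<mu>. u)"
    using F locally_integrable_const[of u] assms(3)
    by (intro set_integral_mono) (auto simp: locally_integrable_def)
  ultimately show ?thesis by simp
qed

lemma set_integral_abs_le:
  assumes F: "locally_integrable F"
  shows "\<bar>LINT x:{a<..b}|\<mu>. F x\<bar> \<le> (LINT x:{a<..b}|\<mu>. \<bar>F x\<bar>)"
proof -
  have i: "set_integrable \<mu> {a<..b} F" "set_integrable \<mu> {a<..b} (\<lambda>x. \<bar>F x\<bar>)"
    using F locally_integrable_abs[OF F] by (auto simp: locally_integrable_def)
  have "(LINT x:{a<..b}|\<mu>. F x) \<le> (LINT x:{a<..b}|\<mu>. \<bar>F x\<bar>)"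
    by (rule set_integral_mono) (use i in auto)
  moreover have "(LINT x:{a<..b}|\<mu>. - F x) \<le> (LINT x:{a<..b}|\<mu>. \<bar>F x\<bar>)"
    by (rule set_integral_mono) (use i in \<open>auto simp: set_integrable_def\<close>)
  ultimately show ?thesis
    using set_integral_uminus[OF i(1)] by linarith
qed

lemma primitive_minus:
  assumes "locally_integrable F" "locally_integrable G"
  shows "primitive W (\<lambda>x. F x - G x) x = primitive W F x - primitive W G x"
  using assms by (simp add: primitive_def locally_integrable_def)

text \<open>Adding the primitive of \<open>\<bar>F\<bar>\<close> makes any primitive monotone.\<close>

lemma primitive_borel_measurable:
  assumes F: "locally_integrable F"
  shows "primitive W F \<in> borel_measurable borel"
proof -
  let ?A = "primitive W (\<lambda>x. \<bar>F x\<bar>)"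
  have *: "\<bar>primitive W F y - primitive W F x\<bar> \<le> ?A y - ?A x" if "x \<le> y" for x y
    using set_integral_abs_le[OF F, of x y]
    by (simp add: primitive_diff[OF F that] primitive_diff[OF locally_integrable_abs[OF F] that])
  have "mono ?A" "mono (\<lambda>x. ?A x + primitive W F x)"
    unfolding mono_def using * by (smt (verit))+
  then have "(\<lambda>x. (?A x + primitive W F x) - ?A x) \<in> borel_measurable borel"
    by (intro borel_measurable_diff borel_measurable_mono)
  then show ?thesis by simp
qed

lemma circle_primitive:
  assumes "circle_fun F" "F \<in> borel_measurable borel" and int: "integrable (dW W) F" 
    and mean: "(\<integral>x. F x \<partial>dW W) = 0"
  shows "circle_fun (primitive W F)"
  unfolding circle_fun_def
proof
  fix x :: real
  note F = locally_integrableI[OF assms(1-3)]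
  let ?d = "\<lambda>x. primitive W F (x + 1) - primitive W F x"
  have le: "?d y = ?d x" if "x \<le> y" for x y
    using primitive_diff[OF F that] primitive_diff[OF F add_right_mono[OF that, of 1]]
      set_integral_shift(1)[OF assms(1,2), of x y] by linarith
  have "?d x = ?d 0"
    using le[of x 0] le[of 0 x] by (metis linear)
  also have "\<dots> = 0" using mean by (simp add: integral_dW primitive_def[of W F 1])
  finally show "primitive W F (x + 1) = primitive W F x" by simp
qed

lemma primitive_abs_le:
  assumes F: "circle_fun F" "F \<in> borel_measurable borel" "integrable (dW W) F" 
    and mean: "(\<integral>x. F x \<partial>dW W) = 0"
  shows "\<bar>primitive W F x\<bar> \<le> (\<integral>x. \<bar>F x\<bar> \<partial>dW W)"
proof (rule circle_fun_from_unit_interval[OF circle_primitive[OF assms]])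
  note F' = locally_integrableI[OF F]
  fix x :: real assume x: "0 \<le> x" "x < 1"
  have "\<bar>primitive W F x\<bar> \<le> (LINT x:{0<..x}|\<mu>. \<bar>F x\<bar>)"
    using set_integral_abs_le[OF F', of 0 x] x by (simp add: primitive_def)
  also have "\<dots> \<le> (LINT x:{0<..1}|\<mu>. \<bar>F x\<bar>)"
    using set_integral_split[OF locally_integrable_abs[OF F'], of 0 x 1] x
      set_integral_lower_bound[OF locally_integrable_abs[OF F'] less_imp_le[OF x(2)], of 0] by simp
  finally show "\<bar>primitive W F x\<bar> \<le> (\<integral>x. \<bar>F x\<bar> \<partial>dW W)" by (simp add: integral_dW)
qed

lemma cadlag_primitive:
  assumes F: "locally_integrable F" and B: "\<And>x. \<bar>F x\<bar> \<le> B"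
  shows "cadlag (primitive W F)"
  unfolding cadlag_def
proof (intro allI conjI)
  have bd: "\<bar>primitive W F y - primitive W F x\<bar> \<le> B * (W y - W x)" if "x \<le> y" for x y
  proof -
    have "- B \<le> F t" "F t \<le> B" for t using B[of t] by auto
    then have "- B * (W y - W x) \<le> primitive W F y - primitive W F x"
      "primitive W F y - primitive W F x \<le> B * (W y - W x)"
      unfolding primitive_diff[OF F that]
      by (intro set_integral_lower_bound[OF F that] set_integral_upper_bound[OF F that]; simp)+
    then show ?thesis by (simp add: abs_le_iff)
  qed
  fix x :: real
  have "((\<lambda>y. B * (W y - W x)) \<longlongrightarrow> B * (W x - W x)) (at_right x)"
    using right_continuous[of x] by (intro tendsto_intros) (simp add: continuous_within)
  then have lim: "((\<lambda>y. B * (W y - W x)) \<longlongrightarrow> 0) (at_right x)" by simp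
  have "((\<lambda>y. primitive W F y - primitive W F x) \<longlongrightarrow> 0) (at_right x)"
  proof (rule Lim_null_comparison[OF _ lim])
    show "\<forall>\<^sub>F y in at_right x. norm (primitive W F y - primitive W F x) \<le> B * (W y - W x)"
      unfolding eventually_at_right_field by (intro exI[of _ "x + 1"]) (simp add: bd)
  qed
  then show "continuous (at_right x) (primitive W F)"
    by (simp add: continuous_within LIM_zero_iff)
  have "mono (\<lambda>y. B * W y + primitive W F y)"
    unfolding mono_def
  proof (intro allI impI)
    fix x y :: real assume "x \<le> y"
    from bd[OF this] show "B * W x + primitive W F x \<le> B * W y + primitive W F y"
      by (simp add: algebra_simps abs_le_iff)
  qed
  from mono_has_left_limit[OF this, of x] obtain l
    where l: "((\<lambda>y. B * W y + primitive W F y) \<longlongrightarrow> l) (at_left x)" ..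
  obtain k where k: "(W \<longlongrightarrow> k) (at_left x)" using cadlag by (auto simp: cadlag_def)
  have "((\<lambda>y. (B * W y + primitive W F y) - B * W y) \<longlongrightarrow> l - B * k) (at_left x)"
    by (intro tendsto_intros l k)
  then show "\<exists>l. (primitive W F \<longlongrightarrow> l) (at_left x)" by auto
qed

text \<open>Left of \<open>x\<close> the values of \<open>F\<close> are close to \<open>F x\<close>, and an atom of the measure at \<open>x\<close> is weighted with exactly \<open>F x\<close>; so the increments of the primitive compare with
  \<open>F x\<close> times those of \<open>W\<close>.\<close>

lemma primitive_diff_quotient:
  assumes F: "locally_integrable F" and "caglad F"
  shows "(diff_quotient W (primitive W F) x \<longlongrightarrow> F x) (at_left 0)"
proof (rule tendstoI)
  fix e :: real assume e: "0 < e"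
  have "(F \<longlongrightarrow> F x) (at_left x)" using assms(2) by (simp add: caglad_def continuous_within)
  from tendstoD[OF this, of "e / 2"] e
  obtain b where b: "b < x" "\<And>y. b < y \<Longrightarrow> y < x \<Longrightarrow> dist (F y) (F x) < e / 2"
    unfolding eventually_at_left_field by auto
  show "\<forall>\<^sub>F h in at_left 0. dist (diff_quotient W (primitive W F) x h) (F x) < e"
    unfolding eventually_at_left_field
  proof (intro exI[of _ "b - x"] conjI allI impI)
    show "b - x < 0" using b by simp
    fix h assume h: "b - x < h" "h < 0"
    have near: "F x - e / 2 \<le> F y \<and> F y \<le> F x + e / 2" if "x + h < y" "y \<le> x" for y
    proof (cases "y = x")
      case False
      with b(2)[of y] that h have "\<bar>F y - F x\<bar> < e / 2" by (simp add: dist_real_def)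
      then show ?thesis by linarith
    qed (use e in simp)
    define m where "m = W x - W (x + h)"
    have m: "0 < m" using less[of "x + h" x] h by (simp add: m_def)
    let ?I = "LINT y:{x + h<..x}|\<mu>. F y"
    have "(F x - e / 2) * m \<le> ?I" "?I \<le> (F x + e / 2) * m"
      unfolding m_def using h near
      by (intro set_integral_lower_bound[OF F] set_integral_upper_bound[OF F]; simp)+
    then have "F x - e / 2 \<le> ?I / m" "?I / m \<le> F x + e / 2"
      using m by (simp_all add: field_simps)
    moreover have "diff_quotient W (primitive W F) x h = ?I / m"
      using primitive_diff[OF F, of "x + h" x] h m
      by (simp add: diff_quotient_def m_def divide_eq_eq field_simps)
    ultimately show "dist (diff_quotient W (primitive W F) x h) (F x) < e"
      using e by (simp add: dist_real_def abs_less_iff)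
  qed
qed

text \<open>Moving left from \<open>b\<close>, the
  estimate \<open>\<bar>G b - G t\<bar> \<le> e (W b - W t)\<close> cannot stop being true: right continuity carries it to the
  infimum of the points reached, and the vanishing left derivative carries it further.\<close>

lemma left_derivative_zero_imp_constant:
  assumes rc: "\<And>x. continuous (at_right x) G"
    and zero: "\<And>x. (diff_quotient W G x \<longlongrightarrow> 0) (at_left 0)"
    and "a \<le> b"
  shows "G a = G b"
proof (rule ccontr)
  assume ne: "G a \<noteq> G b"
  with \<open>a \<le> b\<close> have ab: "a < b" by (cases "a = b") auto
  have key: "\<bar>G b - G a\<bar> \<le> e * (W b - W a)" if e: "0 < e" for e
  proof -
    define Q where "Q t \<longleftrightarrow> \<bar>G b - G t\<bar> \<le> e * (W b - W t)" for t
    define S where "S = {t. a \<le> t \<and> t \<le> b \<and> (\<forall>u. t \<le> u \<longrightarrow> u \<le> b \<longrightarrow> Q u)}"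
    define s where "s = Inf S"
    have bS: "b \<in> S" using ab by (auto simp: S_def Q_def)
    have bdd: "bdd_below S" by (rule bdd_belowI[of _ a]) (simp add: S_def)
    have sb: "s \<le> b" unfolding s_def using bS bdd by (rule cInf_lower)
    have as: "a \<le> s" unfolding s_def using bS by (intro cInf_greatest) (auto simp: S_def)
    have above: "Q u" if "s < u" "u \<le> b" for u
    proof -
      obtain t where "t \<in> S" "t < u" using \<open>s < u\<close> bS bdd unfolding s_def by (metis cInf_less_iff empty_iff)
      then show ?thesis using that by (auto simp: S_def)
    qed
    have Qs: "Q s"
    proof (cases "s = b")
      case True then show ?thesis by (simp add: Q_def)
    next
      case False
      with sb have "s < b" by simp
      have G: "(G \<longlongrightarrow> G s) (at_right s)" and W: "(W \<longlongrightarrow> W s) (at_right s)"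
        using rc right_continuous by (auto simp: continuous_within)
      have "((\<lambda>t. \<bar>G b - G t\<bar>) \<longlongrightarrow> \<bar>G b - G s\<bar>) (at_right s)"
        "((\<lambda>t. e * (W b - W t)) \<longlongrightarrow> e * (W b - W s)) (at_right s)"
        by (intro tendsto_intros G W)+
      moreover have "\<forall>\<^sub>F t in at_right s. \<bar>G b - G t\<bar> \<le> e * (W b - W t)"
        unfolding eventually_at_right_field using above \<open>s < b\<close> by (intro exI[of _ b]) (auto simp: Q_def)
      ultimately show ?thesis
        unfolding Q_def by (intro tendsto_le[OF trivial_limit_at_right_real])
    qed
    have "s = a"
    proof (rule ccontr)
      assume "s \<noteq> a"
      with as have "a < s" by simp
      from tendstoD[OF zero[of s] e] obtain d
        where d: "d < 0" "\<And>h. d < h \<Longrightarrow> h < 0 \<Longrightarrow> \<bar>diff_quotient W G s h\<bar> < e"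
        unfolding eventually_at_left_field by (auto simp: dist_real_def)
      define t where "t = max a (s + d / 2)"
      have t: "a \<le> t" "t < s" "s + d < t" using \<open>a < s\<close> d(1) by (auto simp: t_def)
      have "Q u" if "t \<le> u" "u \<le> b" for u
      proof (cases "s \<le> u")
        case True
        then show ?thesis using above Qs that by (cases "u = s") auto
      next
        case False
        have m: "0 < W s - W u" using less[of u s] False by simp
        have "\<bar>(G u - G s) / (W u - W s)\<bar> < e"
          using d(2)[of "u - s"] False that t by (simp add: diff_quotient_def)
        then have "\<bar>G u - G s\<bar> \<le> e * (W s - W u)"
          using m by (simp add: divide_simps abs_if split: if_splits) (simp_all add: algebra_simps)
        moreover have "\<bar>G b - G s\<bar> \<le> e * (W b - W s)" using Qs by (simp add: Q_def)
        ultimately show ?thesis unfolding Q_def right_diff_distrib by linarith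
      qed
      then have "t \<in> S" using t sb by (simp add: S_def)
      then have "s \<le> t" unfolding s_def using bdd by (rule cInf_lower)
      with t show False by simp
    qed
    with Qs show ?thesis by (simp add: Q_def)
  qed
  have m: "0 < W b - W a" using less[OF ab] by simp
  define m where "m = W b - W a"
  have "\<bar>G b - G a\<bar> \<le> \<bar>G b - G a\<bar> / (2 * m) * m"
    using key[of "\<bar>G b - G a\<bar> / (2 * m)"] ne m by (simp add: m_def)
  also have "\<dots> = \<bar>G b - G a\<bar> / 2" using m by (simp add: m_def[symmetric])
  finally have "\<bar>G b - G a\<bar> \<le> \<bar>G b - G a\<bar> / 2" .
  with ne show False by simp
qed

lemma left_deriv_eq:
  assumes "(diff_quotient W f x \<longlongrightarrow> l) (at_left 0)"
  shows "left_deriv W f x = l"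
  unfolding left_deriv_def using assms by (intro tendsto_Lim) auto

lemma left_deriv_primitive:
  assumes "locally_integrable F" "caglad F"
  shows "left_diff W (\<lambda>x. primitive W F x - c)" "left_deriv W (\<lambda>x. primitive W F x - c) = F"
proof -
  have "diff_quotient W (\<lambda>x. primitive W F x - c) = diff_quotient W (primitive W F)"
    by (simp add: diff_quotient_def fun_eq_iff)
  then have *: "(diff_quotient W (\<lambda>x. primitive W F x - c) x \<longlongrightarrow> F x) (at_left 0)" for x
    using primitive_diff_quotient[OF assms] by simp
  then show "left_diff W (\<lambda>x. primitive W F x - c)" by (auto simp: left_diff_def)
  show "left_deriv W (\<lambda>x. primitive W F x - c) = F" using left_deriv_eq[OF *] by auto
qed

text \<open>The function and the primitive of its derivative have the same left derivative, so their difference is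
  right-continuous with vanishing left derivative.\<close>

lemma fundamental_theorem:
  assumes f: "cadlag f" "left_diff W f" and F: "circle_fun (left_deriv W f)" "caglad (left_deriv W f)"
  shows "f x = f 0 + primitive W (left_deriv W f) x"
proof -
  let ?P = "primitive W (left_deriv W f)"
  let ?G = "\<lambda>x. f x - ?P x"
  note F' = locally_integrable_caglad[OF F]
  obtain B where "\<And>x. \<bar>left_deriv W f x\<bar> \<le> B" using circle_caglad_bounded[OF F] by metis
  then have cP: "cadlag ?P" by (rule cadlag_primitive[OF F'])
  have rc: "continuous (at_right x) ?G" for x
    using cadlag_diff[OF f(1) cP] by (simp add: cadlag_def)
  have zero: "(diff_quotient W ?G x \<longlongrightarrow> 0) (at_left 0)" for x
  proof -
    obtain l where l: "(diff_quotient W f x \<longlongrightarrow> l) (at_left 0)"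
      using f(2) by (auto simp: left_diff_def)
    have "((\<lambda>h. diff_quotient W f x h - diff_quotient W ?P x h)
        \<longlongrightarrow> left_deriv W f x - left_deriv W f x) (at_left 0)"
      using l left_deriv_eq[OF l] primitive_diff_quotient[OF F' F(2), of x] by (intro tendsto_diff) auto
    moreover have "(\<lambda>h. diff_quotient W f x h - diff_quotient W ?P x h) = diff_quotient W ?G x"
      by (simp add: diff_quotient_def fun_eq_iff diff_divide_distrib)
    ultimately show ?thesis by simp
  qed
  have "?G x = ?G 0"
    using left_derivative_zero_imp_constant[OF rc zero, of x 0]
      left_derivative_zero_imp_constant[OF rc zero, of 0 x] by (cases "x \<le> 0") auto
  then show ?thesis by simp
qed

end

section \<open>Reflection exchanges the two measures\<close>

locale circle_pair =
  fixes W V :: "real \<Rightarrow> real"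
  assumes strict_W: "strict_mono W" and strict_V: "strict_mono V"
    and cadlag_W: "cadlag W" and caglad_V: "caglad V"
    and period_W: "\<And>x. W (x + 1) - W x = W 1 - W 0"
    and period_V: "\<And>x. V (x + 1) - V x = V 1 - V 0"

lemma strict_mono_flip: "strict_mono U \<Longrightarrow> strict_mono (flip U)"
  by (simp add: strict_mono_def flip_def)

lemma cadlag_flip: "caglad U \<Longrightarrow> cadlag (flip U)"
  using cadlag_cmult[of "refl_fun U" "-1"] by (simp add: flip_def refl_fun_def[symmetric]) (simp add: refl_fun_def)

lemma caglad_flip: "cadlag U \<Longrightarrow> caglad (flip U)"
  using caglad_cmult[of "refl_fun U" "-1"] by (simp add: flip_def refl_fun_def[symmetric]) (simp add: refl_fun_def)

lemma flip_mass:
  assumes "\<And>x. U (x + 1) - U x = U 1 - U 0"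
  shows "flip U 1 - flip U 0 = U 1 - U 0"
  using assms[of "-1"] by (simp add: flip_def)

lemma period_flip:
  assumes "\<And>x. U (x + 1) - U x = U 1 - U 0"
  shows "flip U (x + 1) - flip U x = flip U 1 - flip U 0"
  using assms[of "- (x + 1)"] flip_mass[OF assms] by (simp add: flip_def)

context circle_pair
begin

text \<open>Through this pair, whatever is proved for \<open>W\<close> becomes a statement about \<open>V\<close>.\<close>

lemma mirrored: "circle_pair (flip V) (flip W)"
  using strict_W strict_V cadlag_W caglad_V period_W period_V
  by unfold_locales
    (auto intro: strict_mono_flip cadlag_flip caglad_flip period_flip)

sublocale W: stieltjes_circle W
  by unfold_locales (use strict_W cadlag_W period_W in auto)

sublocale V': stieltjes_circle "flip V"
  by unfold_locales (use strict_V caglad_V in \<open>auto intro: strict_mono_flip cadlag_flip\<close>,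
      rule period_flip[OF period_V])

lemma V_less: "x < y \<Longrightarrow> V x < V y"
  using strict_V by (simp add: strict_mono_less)

lemma dV_eq: "dV V = restrict_space (distr V'.\<mu> borel uminus) {0..<1}"
  by (simp add: dV_def left_interval_measure_def flip_def)

lemma space_dV [simp]: "space (dV V) = {0..<1}"
  by (simp add: dV_eq space_restrict_space)

lemma measurable_dV: "f \<in> borel_measurable borel \<Longrightarrow> f \<in> borel_measurable (dV V)"
  unfolding dV_eq by (rule measurable_restrict_space1) simp

lemma integral_dV_line:
  fixes f :: "real \<Rightarrow> real"
  assumes [measurable]: "f \<in> borel_measurable borel"
  shows "(\<integral>x. f x \<partial>dV V) = (LINT x:{-1<..0}|V'.\<mu>. refl_fun f x)"
    and "integrable (dV V) f \<longleftrightarrow> set_integrable V'.\<mu> {-1<..0} (refl_fun f)"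
proof -
  have eq: "indicator {0..<1} (- x) *\<^sub>R f (- x) = indicator {-1<..0} x *\<^sub>R refl_fun f x" for x
    by (auto simp: refl_fun_def split: split_indicator)
  have "(\<integral>x. f x \<partial>dV V) = (\<integral>x. indicator {0..<1} x *\<^sub>R f x \<partial>distr V'.\<mu> borel uminus)"
    unfolding dV_eq by (rule integral_restrict_space) simp
  also have "\<dots> = (\<integral>x. indicator {0..<1} (- x) *\<^sub>R f (- x) \<partial>V'.\<mu>)"
    by (rule integral_distr) simp_all
  finally show "(\<integral>x. f x \<partial>dV V) = (LINT x:{-1<..0}|V'.\<mu>. refl_fun f x)"
    unfolding eq set_lebesgue_integral_def .
  have "integrable (dV V) f \<longleftrightarrow> integrable (distr V'.\<mu> borel uminus) (\<lambda>x. indicator {0..<1} x *\<^sub>R f x)"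
    unfolding dV_eq by (rule integrable_restrict_space) simp
  also have "\<dots> \<longleftrightarrow> integrable V'.\<mu> (\<lambda>x. indicator {0..<1} (- x) *\<^sub>R f (- x))"
    by (rule integrable_distr_eq) simp_all
  finally show "integrable (dV V) f \<longleftrightarrow> set_integrable V'.\<mu> {-1<..0} (refl_fun f)"
    unfolding eq set_integrable_def .
qed

text \<open>Reflection sends \<open>[0, 1)\<close> to \<open>(- 1, 0]\<close>; for periodic functions this is as good as \<open>(0, 1]\<close>.\<close>

lemma integral_dV:
  assumes "circle_fun f" "f \<in> borel_measurable borel"
  shows "(\<integral>x. f x \<partial>dV V) = (\<integral>x. refl_fun f x \<partial>dW (flip V))"
  using V'.set_integral_shift(1)[of "refl_fun f" "-1" 0] assms
  by (simp add: integral_dV_line V'.integral_dW)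

lemma integrable_dV:
  assumes "circle_fun f" "f \<in> borel_measurable borel"
  shows "integrable (dV V) f \<longleftrightarrow> integrable (dW (flip V)) (refl_fun f)"
  using V'.set_integral_shift(2)[of "refl_fun f" "-1" 0] assms
  by (simp add: integral_dV_line V'.integrable_dW)

lemma emeasure_dV_Ico:
  assumes "0 \<le> a" "a \<le> b" "b \<le> 1"
  shows "emeasure (dV V) {a..<b} = ennreal (V b - V a)"
proof -
  have "emeasure (dV V) {a..<b} = emeasure (left_interval_measure V) {a..<b}"
    unfolding dV_def using assms by (intro emeasure_restrict_space) (auto simp: left_interval_measure_def)
  also have "\<dots> = ennreal (V b - V a)"
    using assms strict_V caglad_V
    by (intro emeasure_left_interval_measure_Ico) (auto simp: strict_mono_less_eq caglad_def)
  finally show ?thesis .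
qed

lemma measure_dV_Ico:
  assumes "0 \<le> a" "a \<le> b" "b \<le> 1"
  shows "measure (dV V) {a..<b} = V b - V a"
  using emeasure_dV_Ico[OF assms] assms strict_V by (simp add: measure_def strict_mono_less_eq)

sublocale dV: finite_real_measure "dV V"
  unfolding finite_real_measure_def by (rule finite_measureI) (simp add: emeasure_dV_Ico)

lemma mass_V: "measure (dV V) (space (dV V)) = V 1 - V 0"
  by (simp add: measure_dV_Ico)

lemma mass_V_pos: "0 < V 1 - V 0"
  using V_less[of 0 1] by simp

lemma circle_fun_power2: "circle_fun f \<Longrightarrow> circle_fun (\<lambda>x. (f x)\<^sup>2)"
  by (simp add: circle_fun_def)

lemma L2_circle_dV_iff: "f \<in> L2_circle (dV V) \<longleftrightarrow> refl_fun f \<in> L2_circle (dW (flip V))"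
proof -
  have "refl_fun (\<lambda>x. (f x)\<^sup>2) = (\<lambda>x. (refl_fun f x)\<^sup>2)" by (simp add: refl_fun_def)
  then show ?thesis
    using integrable_dV[of "\<lambda>x. (f x)\<^sup>2"] by (auto simp: L2_circle_def circle_fun_power2)
qed

lemma L2_norm_dV:
  assumes "circle_fun f" "f \<in> borel_measurable borel"
  shows "L2_norm (dV V) f = L2_norm (dW (flip V)) (refl_fun f)"
  using integral_dV[of "\<lambda>x. (f x)\<^sup>2"] assms
  by (simp add: L2_norm_def circle_fun_power2) (simp add: refl_fun_def)

lemma C0_iff: "f \<in> C0 V \<longleftrightarrow> refl_fun f \<in> C1 (flip V)"
  using integral_dV[of f] cadlag_borel_measurable[of f] by (auto simp: C0_def C1_def)

text \<open>The same facts for \<open>dW\<close> are those of the mirrored pair.\<close>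

lemma L2_circle_uminus: "f \<in> L2_circle M \<Longrightarrow> (\<lambda>x. - f x) \<in> L2_circle M"
  by (auto simp: L2_circle_def circle_fun_def)

lemma integral_dW_refl:
  assumes "circle_fun f" "f \<in> borel_measurable borel"
  shows "(\<integral>x. refl_fun f x \<partial>dV (flip W)) = (\<integral>x. f x \<partial>dW W)"
  using circle_pair.integral_dV[OF mirrored, of "refl_fun f"] assms by simp

lemma L2_circle_dW_iff: "refl_fun f \<in> L2_circle (dV (flip W)) \<longleftrightarrow> f \<in> L2_circle (dW W)"
  using circle_pair.L2_circle_dV_iff[OF mirrored, of "refl_fun f"] by simp

lemma L2_norm_dW:
  assumes "circle_fun f" "f \<in> borel_measurable borel"
  shows "L2_norm (dV (flip W)) (refl_fun f) = L2_norm (dW W) f"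
  using circle_pair.L2_norm_dV[OF mirrored, of "refl_fun f"] assms by simp

lemma C1_iff: "refl_fun f \<in> C0 (flip W) \<longleftrightarrow> f \<in> C1 W"
  using circle_pair.C0_iff[OF mirrored, of "refl_fun f"] by simp

lemma L2_circle_dV_sq_integrable: "f \<in> L2_circle (dV V) \<Longrightarrow> f \<in> sq_integrable (dV V)"
  by (auto simp: L2_circle_def sq_integrable_def intro: measurable_dV)

lemma L2_circle_dW_sq_integrable: "f \<in> L2_circle (dW W) \<Longrightarrow> f \<in> sq_integrable (dW W)"
  by (auto simp: L2_circle_def sq_integrable_def intro: W.measurable_dW)

lemma L2_circle_dW_locally_integrable:
  assumes "F \<in> L2_circle (dW W)"
  shows "integrable (dW W) F" "W.locally_integrable F"
proof -
  show i: "integrable (dW W) F"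
    by (rule W.dW.sq_integrable_imp_integrable[OF L2_circle_dW_sq_integrable[OF assms]])
  show "W.locally_integrable F"
    using assms i by (intro W.locally_integrableI) (auto simp: L2_circle_def)
qed

lemma C0_L2_circle:
  assumes "f \<in> C0 V"
  shows "f \<in> L2_circle (dV V)"
proof -
  have f: "circle_fun f" "cadlag f" using assms by (auto simp: C0_def)
  obtain B where "\<And>x. \<bar>f x\<bar> \<le> B" using circle_cadlag_bounded[OF f] by metis
  then have "f \<in> sq_integrable (dV V)"
    by (intro dV.sq_integrable_bounded measurable_dV cadlag_borel_measurable f)
  then show ?thesis
    using f cadlag_borel_measurable by (simp add: L2_circle_def sq_integrable_def)
qed

lemma C1_L2_circle: "f \<in> C1 W \<Longrightarrow> f \<in> L2_circle (dW W)"
  using circle_pair.C0_L2_circle[OF mirrored, of "refl_fun f"] by (simp add: C1_iff L2_circle_dW_iff)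

end


section \<open>Mean-zero primitives\<close>

definition int_W :: "(real \<Rightarrow> real) \<Rightarrow> (real \<Rightarrow> real) \<Rightarrow> (real \<Rightarrow> real) \<Rightarrow> real \<Rightarrow> real" where
  "int_W W V F = (\<lambda>x. primitive W F x - (\<integral>y. primitive W F y \<partial>dV V) / (V 1 - V 0))"

text \<open>Reflection reverses the orientation of the line, hence the sign.\<close>

definition int_V :: "(real \<Rightarrow> real) \<Rightarrow> (real \<Rightarrow> real) \<Rightarrow> (real \<Rightarrow> real) \<Rightarrow> real \<Rightarrow> real" where
  "int_V W V G = refl_fun (int_W (flip V) (flip W) (\<lambda>x. - refl_fun G x))"

context circle_pair
begin

text \<open>The mean that is subtracted obeys the same bound as the primitive, hence the factor 2.\<close>

lemma int_W_bound:
  assumes F: "F \<in> L2_circle (dW W)" and mean: "(\<integral>x. F x \<partial>dW W) = 0"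
  shows "\<bar>int_W W V F x\<bar> \<le> 2 * sqrt (W 1 - W 0) * L2_norm (dW W) F"
    and "int_W W V F \<in> L2_circle (dV V)" and "(\<integral>x. int_W W V F x \<partial>dV V) = 0"
proof -
  let ?P = "primitive W F" and ?B = "sqrt (W 1 - W 0) * L2_norm (dW W) F"
  have c: "circle_fun F" "F \<in> borel_measurable borel" using F by (auto simp: L2_circle_def)
  note F' = L2_circle_dW_locally_integrable[OF F]
  have bd: "\<bar>?P x\<bar> \<le> ?B" for x
    using W.primitive_abs_le[OF c F'(1) mean, of x]
      W.dW.integral_abs_le_L2_norm[OF L2_circle_dW_sq_integrable[OF F]] by (simp add: W.measure_dW)
  have meas: "?P \<in> borel_measurable borel" by (rule W.primitive_borel_measurable[OF F'(2)])
  have sq: "?P \<in> sq_integrable (dV V)"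
    using bd by (intro dV.sq_integrable_bounded measurable_dV meas)
  have iP: "integrable (dV V) ?P" by (rule dV.sq_integrable_imp_integrable[OF sq])
  have "\<bar>\<integral>x. ?P x \<partial>dV V\<bar> \<le> (\<integral>x. \<bar>?P x\<bar> \<partial>dV V)" by (rule integral_abs_bound)
  also have "\<dots> \<le> (\<integral>x. ?B \<partial>dV V)" using iP bd by (intro integral_mono) auto
  also have "\<dots> = (V 1 - V 0) * ?B" by (simp add: mass_V[simplified])
  finally have bm: "\<bar>(\<integral>x. ?P x \<partial>dV V) / (V 1 - V 0)\<bar> \<le> ?B"
    using mass_V_pos by (simp add: divide_le_eq mult.commute abs_divide)
  show b2: "\<bar>int_W W V F x\<bar> \<le> 2 * sqrt (W 1 - W 0) * L2_norm (dW W) F" for x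
    using abs_triangle_ineq4[of "?P x" "(\<integral>x. ?P x \<partial>dV V) / (V 1 - V 0)"] bd[of x] bm
    unfolding int_W_def by linarith
  have m2: "int_W W V F \<in> borel_measurable borel" using meas by (simp add: int_W_def)
  have "int_W W V F \<in> sq_integrable (dV V)"
    using b2 by (intro dV.sq_integrable_bounded measurable_dV m2)
  moreover have "circle_fun (int_W W V F)"
    using W.circle_primitive[OF c F'(1) mean] by (simp add: int_W_def circle_fun_def)
  ultimately show "int_W W V F \<in> L2_circle (dV V)"
    using m2 by (simp add: L2_circle_def sq_integrable_def)
  show "(\<integral>x. int_W W V F x \<partial>dV V) = 0"
    unfolding int_W_def using iP mass_V_pos by (simp add: mass_V[simplified])
qed

lemma int_W_diff:
  assumes F: "F \<in> L2_circle (dW W)" "(\<integral>x. F x \<partial>dW W) = 0" and G: "G \<in> L2_circle (dW W)" "(\<integral>x. G x \<partial>dW W) = 0"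
  shows "int_W W V (\<lambda>x. F x - G x) = (\<lambda>x. int_W W V F x - int_W W V G x)"
proof -
  have i: "integrable (dV V) (primitive W F)" if F: "F \<in> L2_circle (dW W)" "(\<integral>x. F x \<partial>dW W) = 0" for F
  proof -
    have "integrable (dV V) (int_W W V F)"
      using int_W_bound(2)[OF F] by (intro dV.sq_integrable_imp_integrable L2_circle_dV_sq_integrable)
    then have "integrable (dV V) (\<lambda>x. int_W W V F x + (\<integral>y. primitive W F y \<partial>dV V) / (V 1 - V 0))"
      by simp
    then show ?thesis by (simp add: int_W_def)
  qed
  have "primitive W (\<lambda>x. F x - G x) = (\<lambda>x. primitive W F x - primitive W G x)"
    using L2_circle_dW_locally_integrable F G by (auto intro: W.primitive_minus)
  then show ?thesis
    using i[OF F] i[OF G] by (simp add: int_W_def fun_eq_iff diff_divide_distrib)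
qed

lemma C1_mean: "F \<in> C1 W \<Longrightarrow> (\<integral>x. F x \<partial>dW W) = 0"
  by (simp add: C1_def)

lemma C0_mean: "f \<in> C0 V \<Longrightarrow> (\<integral>x. f x \<partial>dV V) = 0"
  by (simp add: C0_def)

lemma int_W_C1:
  assumes F: "F \<in> C1 W"
  shows "int_W W V F \<in> C0 V" "left_diff W (int_W W V F)" "left_deriv W (int_W W V F) = F"
proof -
  have c: "circle_fun F" "caglad F" using F by (auto simp: C1_def)
  note li = W.locally_integrable_caglad[OF c]
  obtain B where "\<And>x. \<bar>F x\<bar> \<le> B" using circle_caglad_bounded[OF c] by metis
  then have "cadlag (primitive W F)" by (rule W.cadlag_primitive[OF li])
  then have "cadlag (int_W W V F)" unfolding int_W_def by (intro cadlag_diff cadlag_const)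
  then show "int_W W V F \<in> C0 V"
    using int_W_bound[OF C1_L2_circle[OF F] C1_mean[OF F]] by (simp add: C0_def L2_circle_def)
  show "left_diff W (int_W W V F)" "left_deriv W (int_W W V F) = F"
    unfolding int_W_def using W.left_deriv_primitive[OF li c(2)] by auto
qed

lemma int_W_left_deriv:
  assumes f: "f \<in> C0 V" "left_diff W f" and F: "left_deriv W f \<in> C1 W"
  shows "f = int_W W V (left_deriv W f)"
proof -
  have eq: "f x = f 0 + primitive W (left_deriv W f) x" for x
    by (rule W.fundamental_theorem) (use f F in \<open>auto simp: C0_def C1_def\<close>)
  define c where "c = f 0 + (\<integral>y. primitive W (left_deriv W f) y \<partial>dV V) / (V 1 - V 0)"
  have f_eq: "f x = c + int_W W V (left_deriv W f) x" for x
    unfolding c_def int_W_def by (simp add: eq[symmetric])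
  note b = int_W_bound[OF C1_L2_circle[OF F] C1_mean[OF F]]
  have "integrable (dV V) (int_W W V (left_deriv W f))"
    using b(2) by (intro dV.sq_integrable_imp_integrable L2_circle_dV_sq_integrable)
  then have "(\<integral>x. c + int_W W V (left_deriv W f) x \<partial>dV V) = c * (V 1 - V 0)"
    using b(3) by (simp add: mass_V[simplified])
  moreover have "(\<integral>x. f x \<partial>dV V) = (\<integral>x. c + int_W W V (left_deriv W f) x \<partial>dV V)"
    using f_eq by (rule Bochner_Integration.integral_cong[OF refl])
  ultimately have "(\<integral>x. f x \<partial>dV V) = c * (V 1 - V 0)" by simp
  with f(1) mass_V_pos have "c = 0" by (simp add: C0_def)
  with f_eq show ?thesis by auto
qed


section \<open>Integration by parts\<close>

text \<open>The diagonal is counted on one side only: \<open>primitive\<close> on the \<open>W\<close> side integrates over \<open>y \<le> x\<close>, the one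
  on the \<open>V\<close> side over \<open>x < y\<close>. These conditions are complementary, so common atoms of the two measures
  cause no correction term.\<close>

lemma integration_by_parts:
  assumes F: "F \<in> L2_circle (dW W)" "(\<integral>x. F x \<partial>dW W) = 0"
    and G: "G \<in> L2_circle (dV V)" "(\<integral>x. G x \<partial>dV V) = 0"
  shows "(\<integral>x. int_W W V F x * G x \<partial>dV V) = - (\<integral>x. F x * int_V W V G x \<partial>dW W)"
proof -
  interpret M: circle_pair "flip V" "flip W" by (rule mirrored)
  interpret pair_sigma_finite "dV V" "dW W" ..
  have F_borel: "F \<in> borel_measurable borel" and G_borel: "G \<in> borel_measurable borel"
    using F G by (auto simp: L2_circle_def)
  have [measurable]: "F \<in> borel_measurable (dW W)" "G \<in> borel_measurable (dV V)"
    "(\<lambda>x. x) \<in> borel_measurable (dW W)" "(\<lambda>x. x) \<in> borel_measurable (dV V)"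
    using F_borel G_borel by (auto intro: W.measurable_dW measurable_dV)
  have sF: "F \<in> sq_integrable (dW W)" and sG: "G \<in> sq_integrable (dV V)"
    using F G by (auto intro: L2_circle_dW_sq_integrable L2_circle_dV_sq_integrable)
  have iF: "integrable (dW W) F" and iG: "integrable (dV V) G"
    using sF sG W.dW.sq_integrable_imp_integrable dV.sq_integrable_imp_integrable by auto
  have rG: "(\<lambda>x. - refl_fun G x) \<in> L2_circle (dW (flip V))"
    using G(1) L2_circle_dV_iff L2_circle_uminus by blast
  have mG: "(\<integral>x. - refl_fun G x \<partial>dW (flip V)) = 0"
    using G integral_dV[of G] by (simp add: L2_circle_def)
  define P where "P x = (\<integral>y. (if y \<le> x then F y else 0) \<partial>dW W)" for x
  define Q where "Q y = (\<integral>x. (if x < y then G x else 0) \<partial>dV V)" for y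
  obtain k where k: "\<And>x. x \<in> {0..<1} \<Longrightarrow> int_W W V F x = P x - k"
  proof
    fix x :: real assume "x \<in> {0..<1}"
    then have "P x = primitive W F x"
      by (auto simp: P_def primitive_def W.integral_dW set_lebesgue_integral_def
          intro!: Bochner_Integration.integral_cong split: split_indicator)
    then show "int_W W V F x = P x - (\<integral>y. primitive W F y \<partial>dV V) / (V 1 - V 0)"
      by (simp add: int_W_def)
  qed
  obtain l where l: "\<And>y. y \<in> {0<..1} \<Longrightarrow> int_V W V G y = Q y + l"
  proof
    fix y :: real assume y: "y \<in> {0<..1}"
    have m: "(\<lambda>x. if x < y then G x else 0) \<in> borel_measurable borel"
      using G_borel by measurable
    have "Q y = (LINT t:{-1<..0}|V'.\<mu>. refl_fun (\<lambda>x. if x < y then G x else 0) t)"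
      unfolding Q_def by (rule integral_dV_line[OF m])
    also have "\<dots> = (LINT t:{- y<..0}|V'.\<mu>. refl_fun G t)"
      unfolding set_lebesgue_integral_def using y
      by (intro Bochner_Integration.integral_cong) (auto simp: refl_fun_def split: split_indicator)
    also have "\<dots> = primitive (flip V) (\<lambda>x. - refl_fun G x) (- y)"
      using y by (simp add: primitive_def set_lebesgue_integral_def)
    finally show "int_V W V G y = Q y
        + - (\<integral>y. primitive (flip V) (\<lambda>x. - refl_fun G x) y \<partial>dV (flip W)) / (flip W 1 - flip W 0)"
      by (simp add: int_V_def int_W_def refl_fun_def)
  qed
  let ?h = "\<lambda>x y. if y \<le> x then G x * F y else 0"
  have prod: "integrable (dV V \<Otimes>\<^sub>M dW W) (\<lambda>p. G (fst p) * F (snd p))"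
    by (rule Fubini_integrable) (use iF iG in \<open>auto simp: norm_mult abs_mult\<close>)
  have h: "integrable (dV V \<Otimes>\<^sub>M dW W) (case_prod ?h)"
    by (rule Bochner_Integration.integrable_bound[OF prod]) (auto simp: case_prod_beta)
  have Gle: "(\<integral>x. (if y \<le> x then G x else 0) \<partial>dV V) = - Q y" for y
  proof -
    have "(\<integral>x. (if y \<le> x then G x else 0) \<partial>dV V) + Q y
        = (\<integral>x. (if y \<le> x then G x else 0) + (if x < y then G x else 0) \<partial>dV V)"
      unfolding Q_def
      by (rule Bochner_Integration.integral_add[symmetric];
          rule Bochner_Integration.integrable_bound[OF iG]; simp)
    also have "\<dots> = (\<integral>x. G x \<partial>dV V)"
      by (rule Bochner_Integration.integral_cong) auto
    finally show ?thesis using G(2) by simp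
  qed
  have "(\<integral>x. P x * G x \<partial>dV V) = (\<integral>x. \<integral>y. ?h x y \<partial>dW W \<partial>dV V)"
  proof (rule Bochner_Integration.integral_cong[OF refl])
    fix x
    have "P x * G x = (\<integral>y. (if y \<le> x then F y else 0) * G x \<partial>dW W)" by (simp add: P_def)
    also have "\<dots> = (\<integral>y. ?h x y \<partial>dW W)"
      by (rule Bochner_Integration.integral_cong) auto
    finally show "P x * G x = (\<integral>y. ?h x y \<partial>dW W)" .
  qed
  also have "\<dots> = (\<integral>y. \<integral>x. ?h x y \<partial>dV V \<partial>dW W)"
    by (rule Fubini_integral[OF h, symmetric])
  also have "\<dots> = (\<integral>y. F y * (\<integral>x. (if y \<le> x then G x else 0) \<partial>dV V) \<partial>dW W)"
  proof (rule Bochner_Integration.integral_cong[OF refl])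
    fix y
    have "(\<integral>x. ?h x y \<partial>dV V) = (\<integral>x. F y * (if y \<le> x then G x else 0) \<partial>dV V)"
      by (rule Bochner_Integration.integral_cong) auto
    then show "(\<integral>x. ?h x y \<partial>dV V) = F y * (\<integral>x. (if y \<le> x then G x else 0) \<partial>dV V)" by simp
  qed
  also have "\<dots> = - (\<integral>y. F y * Q y \<partial>dW W)"
    unfolding Gle by simp
  finally have PQ: "(\<integral>x. P x * G x \<partial>dV V) = - (\<integral>y. F y * Q y \<partial>dW W)" .
  have bW: "int_W W V F \<in> sq_integrable (dV V)"
    using int_W_bound(2)[OF F] by (rule L2_circle_dV_sq_integrable)
  have "int_V W V G \<in> L2_circle (dW W)"
    using M.int_W_bound(2)[OF rG mG] L2_circle_dW_iff[of "int_V W V G"] by (simp add: int_V_def)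
  then have bV: "int_V W V G \<in> sq_integrable (dW W)" by (rule L2_circle_dW_sq_integrable)
  have "(\<integral>x. int_W W V F x * G x \<partial>dV V) = (\<integral>x. int_W W V F x * G x + k * G x \<partial>dV V)"
    using sq_integrable_mult[OF bW sG] iG G(2) by simp
  also have "\<dots> = (\<integral>x. P x * G x \<partial>dV V)"
    by (rule Bochner_Integration.integral_cong) (simp_all add: k algebra_simps)
  also note PQ
  also have "(\<integral>y. F y * Q y \<partial>dW W) = (\<integral>y. F y * int_V W V G y - l * F y \<partial>dW W)"
    by (rule Bochner_Integration.integral_cong) (simp_all add: l algebra_simps)
  also have "\<dots> = (\<integral>y. F y * int_V W V G y \<partial>dW W)"
    using sq_integrable_mult[OF sF bV] iF F(2) by simp
  finally show ?thesis .
qed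

section \<open>Density of the range of the primitive\<close>

lemma primitive_constant_piece:
  assumes F: "W.locally_integrable F" and "a \<le> b" and "\<And>x. a < x \<Longrightarrow> x \<le> b \<Longrightarrow> F x = k"
  shows "primitive W F b - primitive W F a = k * (W b - W a)"
  using W.set_integral_lower_bound[OF assms(1,2), of k] W.set_integral_upper_bound[OF assms(1,2), of k]
    assms(3) by (force simp: W.primitive_diff[OF F assms(2)])

lemma V_left_continuous_gap:
  assumes "0 < e"
  obtains d where "0 < d" "\<And>t. x - d \<le> t \<Longrightarrow> t < x \<Longrightarrow> V x - V t < e"
proof -
  have "(V \<longlongrightarrow> V x) (at_left x)" using caglad_V by (simp add: caglad_def continuous_within)
  from tendstoD[OF this assms] obtain b where b: "b < x" "\<And>t. b < t \<Longrightarrow> t < x \<Longrightarrow> dist (V t) (V x) < e"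
    unfolding eventually_at_left_field by auto
  show ?thesis
  proof (rule that[of "(x - b) / 2"])
    show "0 < (x - b) / 2" using b by simp
    fix t assume "x - (x - b) / 2 \<le> t" "t < x"
    then have "b < t" using b(1) by (simp add: field_simps)
    from b(2)[OF this \<open>t < x\<close>] show "V x - V t < e" by (simp add: dist_real_def)
  qed
qed

lemma caglad_ceiling_shift: "caglad (\<lambda>x. real_of_int \<lceil>x - a\<rceil>)"
  unfolding caglad_def
proof (intro allI conjI)
  fix x :: real
  define n where "n = \<lceil>x - a\<rceil>"
  have n: "real_of_int n - 1 < x - a" "x - a \<le> real_of_int n" unfolding n_def by linarith+
  have "\<forall>\<^sub>F y in at_left x. real_of_int \<lceil>y - a\<rceil> = real_of_int \<lceil>x - a\<rceil>"
    unfolding eventually_at_left_field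
  proof (intro exI[of _ "a + real_of_int n - 1"] conjI allI impI)
    show "a + real_of_int n - 1 < x" using n by simp
    fix y assume "a + real_of_int n - 1 < y" "y < x"
    then have "\<lceil>y - a\<rceil> = n" using n by (intro ceiling_unique) auto
    then show "real_of_int \<lceil>y - a\<rceil> = real_of_int \<lceil>x - a\<rceil>" by (simp add: n_def)
  qed
  then show "continuous (at_left x) (\<lambda>x. real_of_int \<lceil>x - a\<rceil>)"
    by (simp add: continuous_within tendsto_eventually)
  define m where "m = \<lfloor>x - a\<rfloor>"
  have m: "real_of_int m \<le> x - a" "x - a < real_of_int m + 1" unfolding m_def by linarith+
  have "\<forall>\<^sub>F y in at_right x. real_of_int \<lceil>y - a\<rceil> = real_of_int (m + 1)"
    unfolding eventually_at_right_field
  proof (intro exI[of _ "a + real_of_int m + 1"] conjI allI impI)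
    show "x < a + real_of_int m + 1" using m by simp
    fix y assume "x < y" "y < a + real_of_int m + 1"
    then have "\<lceil>y - a\<rceil> = m + 1" using m by (intro ceiling_unique) auto
    then show "real_of_int \<lceil>y - a\<rceil> = real_of_int (m + 1)" by simp
  qed
  then show "\<exists>l. ((\<lambda>x. real_of_int \<lceil>x - a\<rceil>) \<longlongrightarrow> l) (at_right x)"
    by (intro exI[of _ "real_of_int (m + 1)"] tendsto_eventually)
qed

lemma circle_ceiling_diff: "circle_fun (\<lambda>x. real_of_int \<lceil>x - a\<rceil> - real_of_int \<lceil>x - b\<rceil>)"
proof -
  have "\<lceil>x + 1 - c\<rceil> = \<lceil>x - c\<rceil> + 1" for x c :: real
    using ceiling_add_of_int[of "x - c" 1] by (simp add: algebra_simps)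
  then show ?thesis by (simp add: circle_fun_def)
qed

text \<open>The periodic function \<open>\<lceil>x - p\<rceil> - \<lceil>x - q\<rceil>\<close> is the indicator of \<open>(p, q]\<close> on the circle. The primitive
  of a function that puts mass one on a short interval ending at \<open>a\<close> and removes it again on one ending
  at \<open>1\<close> differs from the indicator of \<open>[a, 1)\<close> only on two short intervals \<open>[a - d, a)\<close> and \<open>[1 - d, 1)\<close>,
  whose \<open>dV\<close>-measure is small by left continuity of \<open>V\<close>, whatever the atoms are.\<close>

lemma approx_indicator:
  assumes a: "0 < a" "a < 1" and e: "0 < e"
  shows "\<exists>F\<in>C1 W. L2_norm (dV V) (\<lambda>x. indicator {a..<1} x - primitive W F x) < e"
proof -
  have e2: "0 < e\<^sup>2 / 2" using e by simp
  obtain d1 where d1: "0 < d1" "\<And>t. a - d1 \<le> t \<Longrightarrow> t < a \<Longrightarrow> V a - V t < e\<^sup>2 / 2"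
    using V_left_continuous_gap[OF e2, of a] by blast
  obtain d2 where d2: "0 < d2" "\<And>t. 1 - d2 \<le> t \<Longrightarrow> t < 1 \<Longrightarrow> V 1 - V t < e\<^sup>2 / 2"
    using V_left_continuous_gap[OF e2, of 1] by blast
  define d where "d = min (min d1 d2) (min a (1 - a))"
  have d: "0 < d" "d \<le> a" "d \<le> 1 - a" and dV: "V a - V (a - d) < e\<^sup>2 / 2" "V 1 - V (1 - d) < e\<^sup>2 / 2"
    using a d1 d2 by (auto simp: d_def)
  define u v where "u = W a - W (a - d)" and "v = W 1 - W (1 - d)"
  have uv: "0 < u" "0 < v" using W.less[of "a - d" a] W.less[of "1 - d" 1] d by (auto simp: u_def v_def)
  \<comment> \<open>The weights give \<open>F dW\<close> mass \<open>1\<close> on \<open>(a - d, a]\<close> and mass \<open>- 1\<close> on \<open>(1 - d, 1]\<close>.\<close>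
  define F where "F x = (1 / u) * (real_of_int \<lceil>x - (a - d)\<rceil> - real_of_int \<lceil>x - a\<rceil>)
    - (1 / v) * (real_of_int \<lceil>x - (1 - d)\<rceil> - real_of_int \<lceil>x - 1\<rceil>)" for x
  have "caglad F"
    unfolding F_def by (intro caglad_diff caglad_cmult caglad_ceiling_shift)
  have "circle_fun F"
    using circle_ceiling_diff[of "a - d" a] circle_ceiling_diff[of "1 - d" 1]
    by (simp add: F_def circle_fun_def)
  have F: "W.locally_integrable F"
    by (rule W.locally_integrable_caglad) fact+
  have zero: "\<lceil>x - c\<rceil> = 0" if "0 < x" "x \<le> c" "c \<le> 1" for x c :: real
    using that by (intro ceiling_unique) auto
  have one: "\<lceil>x - c\<rceil> = 1" if "c < x" "x \<le> 1" "0 \<le> c" for x c :: real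
    using that by (intro ceiling_unique) auto
  have one': "\<lceil>x\<rceil> = 1" if "0 < x" "x \<le> 1" for x :: real
    using that by (intro ceiling_unique) auto
  have F1: "F x = 0" if "0 < x" "x \<le> a - d" for x
    using that d a by (simp add: F_def zero one')
  have F2: "F x = 1 / u" if "a - d < x" "x \<le> a" for x
    using that d a by (simp add: F_def zero one one')
  have F3: "F x = 0" if "a < x" "x \<le> 1 - d" for x
    using that d a by (simp add: F_def zero one one')
  have F4: "F x = - (1 / v)" if "1 - d < x" "x \<le> 1" for x
    using that d a by (simp add: F_def zero one one')
  let ?P = "primitive W F"
  have P1: "?P x = 0" if "0 \<le> x" "x \<le> a - d" for x
    using primitive_constant_piece[OF F that(1), of 0] F1 that by simp
  have P2: "?P x = (W x - W (a - d)) / u" if "a - d \<le> x" "x \<le> a" for x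
    using primitive_constant_piece[OF F that(1), of "1 / u"] F2 P1[of "a - d"] d that by simp
  have P3: "?P x = 1" if "a \<le> x" "x \<le> 1 - d" for x
    using primitive_constant_piece[OF F that(1), of 0] F3 P2[of a] d uv that by (simp add: u_def)
  have P4: "?P x = 1 - (W x - W (1 - d)) / v" if "1 - d \<le> x" "x \<le> 1" for x
    using primitive_constant_piece[OF F that(1), of "- (1 / v)"] F4 P3[of "1 - d"] d that by simp
  have "?P 1 = 0" using P4[of 1] d uv by (simp add: v_def)
  then have "(\<integral>x. F x \<partial>dW W) = 0" by (simp add: primitive_def W.integral_dW)
  then have "F \<in> C1 W" using \<open>caglad F\<close> \<open>circle_fun F\<close> by (simp add: C1_def)
  let ?J = "\<lambda>x. indicator {a - d..<a} x + indicator {1 - d..<1} x :: real"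
  have err: "(indicator {a..<1} x - ?P x)\<^sup>2 \<le> ?J x" if x: "x \<in> {0..<1}" for x
  proof -
    consider "x < a - d" | "a - d \<le> x" "x < a" | "a \<le> x" "x < 1 - d" | "1 - d \<le> x" by linarith
    then show ?thesis
    proof cases
      case 1
      then show ?thesis using x P1[of x] d by (simp add: indicator_def)
    next
      case 2
      have "W x \<le> W a" "W (a - d) \<le> W x" using W.mono 2 by auto
      then have "0 \<le> ?P x" "?P x \<le> 1" using P2[of x] 2 uv by (simp_all add: u_def)
      then show ?thesis using 2 d power_le_one[of "?P x" 2] by (simp add: indicator_def)
    next
      case 3
      then show ?thesis using x P3[of x] d by (simp add: indicator_def)
    next
      case 4
      have "W x \<le> W 1" "W (1 - d) \<le> W x" using W.mono 4 x by auto
      then have "0 \<le> 1 - ?P x" "1 - ?P x \<le> 1" using P4[of x] 4 x uv by (simp_all add: v_def)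
      then show ?thesis using 4 d a x power_le_one[of "1 - ?P x" 2] by (simp add: indicator_def)
    qed
  qed
  have J: "integrable (dV V) (\<lambda>x. indicator {p..<q} x :: real)"
    "(\<integral>x. indicator {p..<q} x \<partial>dV V) = V q - V p" if "0 \<le> p" "p \<le> q" "q \<le> 1" for p q
  proof -
    have s: "{p..<q} \<in> sets (dV V)" using that by (auto simp: dV_eq sets_restrict_space_iff)
    then show "integrable (dV V) (\<lambda>x. indicator {p..<q} x :: real)"
      by (intro integrable_real_indicator) (simp_all add: dV.emeasure_eq_measure)
    have "{p..<q} \<inter> {0..<1} = {p..<q}" using that by auto
    then show "(\<integral>x. indicator {p..<q} x \<partial>dV V) = V q - V p"
      using that by (simp add: measure_dV_Ico)
  qed
  have "(\<integral>x. (indicator {a..<1} x - ?P x)\<^sup>2 \<partial>dV V) \<le> (\<integral>x. ?J x \<partial>dV V)"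
    using J(1)[of "a - d" a] J(1)[of "1 - d" 1] a d err
    by (intro integral_mono') auto
  also have "\<dots> = (V a - V (a - d)) + (V 1 - V (1 - d))"
    using J[of "a - d" a] J[of "1 - d" 1] a d by simp
  also have "\<dots> < e\<^sup>2" using dV by simp
  finally have "L2_norm (dV V) (\<lambda>x. indicator {a..<1} x - ?P x) < sqrt (e\<^sup>2)"
    unfolding L2_norm_def by (rule real_sqrt_less_mono)
  then show ?thesis using \<open>F \<in> C1 W\<close> e by auto
qed

lemma primitive_sq_integrable:
  assumes "F \<in> C1 W"
  shows "primitive W F \<in> sq_integrable (dV V)"
proof -
  note F = C1_L2_circle[OF assms] C1_mean[OF assms]
  have "int_W W V F \<in> sq_integrable (dV V)"
    by (rule L2_circle_dV_sq_integrable[OF int_W_bound(2)[OF F]])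
  from sq_integrable_add[OF this dV.sq_integrable_const]
  have "(\<lambda>x. int_W W V F x + (\<integral>y. primitive W F y \<partial>dV V) / (V 1 - V 0)) \<in> sq_integrable (dV V)" .
  then show ?thesis by (simp add: int_W_def)
qed

lemma C1_add:
  assumes "F \<in> C1 W" "G \<in> C1 W"
  shows "(\<lambda>x. F x + G x) \<in> C1 W" "primitive W (\<lambda>x. F x + G x) = (\<lambda>x. primitive W F x + primitive W G x)"
proof -
  have "caglad (\<lambda>x. F x - (-1) * G x)"
    using assms by (intro caglad_diff caglad_cmult) (auto simp: C1_def)
  then show "(\<lambda>x. F x + G x) \<in> C1 W"
    using assms L2_circle_dW_locally_integrable(1)[OF C1_L2_circle]
    by (simp add: C1_def circle_fun_def)
  show "primitive W (\<lambda>x. F x + G x) = (\<lambda>x. primitive W F x + primitive W G x)"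
    using L2_circle_dW_locally_integrable(2)[OF C1_L2_circle] assms
    by (simp add: primitive_def W.locally_integrable_def fun_eq_iff)
qed

lemma C1_cmult:
  assumes "F \<in> C1 W"
  shows "(\<lambda>x. c * F x) \<in> C1 W" "primitive W (\<lambda>x. c * F x) = (\<lambda>x. c * primitive W F x)"
  using assms by (auto simp: C1_def circle_fun_def caglad_cmult primitive_def)

lemma sets_dV: "sets (dV V) = sigma_sets {0..<1} (range (\<lambda>a. {0..<1} \<inter> {a..}))"
proof -
  have b: "sets (borel :: real measure) = sigma_sets UNIV (range atLeast)"
    by (simp add: borel_Ici)
  have "{0..<1::real} \<in> sigma_sets UNIV (range atLeast)" by (simp add: b[symmetric])
  from sigma_sets_Int[OF this]
  have "(\<inter>) {0..<1::real} ` sigma_sets UNIV (range atLeast)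
      = sigma_sets {0..<1} ((\<inter>) {0..<1} ` range atLeast)" by simp
  then show ?thesis
    by (simp add: dV_eq sets_restrict_space b image_image)
qed

text \<open>The functions that can be approximated form a closed subspace, and it contains the indicators of the
  intervals \<open>[a, 1)\<close>, which generate the Borel sets of the period.\<close>

lemma approx_by_constant_plus_primitive:
  assumes f: "f \<in> sq_integrable (dV V)" and "0 < e"
  shows "\<exists>c. \<exists>F\<in>C1 W. L2_norm (dV V) (\<lambda>x. f x - (c + primitive W F x)) < e"
proof -
  define A where "A = {f \<in> sq_integrable (dV V).
    \<forall>e>0. \<exists>c. \<exists>F\<in>C1 W. L2_norm (dV V) (\<lambda>x. f x - (c + primitive W F x)) < e}"
  have P0: "primitive W (\<lambda>_. 0) = (\<lambda>_. 0)"
    by (simp add: primitive_def fun_eq_iff set_lebesgue_integral_def)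
  have C1_0: "(\<lambda>_. 0) \<in> C1 W" by (simp add: C1_def circle_fun_def)
  have const: "(\<lambda>_. c) \<in> A" for c
    unfolding A_def
  proof (intro CollectI conjI allI impI)
    fix e :: real assume "0 < e"
    then show "\<exists>c'. \<exists>F\<in>C1 W. L2_norm (dV V) (\<lambda>x. c - (c' + primitive W F x)) < e"
      using C1_0 by (intro exI[of _ c] bexI[of _ "\<lambda>_. 0"]) (simp_all add: P0 L2_norm_def)
  qed simp
  have cong: "f \<in> A" if "g \<in> A" "\<And>x. x \<in> {0..<1} \<Longrightarrow> f x = g x" for f g
  proof -
    have "L2_norm (dV V) (\<lambda>x. f x - h x) = L2_norm (dV V) (\<lambda>x. g x - h x)" for h
      unfolding L2_norm_def by (intro arg_cong[where f=sqrt] Bochner_Integration.integral_cong) (simp_all add: that)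
    moreover have "f \<in> borel_measurable (dV V) \<longleftrightarrow> g \<in> borel_measurable (dV V)"
      by (rule measurable_cong) (simp add: that(2))
    moreover have "integrable (dV V) (\<lambda>x. (f x)\<^sup>2) \<longleftrightarrow> integrable (dV V) (\<lambda>x. (g x)\<^sup>2)"
      by (rule Bochner_Integration.integrable_cong[OF refl]) (simp add: that(2))
    ultimately show ?thesis using that(1) by (simp add: A_def sq_integrable_def)
  qed
  have "f \<in> A"
  proof (rule dV.closed_subspace_eq_sq_integrable[OF _ _ _ _ _ _ _ _ f])
    let ?E = "range (\<lambda>a. {0..<1::real} \<inter> {a..})"
    show "sets (dV V) = sigma_sets (space (dV V)) ?E" by (simp add: sets_dV)
    show "Int_stable ?E"
    proof (rule Int_stableI, elim rangeE)
      fix S T :: "real set" and a b assume "S = {0..<1} \<inter> {a..}" "T = {0..<1} \<inter> {b..}"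
      then have "S \<inter> T = {0..<1} \<inter> {max a b..}" by auto
      then show "S \<inter> T \<in> ?E" by blast
    qed
    show "?E \<subseteq> Pow (space (dV V))" by auto
    show "(\<lambda>x. 1) \<in> A" by (rule const)
    fix S assume "S \<in> ?E"
    then obtain a where S: "S = {0..<1} \<inter> {a..}" by auto
    consider "a \<le> 0" | "1 \<le> a" | "0 < a" "a < 1" by linarith
    then show "indicator S \<in> A"
    proof cases
      case 1
      then show ?thesis by (intro cong[OF const[of 1]]) (auto simp: S indicator_def)
    next
      case 2
      then show ?thesis by (intro cong[OF const[of 0]]) (auto simp: S indicator_def)
    next
      case 3
      then have S': "S = {a..<1}" by (auto simp: S)
      have "S \<in> sets (dV V)"
        using 3 by (auto simp: S' dV_eq sets_restrict_space_iff)
      then have "indicator S \<in> sq_integrable (dV V)"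
        by (intro dV.sq_integrable_bounded[of _ 1]) (auto split: split_indicator)
      then show ?thesis
        unfolding A_def using approx_indicator[OF 3]
        by (auto simp: S' intro!: exI[of _ 0])
    qed
  next
    fix f g assume f: "f \<in> A" and g: "g \<in> A"
    show "(\<lambda>x. f x + g x) \<in> A"
      unfolding A_def
    proof (intro CollectI conjI allI impI)
      show "(\<lambda>x. f x + g x) \<in> sq_integrable (dV V)"
        using f g by (auto simp: A_def intro: sq_integrable_add)
      fix e :: real assume "0 < e"
      then have e2: "0 < e / 2" by simp
      obtain c F where F: "F \<in> C1 W" "L2_norm (dV V) (\<lambda>x. f x - (c + primitive W F x)) < e / 2"
        using f e2 unfolding A_def by blast
      obtain c' G where G: "G \<in> C1 W" "L2_norm (dV V) (\<lambda>x. g x - (c' + primitive W G x)) < e / 2"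
        using g e2 unfolding A_def by blast
      let ?H = "\<lambda>x. F x + G x"
      have sF: "(\<lambda>x. f x - (c + primitive W F x)) \<in> sq_integrable (dV V)"
        using f by (auto simp: A_def intro!: sq_integrable_diff sq_integrable_add primitive_sq_integrable F(1))
      have sG: "(\<lambda>x. g x - (c' + primitive W G x)) \<in> sq_integrable (dV V)"
        using g by (auto simp: A_def intro!: sq_integrable_diff sq_integrable_add primitive_sq_integrable G(1))
      have "(\<lambda>x. f x + g x - (c + c' + primitive W ?H x))
          = (\<lambda>x. (f x - (c + primitive W F x)) + (g x - (c' + primitive W G x)))"
        by (simp add: C1_add[OF F(1) G(1)] fun_eq_iff)
      then have "L2_norm (dV V) (\<lambda>x. f x + g x - (c + c' + primitive W ?H x)) < e"
        using L2_norm_triangle[OF sF sG] F(2) G(2) by simp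
      then show "\<exists>c. \<exists>F\<in>C1 W. L2_norm (dV V) (\<lambda>x. f x + g x - (c + primitive W F x)) < e"
        using C1_add(1)[OF F(1) G(1)] by blast
    qed
  next
    fix f and k :: real assume f: "f \<in> A"
    show "(\<lambda>x. k * f x) \<in> A"
      unfolding A_def
    proof (intro CollectI conjI allI impI)
      show "(\<lambda>x. k * f x) \<in> sq_integrable (dV V)"
        using f by (auto simp: A_def intro: sq_integrable_cmult)
      fix e :: real assume "0 < e"
      then have "0 < e / (\<bar>k\<bar> + 1)" by simp
      then obtain c F where F: "F \<in> C1 W" "L2_norm (dV V) (\<lambda>x. f x - (c + primitive W F x)) < e / (\<bar>k\<bar> + 1)"
        using f unfolding A_def by blast
      have "(\<lambda>x. k * f x - (k * c + primitive W (\<lambda>x. k * F x) x)) = (\<lambda>x. k * (f x - (c + primitive W F x)))"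
        by (simp add: C1_cmult[OF F(1)] fun_eq_iff algebra_simps)
      then have "L2_norm (dV V) (\<lambda>x. k * f x - (k * c + primitive W (\<lambda>x. k * F x) x))
          = \<bar>k\<bar> * L2_norm (dV V) (\<lambda>x. f x - (c + primitive W F x))"
        by (simp add: L2_norm_cmult)
      also have "\<dots> \<le> \<bar>k\<bar> * (e / (\<bar>k\<bar> + 1))"
        using F(2) by (intro mult_left_mono) auto
      also have "\<dots> < e" using \<open>0 < e\<close> by (simp add: field_simps)
      finally show "\<exists>c. \<exists>F\<in>C1 W. L2_norm (dV V) (\<lambda>x. k * f x - (c + primitive W F x)) < e"
        using C1_cmult(1)[OF F(1)] by blast
    qed
  next
    fix f assume f: "f \<in> sq_integrable (dV V)"
      and ap: "\<And>e. 0 < e \<Longrightarrow> \<exists>g\<in>A. g \<in> sq_integrable (dV V) \<and> L2_norm (dV V) (\<lambda>x. f x - g x) < e"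
    show "f \<in> A"
      unfolding A_def
    proof (intro CollectI conjI allI impI)
      fix e :: real assume "0 < e"
      then have e2: "0 < e / 2" by simp
      obtain g where g: "g \<in> A" "L2_norm (dV V) (\<lambda>x. f x - g x) < e / 2"
        using ap[OF e2] by blast
      obtain c F where F: "F \<in> C1 W" "L2_norm (dV V) (\<lambda>x. g x - (c + primitive W F x)) < e / 2"
        using g(1) e2 unfolding A_def by blast
      have "(\<lambda>x. c + primitive W F x) \<in> sq_integrable (dV V)"
        by (intro sq_integrable_add primitive_sq_integrable F(1)) simp
      then have "L2_norm (dV V) (\<lambda>x. f x - (c + primitive W F x)) < e"
        using L2_norm_triangle_diff[OF f _ , of g "\<lambda>x. c + primitive W F x"] g F(2) by (simp add: A_def)
      then show "\<exists>c. \<exists>F\<in>C1 W. L2_norm (dV V) (\<lambda>x. f x - (c + primitive W F x)) < e"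
        using F(1) by blast
    qed (rule f)
  qed
  then show ?thesis using \<open>0 < e\<close> by (simp add: A_def)
qed

text \<open>Functions of mean zero are orthogonal to the constants, so adjusting the constant in an approximation
  to the one that gives the approximant mean zero can only reduce the error.\<close>

lemma int_W_range_dense:
  assumes f: "f \<in> L2_circle (dV V)" "(\<integral>x. f x \<partial>dV V) = 0" and "0 < e"
  shows "\<exists>F\<in>C1 W. L2_norm (dV V) (\<lambda>x. f x - int_W W V F x) < e"
proof -
  obtain c F where F: "F \<in> C1 W" "L2_norm (dV V) (\<lambda>x. f x - (c + primitive W F x)) < e"
    using approx_by_constant_plus_primitive[OF L2_circle_dV_sq_integrable[OF f(1)] \<open>0 < e\<close>] by blast
  note b = int_W_bound[OF C1_L2_circle[OF F(1)] C1_mean[OF F(1)]]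
  define z where "z x = f x - int_W W V F x" for x
  define k where "k = c + (\<integral>y. primitive W F y \<partial>dV V) / (V 1 - V 0)"
  have z: "z \<in> sq_integrable (dV V)"
    unfolding z_def using f(1) b(2) by (intro sq_integrable_diff L2_circle_dV_sq_integrable)
  have iz: "integrable (dV V) z" by (rule dV.sq_integrable_imp_integrable[OF z])
  have iz2: "integrable (dV V) (\<lambda>x. (z x)\<^sup>2)" using z by (simp add: sq_integrable_def)
  have "(\<integral>x. z x \<partial>dV V) = 0"
    unfolding z_def using f b
    by (simp add: dV.sq_integrable_imp_integrable L2_circle_dV_sq_integrable)
  then have "(\<integral>x. (z x)\<^sup>2 - 2 * k * z x + k\<^sup>2 \<partial>dV V) = (\<integral>x. (z x)\<^sup>2 \<partial>dV V) + k\<^sup>2 * (V 1 - V 0)"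
    using iz iz2 by (simp add: mass_V[simplified])
  moreover have "(z x)\<^sup>2 - 2 * k * z x + k\<^sup>2 = (f x - (c + primitive W F x))\<^sup>2" for x
  proof -
    have eq: "f x - (c + primitive W F x) = z x - k" by (simp add: z_def k_def int_W_def)
    show ?thesis unfolding eq power2_diff by simp
  qed
  ultimately have "(\<integral>x. (z x)\<^sup>2 \<partial>dV V) \<le> (\<integral>x. (f x - (c + primitive W F x))\<^sup>2 \<partial>dV V)"
    using mass_V_pos by simp
  then have "L2_norm (dV V) z \<le> L2_norm (dV V) (\<lambda>x. f x - (c + primitive W F x))"
    by (simp add: L2_norm_def)
  with F show ?thesis unfolding z_def by (intro bexI[of _ F]) auto
qed

end

section \<open>The derivative with respect to \<open>V\<close> by reflection\<close>

lemma diff_quotient_flip: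
  "diff_quotient V g x h = - diff_quotient (flip V) (refl_fun g) (- x) (- h)"
proof -
  have "(g (x + h) - g x) / (V (x + h) - V x) = - ((g (x + h) - g x) / (V x - V (x + h)))"
    by (metis minus_diff_eq minus_divide_right)
  then show ?thesis by (simp add: diff_quotient_def flip_def refl_fun_def add.commute)
qed

lemma right_limit_iff_left_limit_refl:
  "(diff_quotient V g x \<longlongrightarrow> l) (at_right 0)
    \<longleftrightarrow> (diff_quotient (flip V) (refl_fun g) (- x) \<longlongrightarrow> - l) (at_left 0)"
proof -
  have eq: "diff_quotient V g x = (\<lambda>h. - diff_quotient (flip V) (refl_fun g) (- x) (- h))"
    by (rule ext) (rule diff_quotient_flip)
  have "(diff_quotient (flip V) (refl_fun g) (- x) \<longlongrightarrow> - l) (at_left 0)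
      \<longleftrightarrow> ((\<lambda>h. diff_quotient (flip V) (refl_fun g) (- x) (- h)) \<longlongrightarrow> - l) (at_right 0)"
    using filterlim_at_left_to_right[of _ _ 0] by simp
  also have "\<dots> \<longleftrightarrow> (diff_quotient V g x \<longlongrightarrow> l) (at_right 0)"
    unfolding eq by (rule tendsto_minus_cancel_left)
  finally show ?thesis by simp
qed

lemma right_diff_iff: "right_diff V g \<longleftrightarrow> left_diff (flip V) (refl_fun g)"
proof -
  have "right_diff V g \<longleftrightarrow> (\<forall>x. \<exists>l. (diff_quotient (flip V) (refl_fun g) (- x) \<longlongrightarrow> - l) (at_left 0))"
    by (simp add: right_diff_def right_limit_iff_left_limit_refl)
  also have "\<dots> \<longleftrightarrow> left_diff (flip V) (refl_fun g)"
    unfolding left_diff_def by (metis minus_minus)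
  finally show ?thesis .
qed

lemma right_deriv_eq:
  assumes "(diff_quotient V g x \<longlongrightarrow> l) (at_right 0)"
  shows "right_deriv V g x = l"
  unfolding right_deriv_def using assms by (intro tendsto_Lim) auto

context circle_pair
begin

lemma left_deriv_refl:
  assumes "right_diff V g"
  shows "left_deriv (flip V) (refl_fun g) = (\<lambda>x. - refl_fun (right_deriv V g) x)"
proof
  fix x
  obtain l where l: "(diff_quotient V g (- x) \<longlongrightarrow> l) (at_right 0)"
    using assms by (auto simp: right_diff_def)
  then have "left_deriv (flip V) (refl_fun g) x = - l"
    using right_limit_iff_left_limit_refl[of V g "- x" l] by (intro V'.left_deriv_eq) simp
  with right_deriv_eq[OF l] show "left_deriv (flip V) (refl_fun g) x = - refl_fun (right_deriv V g) x"
    by (simp add: refl_fun_def)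
qed

lemma neg_refl_L2:
  assumes "G \<in> L2_circle (dV V)"
  shows "(\<lambda>x. - refl_fun G x) \<in> L2_circle (dW (flip V))"
    and "L2_norm (dW (flip V)) (\<lambda>x. - refl_fun G x) = L2_norm (dV V) G"
    and "(\<integral>x. - refl_fun G x \<partial>dW (flip V)) = - (\<integral>x. G x \<partial>dV V)"
  using assms L2_circle_dV_iff[of G] L2_circle_uminus[of "refl_fun G"] L2_norm_dV[of G] integral_dV[of G]
    L2_norm_cmult[of _ "-1" "refl_fun G"]
  by (auto simp: L2_circle_def)

lemma neg_refl_C1: "G \<in> C0 V \<longleftrightarrow> (\<lambda>x. - refl_fun G x) \<in> C1 (flip V)"
proof -
  interpret M: circle_pair "flip V" "flip W" by (rule mirrored)
  show ?thesis
    using M.C1_cmult(1)[of "refl_fun G" "-1"] M.C1_cmult(1)[of "\<lambda>x. - refl_fun G x" "-1"]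
    by (auto simp: C0_iff)
qed

lemma refl_int_V: "refl_fun (int_V W V G) = int_W (flip V) (flip W) (\<lambda>x. - refl_fun G x)"
  by (simp add: int_V_def)

lemma int_V_bound:
  assumes G: "G \<in> L2_circle (dV V)" and mean: "(\<integral>x. G x \<partial>dV V) = 0"
  shows "\<bar>int_V W V G x\<bar> \<le> 2 * sqrt (V 1 - V 0) * L2_norm (dV V) G"
    and "int_V W V G \<in> L2_circle (dW W)" and "(\<integral>x. int_V W V G x \<partial>dW W) = 0"
proof -
  interpret M: circle_pair "flip V" "flip W" by (rule mirrored)
  have m: "(\<integral>x. - refl_fun G x \<partial>dW (flip V)) = 0" using neg_refl_L2(3)[OF G] mean by simp
  note b = M.int_W_bound[OF neg_refl_L2(1)[OF G] m, folded refl_int_V]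
  show "\<bar>int_V W V G x\<bar> \<le> 2 * sqrt (V 1 - V 0) * L2_norm (dV V) G"
    using b(1)[of "- x"] unfolding neg_refl_L2(2)[OF G] flip_mass[OF period_V] by (simp add: refl_fun_def)
  show L: "int_V W V G \<in> L2_circle (dW W)" using b(2) by (simp add: L2_circle_dW_iff)
  show "(\<integral>x. int_V W V G x \<partial>dW W) = 0"
    using b(3) integral_dW_refl[of "int_V W V G"] L by (simp add: L2_circle_def)
qed

lemma int_V_diff:
  assumes F: "F \<in> L2_circle (dV V)" "(\<integral>x. F x \<partial>dV V) = 0" and G: "G \<in> L2_circle (dV V)" "(\<integral>x. G x \<partial>dV V) = 0"
  shows "int_V W V (\<lambda>x. F x - G x) = (\<lambda>x. int_V W V F x - int_V W V G x)"
proof -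
  interpret M: circle_pair "flip V" "flip W" by (rule mirrored)
  have m: "(\<integral>x. - refl_fun F x \<partial>dW (flip V)) = 0" "(\<integral>x. - refl_fun G x \<partial>dW (flip V)) = 0"
    using neg_refl_L2(3)[OF F(1)] neg_refl_L2(3)[OF G(1)] F G by auto
  have "(\<lambda>x. - refl_fun F x - - refl_fun G x) = (\<lambda>x. - refl_fun (\<lambda>x. F x - G x) x)"
    by (simp add: refl_fun_def fun_eq_iff)
  with M.int_W_diff[OF neg_refl_L2(1)[OF F(1)] m(1) neg_refl_L2(1)[OF G(1)] m(2)]
  show ?thesis by (simp add: int_V_def refl_fun_diff)
qed

lemma int_V_C0:
  assumes G: "G \<in> C0 V"
  shows "int_V W V G \<in> C1 W" "right_diff V (int_V W V G)" "right_deriv V (int_V W V G) = G"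
proof -
  interpret M: circle_pair "flip V" "flip W" by (rule mirrored)
  note i = M.int_W_C1[OF G[unfolded neg_refl_C1], folded refl_int_V]
  show "int_V W V G \<in> C1 W" using i(1) by (simp add: C1_iff)
  show d: "right_diff V (int_V W V G)" using i(2) by (simp add: right_diff_iff)
  show "right_deriv V (int_V W V G) = G"
  proof
    fix x
    show "right_deriv V (int_V W V G) x = G x"
      using fun_cong[OF left_deriv_refl[OF d], of "- x"] i(3) by (simp add: refl_fun_def)
  qed
qed

lemma int_V_right_deriv:
  assumes g: "g \<in> C1 W" "right_diff V g" and G: "right_deriv V g \<in> C0 V"
  shows "g = int_V W V (right_deriv V g)"
proof -
  interpret M: circle_pair "flip V" "flip W" by (rule mirrored)
  have "refl_fun g = int_W (flip V) (flip W) (left_deriv (flip V) (refl_fun g))"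
    using g G[unfolded neg_refl_C1]
    by (intro M.int_W_left_deriv) (simp_all add: C1_iff right_diff_iff[symmetric] left_deriv_refl)
  then have "refl_fun (refl_fun g) = int_V W V (right_deriv V g)"
    by (simp add: int_V_def left_deriv_refl[OF g(2)])
  then show ?thesis by simp
qed

lemma int_V_range_dense:
  assumes f: "f \<in> L2_circle (dW W)" "(\<integral>x. f x \<partial>dW W) = 0" and "0 < e"
  shows "\<exists>G\<in>C0 V. L2_norm (dW W) (\<lambda>x. f x - int_V W V G x) < e"
proof -
  interpret M: circle_pair "flip V" "flip W" by (rule mirrored)
  have "refl_fun f \<in> L2_circle (dV (flip W))" "(\<integral>x. refl_fun f x \<partial>dV (flip W)) = 0"
    using f integral_dW_refl[of f] by (auto simp: L2_circle_dW_iff) (auto simp: L2_circle_def)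
  from M.int_W_range_dense[OF this \<open>0 < e\<close>] obtain F where F: "F \<in> C1 (flip V)"
    "L2_norm (dV (flip W)) (\<lambda>x. refl_fun f x - int_W (flip V) (flip W) F x) < e" by blast
  define G where "G = refl_fun (\<lambda>x. - F x)"
  have FG: "F = (\<lambda>x. - refl_fun G x)" by (simp add: G_def)
  have G: "G \<in> C0 V" using F(1) unfolding FG by (simp add: neg_refl_C1)
  have "int_V W V G \<in> L2_circle (dW W)"
    by (rule int_V_bound(2)[OF C0_L2_circle[OF G] C0_mean[OF G]])
  then have "L2_norm (dV (flip W)) (refl_fun (\<lambda>x. f x - int_V W V G x)) = L2_norm (dW W) (\<lambda>x. f x - int_V W V G x)"
    using f(1) by (intro L2_norm_dW) (auto simp: L2_circle_def circle_fun_def)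
  with F(2) G show ?thesis
    unfolding FG refl_int_V[symmetric] refl_fun_diff[symmetric] by auto
qed

section \<open>The alternating scale and its smooth chains\<close>


text \<open>Level \<open>n\<close> carries \<open>dV\<close> if \<open>n\<close> is even and \<open>dW\<close> if \<open>n\<close> is odd. Everything below depends on \<open>n\<close> only
  through its parity, and indexing by \<open>n\<close> treats both kinds of functions at once.\<close>

abbreviation meas :: "nat \<Rightarrow> real measure" where "meas \<equiv> kappa W V"

definition mean_zero_L2 :: "nat \<Rightarrow> (real \<Rightarrow> real) set" where
  "mean_zero_L2 n = {f \<in> L2_circle (meas n). (\<integral>x. f x \<partial>meas n) = 0}"

definition regular :: "nat \<Rightarrow> (real \<Rightarrow> real) set" where
  "regular n = (if even n then C0 V else C1 W)"

definition integrate :: "nat \<Rightarrow> (real \<Rightarrow> real) \<Rightarrow> real \<Rightarrow> real" where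
  "integrate n = (if even n then int_W W V else int_V W V)"

definition strong_diff :: "nat \<Rightarrow> (real \<Rightarrow> real) \<Rightarrow> bool" where
  "strong_diff n = (if even n then left_diff W else right_diff V)"

definition strong_deriv :: "nat \<Rightarrow> (real \<Rightarrow> real) \<Rightarrow> real \<Rightarrow> real" where
  "strong_deriv n = (if even n then left_deriv W else right_deriv V)"

text \<open>The members of a chain are the successive strong derivatives of the member at level zero.\<close>

definition smooth_chain :: "(nat \<Rightarrow> real \<Rightarrow> real) \<Rightarrow> bool" where
  "smooth_chain x \<longleftrightarrow> (\<forall>n. x n \<in> regular n \<and> x n = integrate n (x (Suc n)))"

lemma finite_real_measure_meas: "finite_real_measure (meas n)"
  by (simp add: kappa_def dV.finite_real_measure_axioms W.finite_real_measure_dW)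

sublocale meas: finite_real_measure "meas n" for n
  by (rule finite_real_measure_meas)

definition mass :: "nat \<Rightarrow> real" where
  "mass n = measure (meas n) (space (meas n))"

lemma mass_pos: "0 < mass n"
  using W.mass_pos mass_V_pos by (simp add: mass_def kappa_def W.measure_dW mass_V[simplified])

lemma integral_const: "(\<integral>x. c \<partial>meas n) = mass n * c"
  by (simp add: mass_def)

lemma L2_sq_integrable: "f \<in> L2_circle (meas n) \<Longrightarrow> f \<in> sq_integrable (meas n)"
  using L2_circle_dV_sq_integrable L2_circle_dW_sq_integrable by (simp add: kappa_def split: if_splits)

lemma borel_measurable_meas: "f \<in> borel_measurable borel \<Longrightarrow> f \<in> borel_measurable (meas n)"
  by (simp add: kappa_def measurable_dV W.measurable_dW)

lemma L2_integrable: "f \<in> L2_circle (meas n) \<Longrightarrow> integrable (meas n) f"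
  by (rule meas.sq_integrable_imp_integrable[OF L2_sq_integrable])

lemma L2_const: "(\<lambda>_. c) \<in> L2_circle (meas n)"
  by (simp add: L2_circle_def circle_fun_def)

lemma L2_diff: "f \<in> L2_circle (meas n) \<Longrightarrow> g \<in> L2_circle (meas n) \<Longrightarrow> (\<lambda>x. f x - g x) \<in> L2_circle (meas n)"
  using sq_integrable_diff[OF L2_sq_integrable L2_sq_integrable, of f n g]
  by (auto simp: L2_circle_def circle_fun_def sq_integrable_def)

lemma L2_add: "f \<in> L2_circle (meas n) \<Longrightarrow> g \<in> L2_circle (meas n) \<Longrightarrow> (\<lambda>x. f x + g x) \<in> L2_circle (meas n)"
  using L2_diff[of f n "\<lambda>x. - g x"] L2_circle_uminus[of g] by simp

lemma L2_mult: "f \<in> L2_circle (meas n) \<Longrightarrow> g \<in> L2_circle (meas n) \<Longrightarrow> integrable (meas n) (\<lambda>x. f x * g x)"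
  by (intro sq_integrable_mult L2_sq_integrable)

lemma mean_zero_L2D: "f \<in> mean_zero_L2 n \<Longrightarrow> f \<in> L2_circle (meas n)" "f \<in> mean_zero_L2 n \<Longrightarrow> (\<integral>x. f x \<partial>meas n) = 0"
  by (auto simp: mean_zero_L2_def)

lemma mean_zero_L2_diff:
  assumes "f \<in> mean_zero_L2 n" "g \<in> mean_zero_L2 n"
  shows "(\<lambda>x. f x - g x) \<in> mean_zero_L2 n"
  using assms L2_diff[of f n g] L2_integrable by (simp add: mean_zero_L2_def)

lemma regular_mean_zero_L2: "f \<in> regular n \<Longrightarrow> f \<in> mean_zero_L2 n"
  by (auto simp: regular_def mean_zero_L2_def kappa_def C0_L2_circle C1_L2_circle C0_mean C1_mean)

lemma integrate_mean_zero_L2: "F \<in> mean_zero_L2 (Suc n) \<Longrightarrow> integrate n F \<in> mean_zero_L2 n"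
  using int_W_bound(2,3) int_V_bound(2,3)
  by (cases "even n") (auto simp: integrate_def mean_zero_L2_def kappa_def)

lemma integrate_diff:
  "F \<in> mean_zero_L2 (Suc n) \<Longrightarrow> G \<in> mean_zero_L2 (Suc n)
    \<Longrightarrow> integrate n (\<lambda>x. F x - G x) = (\<lambda>x. integrate n F x - integrate n G x)"
  using int_W_diff int_V_diff by (cases "even n") (auto simp: integrate_def mean_zero_L2_def kappa_def)

text \<open>One constant serves for the passage from the \<open>L\<^sup>2\<close> norm of a function to the uniform norm of its
  primitive and for the passage from the uniform norm back to the \<open>L\<^sup>2\<close> norm.\<close>

definition bound :: real where
  "bound = 1 + 2 * sqrt (W 1 - W 0) + 2 * sqrt (V 1 - V 0)"

lemma bound_ge_1: "1 \<le> bound"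
  using W.mass_pos mass_V_pos by (simp add: bound_def)

lemma bound_ge_mass: "2 * sqrt (mass n) \<le> bound"
  using W.mass_pos mass_V_pos by (simp add: bound_def mass_def kappa_def W.measure_dW mass_V[simplified])

lemma integrate_le_L2_norm:
  assumes "F \<in> mean_zero_L2 (Suc n)"
  shows "\<bar>integrate n F x\<bar> \<le> bound * L2_norm (meas (Suc n)) F"
proof -
  have "\<bar>integrate n F x\<bar> \<le> 2 * sqrt (mass (Suc n)) * L2_norm (meas (Suc n)) F"
    using assms int_W_bound(1)[of F x] int_V_bound(1)[of F x]
    by (cases "even n") (auto simp: integrate_def mean_zero_L2_def kappa_def mass_def W.measure_dW mass_V[simplified])
  also have "\<dots> \<le> bound * L2_norm (meas (Suc n)) F"
    by (intro mult_right_mono bound_ge_mass) simp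
  finally show ?thesis .
qed

lemma L2_norm_le_bound:
  assumes "f \<in> borel_measurable borel" "\<And>x. \<bar>f x\<bar> \<le> B"
  shows "L2_norm (meas n) f \<le> bound * B"
proof -
  have B: "0 \<le> B" using assms(2)[of 0] by simp
  have "L2_norm (meas n) f \<le> sqrt (mass n) * B"
    unfolding mass_def by (rule meas.L2_norm_le_sup[OF borel_measurable_meas[OF assms(1)] assms(2) B])
  also have "\<dots> \<le> bound * B"
    using bound_ge_mass[of n] mass_pos[of n] B by (intro mult_right_mono) (auto intro: order_trans[rotated])
  finally show ?thesis .
qed

lemma mean_zero_L2_borel: "f \<in> mean_zero_L2 n \<Longrightarrow> f \<in> borel_measurable borel"
  by (simp add: mean_zero_L2_def L2_circle_def)

lemma integrate_L2_norm_le: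
  assumes "F \<in> mean_zero_L2 (Suc n)"
  shows "L2_norm (meas n) (integrate n F) \<le> bound\<^sup>2 * L2_norm (meas (Suc n)) F"
  using L2_norm_le_bound[OF mean_zero_L2_borel[OF integrate_mean_zero_L2[OF assms]] integrate_le_L2_norm[OF assms], of n]
  by (simp add: power2_eq_square mult.assoc)

lemma integrate_regular:
  assumes "F \<in> regular (Suc n)"
  shows "integrate n F \<in> regular n" "strong_diff n (integrate n F)" "strong_deriv n (integrate n F) = F"
  using assms int_W_C1 int_V_C0
  by (auto simp: regular_def integrate_def strong_diff_def strong_deriv_def split: if_splits)

lemma integrate_strong_deriv:
  assumes "f \<in> regular n" "strong_diff n f" "strong_deriv n f \<in> regular (Suc n)"
  shows "f = integrate n (strong_deriv n f)"
  using assms int_W_left_deriv int_V_right_deriv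
  by (cases "even n") (auto simp: regular_def integrate_def strong_diff_def strong_deriv_def)

lemma integrate_dense:
  assumes "f \<in> mean_zero_L2 n" "0 < e"
  obtains F where "F \<in> regular (Suc n)" "L2_norm (meas n) (\<lambda>x. f x - integrate n F x) < e"
  using assms int_W_range_dense[of f e] int_V_range_dense[of f e] that
  by (cases "even n") (auto simp: regular_def integrate_def mean_zero_L2_def kappa_def)

lemma integrate_by_parts:
  assumes F: "F \<in> mean_zero_L2 (Suc n)" and G: "G \<in> mean_zero_L2 n"
  shows "(\<integral>x. integrate n F x * G x \<partial>meas n) = - (\<integral>x. F x * integrate (Suc n) G x \<partial>meas (Suc n))"
  using assms integration_by_parts[of F G] integration_by_parts[of G F]
  by (cases "even n") (simp_all add: integrate_def mean_zero_L2_def kappa_def mult.commute)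

lemma regular_uniform_limit:
  assumes u: "uniform_limit UNIV f g sequentially" and f: "\<And>i. f i \<in> regular n"
  shows "g \<in> regular n"
proof -
  have circ: "circle_fun g"
    by (rule circle_fun_uniform_limit[OF u])
      (use f in \<open>cases "even n"; simp add: regular_def C0_def C1_def\<close>)
  have reg: "if even n then cadlag g else caglad g"
    using cadlag_uniform_limit[OF u] caglad_uniform_limit[OF u] f
    by (auto simp: regular_def C0_def C1_def split: if_splits)
  obtain B where "\<And>x. \<bar>g x\<bar> \<le> B"
    using reg circ circle_cadlag_bounded circle_caglad_bounded by (metis (full_types))
  moreover have gm: "g \<in> borel_measurable borel"
    using reg cadlag_borel_measurable caglad_borel_measurable by (metis (full_types))
  ultimately have ig: "integrable (meas n) g"
    by (intro meas.sq_integrable_imp_integrable meas.sq_integrable_bounded borel_measurable_meas)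
  have "\<bar>\<integral>x. g x \<partial>meas n\<bar> \<le> e" if e: "0 < e" for e
  proof -
    define d where "d = e / mass n"
    have "0 < d" using e mass_pos[of n] by (simp add: d_def)
    with u have "\<forall>\<^sub>F i in sequentially. \<forall>x\<in>UNIV. dist (f i x) (g x) < d" by (rule uniform_limitD)
    from eventually_happens'[OF sequentially_bot this]
    obtain i where "\<And>x. dist (f i x) (g x) < d" by blast
    then have i: "\<bar>f i x - g x\<bar> \<le> d" for x by (simp add: dist_real_def less_imp_le)
    have fi: "f i \<in> mean_zero_L2 n" by (rule regular_mean_zero_L2[OF f])
    note ifi = L2_integrable[OF mean_zero_L2D(1)[OF fi]]
    have "(\<integral>x. g x \<partial>meas n) = - (\<integral>x. f i x - g x \<partial>meas n)"
      using ifi ig mean_zero_L2D(2)[OF fi] by simp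
    then have "\<bar>\<integral>x. g x \<partial>meas n\<bar> \<le> (\<integral>x. \<bar>f i x - g x\<bar> \<partial>meas n)"
      using integral_abs_bound[of "meas n" "\<lambda>x. f i x - g x"] by simp
    also have "\<dots> \<le> (\<integral>x. d \<partial>meas n)" using i ifi ig by (intro integral_mono) auto
    also have "\<dots> = e" unfolding integral_const d_def using mass_pos[of n] by simp
    finally show ?thesis .
  qed
  then have "\<bar>\<integral>x. g x \<partial>meas n\<bar> \<le> 0" by (rule field_le_epsilon[of _ 0, simplified])
  then show ?thesis
    using circ reg by (auto simp: regular_def C0_def C1_def kappa_def)
qed

lemma regular_parity: "even m = even n \<Longrightarrow> regular m = regular n" "even m = even n \<Longrightarrow> integrate m = integrate n"
  by (simp_all add: regular_def integrate_def)

text \<open>A chain that is given only from level \<open>k\<close> upwards is completed by integrating its lowest member \<open>k\<close> more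
  times.\<close>

lemma smooth_chain_extend_down:
  assumes "\<And>j. x j \<in> regular (k + j)" "\<And>j. x j = integrate (k + j) (x (Suc j))"
  obtains w where "smooth_chain w" "\<And>j. w (k + j) = x j"
proof -
  have "\<exists>w. smooth_chain w \<and> (\<forall>j. w (k + j) = x j)"
    if "\<And>j. x j \<in> regular (k + j)" "\<And>j. x j = integrate (k + j) (x (Suc j))" for x
    using that
  proof (induction k arbitrary: x)
    case 0
    then have "smooth_chain x" unfolding smooth_chain_def by (metis add_0)
    then show ?case by (metis add_0)
  next
    case (Suc k)
    let ?x = "\<lambda>j. case j of 0 \<Rightarrow> integrate k (x 0) | Suc i \<Rightarrow> x i"
    have "\<exists>w. smooth_chain w \<and> (\<forall>j. w (k + j) = ?x j)"
    proof (rule Suc.IH)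
      fix j
      show "?x j \<in> regular (k + j)"
        using Suc.prems(1)[of 0] Suc.prems(1)[of "j - 1"] integrate_regular(1) by (cases j) auto
      show "?x j = integrate (k + j) (?x (Suc j))"
      proof (cases j)
        case (Suc i)
        then show ?thesis using Suc.prems(2)[of i] by (simp only: nat.case add_Suc_right add_Suc)
      qed simp
    qed
    then obtain w where w: "smooth_chain w" "\<And>j. w (k + j) = ?x j" by blast
    have "w (Suc k + j) = x j" for j using w(2)[of "Suc j"] by simp
    with w(1) show ?case by blast
  qed
  with assms that show ?thesis by blast
qed

text \<open>A chain may be restarted at any other level of the same parity.\<close>

lemma smooth_chain_reindex:
  assumes x: "smooth_chain x" and "even a = even b"
  obtains w where "smooth_chain w" "\<And>j. w (a + j) = x (b + j)"
proof (rule smooth_chain_extend_down[of "\<lambda>j. x (b + j)" a])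
  have p: "even (a + j) = even (b + j)" for j using assms(2) by simp
  show "x (b + j) \<in> regular (a + j)" "x (b + j) = integrate (a + j) (x (b + Suc j))" for j
    using x unfolding smooth_chain_def regular_parity(1)[OF p] regular_parity(2)[OF p]
    by (metis add_Suc_right)+
qed (use that in blast)

lemma smooth_chain_strong:
  assumes "smooth_chain x"
  shows "strong_diff n (x n)" "strong_deriv n (x n) = x (Suc n)" "x n \<in> regular n"
proof -
  have r: "x (Suc n) \<in> regular (Suc n)" and e: "x n = integrate n (x (Suc n))"
    using assms unfolding smooth_chain_def by blast+
  show "strong_diff n (x n)" "strong_deriv n (x n) = x (Suc n)"
    unfolding e using integrate_regular[OF r] by auto
  show "x n \<in> regular n" using assms unfolding smooth_chain_def by blast
qed

text \<open>The approximants at level \<open>k + j\<close> obtained by integrating the \<open>(j + m)\<close>-th choice down \<open>m\<close> levels.\<close>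

primrec descend :: "(nat \<Rightarrow> real \<Rightarrow> real) \<Rightarrow> nat \<Rightarrow> nat \<Rightarrow> nat \<Rightarrow> real \<Rightarrow> real" where
  "descend z k 0 j = z j"
| "descend z k (Suc m) j = integrate (k + j) (descend z k m (Suc j))"

text \<open>This is the Mittag-Leffler argument for the inverse system of the maps \<open>integrate\<close>. Each map has
  dense range, so successive errors can be made to decrease fast. Only the first error is measured in
  \<open>L\<^sup>2\<close>; all others have been integrated at least once and are small uniformly, so the limits exist and
  stay regular.\<close>

theorem smooth_chains_dense:
  assumes y: "y \<in> mean_zero_L2 k" and "0 < e"
  obtains x where "smooth_chain x" "L2_norm (meas k) (\<lambda>t. y t - x k t) < e"
proof -
  define c where "c = e / (2 * bound)"
  have c: "0 < c" using \<open>0 < e\<close> bound_ge_1 by (simp add: c_def)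
  \<comment> \<open>Going down one level multiplies a uniform error by at most \<open>bound\<^sup>2\<close>. The errors \<open>\<delta> j\<close> outweigh this
    by a geometric factor, so that the corrections at every level sum to at most \<open>c\<close>.\<close>
  define \<delta> where "\<delta> j = c * (1 / (2 * bound\<^sup>2)) ^ j" for j
  have \<delta>_pos: "0 < \<delta> j" for j using c bound_ge_1 by (simp add: \<delta>_def)
  define P where "P j f \<longleftrightarrow> f \<in> mean_zero_L2 (k + j) \<and> (if j = 0 then f = y else f \<in> regular (k + j))" for j f
  have "\<exists>z. \<forall>j. P j (z j) \<and> L2_norm (meas (k + j)) (\<lambda>t. z j t - integrate (k + j) (z (Suc j)) t) < \<delta> j"
  proof (rule dependent_nat_choice)
    show "\<exists>f. P 0 f" using y by (simp add: P_def)
    fix f j assume "P j f"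
    then have "f \<in> mean_zero_L2 (k + j)" by (simp add: P_def)
    from integrate_dense[OF this \<delta>_pos] obtain F where "F \<in> regular (Suc (k + j))"
      "L2_norm (meas (k + j)) (\<lambda>t. f t - integrate (k + j) F t) < \<delta> j" by blast
    then show "\<exists>F. P (Suc j) F \<and> L2_norm (meas (k + j)) (\<lambda>t. f t - integrate (k + j) F t) < \<delta> j"
      using regular_mean_zero_L2 by (intro exI[of _ F]) (simp add: P_def)
  qed
  then obtain z where z: "\<And>j. P j (z j)"
    "\<And>j. L2_norm (meas (k + j)) (\<lambda>t. z j t - integrate (k + j) (z (Suc j)) t) < \<delta> j" by blast
  have z0: "z 0 = y" using z(1)[of 0] by (simp add: P_def)
  have z_mean: "z j \<in> mean_zero_L2 (k + j)" for j using z(1)[of j] by (simp add: P_def)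
  let ?S = "descend z k"
  have S_Suc: "?S m (Suc j) \<in> regular (k + Suc j)" for m j
  proof (induction m arbitrary: j)
    case 0
    then show ?case using z(1)[of "Suc j"] by (simp add: P_def)
  next
    case (Suc m)
    from integrate_regular(1)[of "?S m (Suc (Suc j))" "k + Suc j"] Suc[of "Suc j"] show ?case by simp
  qed
  have S_reg: "?S (Suc m) j \<in> regular (k + j)" for m j
    using integrate_regular(1)[of "?S m (Suc j)" "k + j"] S_Suc[of m j] by simp
  have S_mean: "?S m (Suc j) \<in> mean_zero_L2 (Suc (k + j))" for m j
    using regular_mean_zero_L2[OF S_Suc] by simp
  have step: "\<bar>?S (Suc (Suc m)) j t - ?S (Suc m) j t\<bar> \<le> bound ^ (2 * m + 1) * \<delta> (Suc (m + j))" for m j t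
  proof (induction m arbitrary: j t)
    case 0
    let ?d = "\<lambda>t. ?S (Suc 0) (Suc j) t - ?S 0 (Suc j) t"
    have "\<bar>?S (Suc (Suc 0)) j t - ?S (Suc 0) j t\<bar> = \<bar>integrate (k + j) ?d t\<bar>"
      using integrate_diff[OF S_mean[of "Suc 0" j] S_mean[of 0 j]] by simp
    also have "\<dots> \<le> bound * L2_norm (meas (Suc (k + j))) ?d"
      by (intro integrate_le_L2_norm mean_zero_L2_diff S_mean)
    also have "L2_norm (meas (Suc (k + j))) ?d \<le> \<delta> (Suc j)"
      using z(2)[of "Suc j"] by (simp add: L2_norm_minus_commute)
    finally show ?case using bound_ge_1 by (simp add: mult_left_mono)
  next
    case (Suc m)
    let ?d = "\<lambda>t. ?S (Suc (Suc m)) (Suc j) t - ?S (Suc m) (Suc j) t"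
    have d: "?d \<in> mean_zero_L2 (Suc (k + j))" by (intro mean_zero_L2_diff S_mean)
    have "\<bar>?S (Suc (Suc (Suc m))) j t - ?S (Suc (Suc m)) j t\<bar> = \<bar>integrate (k + j) ?d t\<bar>"
      using integrate_diff[OF S_mean[of "Suc (Suc m)" j] S_mean[of "Suc m" j]] by simp
    also have "\<dots> \<le> bound * L2_norm (meas (Suc (k + j))) ?d" by (rule integrate_le_L2_norm[OF d])
    also have "L2_norm (meas (Suc (k + j))) ?d \<le> bound * (bound ^ (2 * m + 1) * \<delta> (Suc (m + Suc j)))"
      by (rule L2_norm_le_bound[OF mean_zero_L2_borel[OF d] Suc])
    finally show ?case using bound_ge_1 by (simp add: mult_left_mono mult_ac)
  qed
  have step': "\<bar>?S (Suc (Suc m)) j t - ?S (Suc m) j t\<bar> \<le> c * (1 / 2) ^ Suc m" for m j t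
  proof -
    have b: "bound \<noteq> 0" using bound_ge_1 by simp
    have "bound ^ (2 * m + 1) * \<delta> (Suc (m + j))
        = c * (1 / 2) ^ Suc m * ((1 / (2 * bound\<^sup>2)) ^ j * (1 / bound))"
      using b unfolding \<delta>_def by (simp add: power_add power_mult power_divide power_mult_distrib
          power2_eq_square field_simps)
    also have "\<dots> \<le> c * (1 / 2) ^ Suc m * (1 * 1)"
    proof (intro mult_left_mono mult_mono power_le_one)
      have "1 \<le> bound\<^sup>2" using bound_ge_1 by (simp add: one_le_power)
      then show "1 / (2 * bound\<^sup>2) \<le> 1" by (simp add: divide_le_eq)
    qed (use bound_ge_1 c in auto)
    finally show ?thesis using step[where m=m and j=j and t=t] by linarith
  qed
  define x where "x j t = ?S (Suc 0) j t + (\<Sum>m. ?S (Suc (Suc m)) j t - ?S (Suc m) j t)" for j t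
  have summ: "(\<lambda>m. c * (1 / 2) ^ Suc m) sums c"
  proof -
    have "(\<lambda>m. c * (1/2::real) * (1 / 2) ^ m) sums (c * (1/2) * (1 / (1 - 1 / 2)))"
      by (intro sums_mult geometric_sums) simp
    then show ?thesis by simp
  qed
  have lim: "uniform_limit UNIV (\<lambda>N. ?S (Suc N) j) (x j) sequentially" for j
  proof -
    have "uniform_limit UNIV (\<lambda>N t. \<Sum>m<N. ?S (Suc (Suc m)) j t - ?S (Suc m) j t)
        (\<lambda>t. \<Sum>m. ?S (Suc (Suc m)) j t - ?S (Suc m) j t) sequentially"
      by (rule Weierstrass_m_test[where M="\<lambda>m. c * (1 / 2) ^ Suc m"])
        (use step' sums_summable[OF summ] in auto)
    from uniform_limit_add[OF uniform_limit_const this, of "?S (Suc 0) j"]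
    have "uniform_limit UNIV (\<lambda>N t. ?S (Suc 0) j t + (\<Sum>m<N. ?S (Suc (Suc m)) j t - ?S (Suc m) j t))
        (x j) sequentially"
      unfolding x_def[abs_def] .
    moreover have eq: "?S (Suc 0) j t + (\<Sum>m<N. ?S (Suc (Suc m)) j t - ?S (Suc m) j t) = ?S (Suc N) j t" for N t
      using sum_lessThan_telescope[of "\<lambda>m. ?S (Suc m) j t" N] by simp
    ultimately show ?thesis unfolding eq by simp
  qed
  have x_reg: "x j \<in> regular (k + j)" for j
    by (rule regular_uniform_limit[OF lim S_reg])
  \<comment> \<open>Integration is continuous for uniform convergence, so the relation between consecutive approximants
    passes to the limit.\<close>
  have x_int: "x j = integrate (k + j) (x (Suc j))" for j
  proof
    fix t
    have "(\<lambda>N. ?S (Suc (Suc N)) j t) \<longlonglongrightarrow> integrate (k + j) (x (Suc j)) t"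
    proof (rule LIMSEQ_I)
      fix r :: real assume "0 < r"
      define s where "s = r / (2 * bound\<^sup>2)"
      have s: "0 < s" "bound * (bound * s) < r" 
        using \<open>0 < r\<close> bound_ge_1 by (auto simp: s_def power2_eq_square)
      have "\<forall>\<^sub>F N in sequentially. \<forall>t\<in>UNIV. dist (?S (Suc N) (Suc j) t) (x (Suc j) t) < s"
        by (rule uniform_limitD[OF lim s(1)])
      then obtain N where N: "\<And>n t. N \<le> n \<Longrightarrow> \<bar>?S (Suc n) (Suc j) t - x (Suc j) t\<bar> \<le> s"
        by (force simp: eventually_sequentially dist_real_def less_imp_le)
      have "norm (?S (Suc (Suc n)) j t - integrate (k + j) (x (Suc j)) t) < r" if "N \<le> n" for n
      proof -
        let ?d = "\<lambda>t. ?S (Suc n) (Suc j) t - x (Suc j) t"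
        have xm: "x (Suc j) \<in> mean_zero_L2 (Suc (k + j))"
          using regular_mean_zero_L2[OF x_reg[of "Suc j"]] by simp
        have d: "?d \<in> mean_zero_L2 (Suc (k + j))" by (rule mean_zero_L2_diff[OF S_mean xm])
        have "norm (?S (Suc (Suc n)) j t - integrate (k + j) (x (Suc j)) t) = \<bar>integrate (k + j) ?d t\<bar>"
          using integrate_diff[OF S_mean[of "Suc n" j] xm] by simp
        also have "\<dots> \<le> bound * L2_norm (meas (Suc (k + j))) ?d" by (rule integrate_le_L2_norm[OF d])
        also have "\<dots> \<le> bound * (bound * s)"
          using bound_ge_1 by (intro mult_left_mono L2_norm_le_bound[OF mean_zero_L2_borel[OF d] N[OF that]]) auto
        finally show ?thesis using s(2) by simp
      qed
      then show "\<exists>N. \<forall>n\<ge>N. norm (?S (Suc (Suc n)) j t - integrate (k + j) (x (Suc j)) t) < r" by blast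
    qed
    moreover have "(\<lambda>N. ?S (Suc (Suc N)) j t) \<longlonglongrightarrow> x j t"
      using LIMSEQ_Suc[OF tendsto_uniform_limitI[OF lim, of t j]] by simp
    ultimately show "x j t = integrate (k + j) (x (Suc j)) t" by (rule LIMSEQ_unique[rotated])
  qed
  obtain w where w: "smooth_chain w" "\<And>j. w (k + j) = x j"
    using smooth_chain_extend_down[OF x_reg x_int] by blast
  have "L2_norm (meas k) (\<lambda>t. y t - x 0 t) < e"
  proof -
    have xm: "x 0 \<in> mean_zero_L2 k" using regular_mean_zero_L2[OF x_reg[of 0]] by simp
    have Sm: "?S (Suc 0) 0 \<in> mean_zero_L2 k" using regular_mean_zero_L2[OF S_reg[of 0 0]] by simp
    have "\<bar>?S (Suc 0) 0 t - x 0 t\<bar> \<le> c" for t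
    proof -
      have "\<bar>\<Sum>m. ?S (Suc (Suc m)) 0 t - ?S (Suc m) 0 t\<bar> \<le> (\<Sum>m. c * (1 / 2) ^ Suc m)"
        unfolding real_norm_def[symmetric]
        by (rule norm_suminf_le[OF _ sums_summable[OF summ]]) (unfold real_norm_def, rule step')
      then show ?thesis using sums_unique[OF summ] by (simp add: x_def)
    qed
    then have "L2_norm (meas k) (\<lambda>t. ?S (Suc 0) 0 t - x 0 t) \<le> bound * c"
      by (rule L2_norm_le_bound[OF mean_zero_L2_borel[OF mean_zero_L2_diff[OF Sm xm]]])
    moreover have "L2_norm (meas k) (\<lambda>t. y t - ?S (Suc 0) 0 t) < c"
      using z(2)[of 0] by (simp add: z0 \<delta>_def)
    moreover have "c + bound * c \<le> e"
      using mult_right_mono[OF bound_ge_1, of c] c bound_ge_1 by (simp add: c_def)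
    ultimately show ?thesis
      using L2_norm_triangle_diff[of y "meas k" "?S (Suc 0) 0" "x 0"] y Sm xm
      by (simp add: L2_sq_integrable mean_zero_L2D)
  qed
  with w(2)[of 0] have "L2_norm (meas k) (\<lambda>t. y t - w k t) < e" by simp
  with w(1) that show ?thesis by blast
qed

end

section \<open>Test functions are the ends of smooth chains\<close>

lemma left_deriv_const_add: "left_deriv W (\<lambda>x. c + f x) = left_deriv W f"
proof -
  have eq: "diff_quotient W (\<lambda>x. c + f x) = diff_quotient W f"
    by (intro ext) (simp add: diff_quotient_def)
  show ?thesis by (rule ext) (simp only: left_deriv_def eq)
qed

lemma right_deriv_const_add: "right_deriv V (\<lambda>x. c + f x) = right_deriv V f"
proof -
  have eq: "diff_quotient V (\<lambda>x. c + f x) = diff_quotient V f"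
    by (intro ext) (simp add: diff_quotient_def)
  show ?thesis by (rule ext) (simp only: right_deriv_def eq)
qed

context circle_pair
begin

lemma Cinf_WV_iff: "h \<in> Cinf_WV W V \<longleftrightarrow> (\<exists>c x. smooth_chain x \<and> h = (\<lambda>t. c + x 0 t))"
proof
  assume "h \<in> Cinf_WV W V"
  then obtain c f where h: "h = (\<lambda>t. c + f t)" and f: "f \<in> C0 V"
    and D: "\<And>n. if even n then left_diff W (strong_D_WV W V n f) \<and> strong_D_WV W V (Suc n) f \<in> C1 W
          else right_diff V (strong_D_WV W V n f) \<and> strong_D_WV W V (Suc n) f \<in> C0 V"
    by (auto simp: Cinf_WV_def)
  let ?x = "\<lambda>n. strong_D_WV W V n f"
  have r: "?x n \<in> regular n" for n
  proof (cases n)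
    case (Suc m)
    then show ?thesis using D[of m] by (simp add: regular_def split: if_splits)
  qed (use f in \<open>simp add: regular_def\<close>)
  have d: "strong_diff n (?x n)" for n
    using D[of n] by (simp add: strong_diff_def split: if_splits)
  have s: "strong_deriv n (?x n) = ?x (Suc n)" for n
    by (simp add: strong_deriv_def)
  have "?x n = integrate n (?x (Suc n))" for n
    using integrate_strong_deriv[OF r d, of n] r[of "Suc n"] unfolding s by simp
  with r have "smooth_chain ?x" unfolding smooth_chain_def by blast
  moreover have "h = (\<lambda>t. c + ?x 0 t)" by (simp add: h)
  ultimately show "\<exists>c x. smooth_chain x \<and> h = (\<lambda>t. c + x 0 t)" by blast
next
  assume "\<exists>c x. smooth_chain x \<and> h = (\<lambda>t. c + x 0 t)"
  then obtain c x where x: "smooth_chain x" and h: "h = (\<lambda>t. c + x 0 t)" by blast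
  note st = smooth_chain_strong[OF x]
  have e: "strong_D_WV W V n (x 0) = x n" for n
  proof (induction n)
    case (Suc n)
    then show ?case using st(2)[of n] by (simp add: strong_deriv_def split: if_splits)
  qed simp
  have "if even n then left_diff W (strong_D_WV W V n (x 0)) \<and> strong_D_WV W V (Suc n) (x 0) \<in> C1 W
      else right_diff V (strong_D_WV W V n (x 0)) \<and> strong_D_WV W V (Suc n) (x 0) \<in> C0 V" for n
    unfolding e
    using st(1)[of n] st(3)[of "Suc n"] by (simp add: strong_diff_def regular_def split: if_splits)
  moreover have "x 0 \<in> C0 V" using st(3)[of 0] by (simp add: regular_def)
  ultimately show "h \<in> Cinf_WV W V" unfolding Cinf_WV_def h by blast
qed

lemma Cinf_VW_iff: "h \<in> Cinf_VW V W \<longleftrightarrow> (\<exists>c x. smooth_chain x \<and> h = (\<lambda>t. c + x 1 t))"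
proof
  assume "h \<in> Cinf_VW V W"
  then obtain c g where h: "h = (\<lambda>t. c + g t)" and g: "g \<in> C1 W"
    and D: "\<And>n. if even n then right_diff V (strong_D_VW V W n g) \<and> strong_D_VW V W (Suc n) g \<in> C0 V
          else left_diff W (strong_D_VW V W n g) \<and> strong_D_VW V W (Suc n) g \<in> C1 W"
    by (auto simp: Cinf_VW_def)
  let ?x = "\<lambda>n. strong_D_VW V W n g"
  have r: "?x n \<in> regular (1 + n)" for n
  proof (cases n)
    case (Suc m)
    then show ?thesis using D[of m] by (simp add: regular_def split: if_splits)
  qed (use g in \<open>simp add: regular_def\<close>)
  have d: "strong_diff (1 + n) (?x n)" for n
    using D[of n] by (simp add: strong_diff_def split: if_splits)
  have s: "strong_deriv (1 + n) (?x n) = ?x (Suc n)" for n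
    by (simp add: strong_deriv_def)
  have "?x n = integrate (1 + n) (?x (Suc n))" for n
    using integrate_strong_deriv[OF r d, of n] r[of "Suc n"] unfolding s by simp
  from smooth_chain_extend_down[OF r this] obtain w where w: "smooth_chain w" "\<And>j. w (1 + j) = ?x j"
    by blast
  have "h = (\<lambda>t. c + w 1 t)" using w(2)[of 0] by (simp add: h)
  with w(1) show "\<exists>c x. smooth_chain x \<and> h = (\<lambda>t. c + x 1 t)" by blast
next
  assume "\<exists>c x. smooth_chain x \<and> h = (\<lambda>t. c + x 1 t)"
  then obtain c x where x: "smooth_chain x" and h: "h = (\<lambda>t. c + x 1 t)" by blast
  note st = smooth_chain_strong[OF x]
  have e: "strong_D_VW V W n (x 1) = x (Suc n)" for n
  proof (induction n)
    case (Suc n)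
    then show ?case using st(2)[of "Suc n"] by (simp add: strong_deriv_def split: if_splits)
  qed simp
  have "if even n then right_diff V (strong_D_VW V W n (x 1)) \<and> strong_D_VW V W (Suc n) (x 1) \<in> C0 V
      else left_diff W (strong_D_VW V W n (x 1)) \<and> strong_D_VW V W (Suc n) (x 1) \<in> C1 W" for n
    unfolding e
    using st(1)[of "Suc n"] st(3)[of "Suc (Suc n)"] by (simp add: strong_diff_def regular_def split: if_splits)
  moreover have "x 1 \<in> C1 W" using st(3)[of 1] by (simp add: regular_def)
  ultimately show "h \<in> Cinf_VW V W" unfolding Cinf_VW_def h by blast
qed

section \<open>Weak derivatives\<close>

definition weak_step :: "nat \<Rightarrow> (real \<Rightarrow> real) \<Rightarrow> (real \<Rightarrow> real) \<Rightarrow> bool" where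
  "weak_step n f F \<longleftrightarrow> (if even n then has_weak_deriv_W W V f F else has_weak_deriv_V W V f F)"

text \<open>The test functions are the members at level 0 or 1 of chains plus constants. Restarting the chain at
  level \<open>n + 1\<close>, which has the same parity, puts test functions, their derivatives and the functions that
  are tested on matching levels.\<close>

lemma weak_step_chain:
  "weak_step n f F \<longleftrightarrow> f \<in> L2_circle (meas n) \<and> F \<in> L2_circle (meas (Suc n)) \<and>
    (\<forall>c x. smooth_chain x \<longrightarrow>
      (\<integral>t. f t * x (Suc (Suc n)) t \<partial>meas n) = - (\<integral>t. F t * (c + x (Suc n) t) \<partial>meas (Suc n)))"
proof -
  let ?E = "\<lambda>a b. \<forall>c x. smooth_chain x \<longrightarrow>
      (\<integral>t. f t * x b t \<partial>meas n) = - (\<integral>t. F t * (c + x a t) \<partial>meas (Suc n))"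
  have shift: "?E a (Suc a)" if E: "?E b (Suc b)" and p: "even a = even b" for a b
  proof (intro allI impI)
    fix c x assume "smooth_chain x"
    then obtain w where w: "smooth_chain w" "\<And>j. w (b + j) = x (a + j)"
      using smooth_chain_reindex[of x b a] p by blast
    show "(\<integral>t. f t * x (Suc a) t \<partial>meas n) = - (\<integral>t. F t * (c + x a t) \<partial>meas (Suc n))"
      using E[rule_format, OF w(1), of c] w(2)[of 0] w(2)[of 1] by simp
  qed
  show ?thesis
  proof (cases "even n")
    case True
    have tests: "(\<forall>g\<in>Cinf_VW V W. Q g) \<longleftrightarrow> (\<forall>c x. smooth_chain x \<longrightarrow> Q (\<lambda>t. c + x 1 t))" for Q
      unfolding Ball_def Cinf_VW_iff by blast
    have r: "right_deriv V (\<lambda>t. c + x 1 t) = x (Suc 1)" if "smooth_chain x" for c x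
      using smooth_chain_strong(2)[OF that, of 1] by (simp add: right_deriv_const_add strong_deriv_def)
    have "weak_step n f F \<longleftrightarrow> f \<in> L2_circle (meas n) \<and> F \<in> L2_circle (meas (Suc n)) \<and>
        (\<forall>c x. smooth_chain x \<longrightarrow> (\<integral>t. f t * right_deriv V (\<lambda>t. c + x 1 t) t \<partial>meas n)
          = - (\<integral>t. F t * (c + x 1 t) \<partial>meas (Suc n)))"
      using True unfolding weak_step_def has_weak_deriv_W_def tests by (simp add: kappa_def)
    also have "\<dots> \<longleftrightarrow> f \<in> L2_circle (meas n) \<and> F \<in> L2_circle (meas (Suc n)) \<and> ?E 1 (Suc 1)"
      by (simp only: r cong: imp_cong)
    finally have "weak_step n f F \<longleftrightarrow> f \<in> L2_circle (meas n) \<and> F \<in> L2_circle (meas (Suc n)) \<and> ?E 1 (Suc 1)" .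
    moreover have "?E 1 (Suc 1) \<longleftrightarrow> ?E (Suc n) (Suc (Suc n))"
    proof
      assume "?E 1 (Suc 1)"
      then show "?E (Suc n) (Suc (Suc n))" by (rule shift) (use True in simp)
    next
      assume "?E (Suc n) (Suc (Suc n))"
      then show "?E 1 (Suc 1)" by (rule shift) (use True in simp)
    qed
    ultimately show ?thesis by simp
  next
    case False
    have tests: "(\<forall>g\<in>Cinf_WV W V. Q g) \<longleftrightarrow> (\<forall>c x. smooth_chain x \<longrightarrow> Q (\<lambda>t. c + x 0 t))" for Q
      unfolding Ball_def Cinf_WV_iff by blast
    have r: "left_deriv W (\<lambda>t. c + x 0 t) = x (Suc 0)" if "smooth_chain x" for c x
      using smooth_chain_strong(2)[OF that, of 0] by (simp add: left_deriv_const_add strong_deriv_def)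
    have "weak_step n f F \<longleftrightarrow> f \<in> L2_circle (meas n) \<and> F \<in> L2_circle (meas (Suc n)) \<and>
        (\<forall>c x. smooth_chain x \<longrightarrow> (\<integral>t. f t * left_deriv W (\<lambda>t. c + x 0 t) t \<partial>meas n)
          = - (\<integral>t. F t * (c + x 0 t) \<partial>meas (Suc n)))"
      using False unfolding weak_step_def has_weak_deriv_V_def tests by (simp add: kappa_def)
    also have "\<dots> \<longleftrightarrow> f \<in> L2_circle (meas n) \<and> F \<in> L2_circle (meas (Suc n)) \<and> ?E 0 (Suc 0)"
      by (simp only: r cong: imp_cong)
    finally have "weak_step n f F \<longleftrightarrow> f \<in> L2_circle (meas n) \<and> F \<in> L2_circle (meas (Suc n)) \<and> ?E 0 (Suc 0)" .
    moreover have "?E 0 (Suc 0) \<longleftrightarrow> ?E (Suc n) (Suc (Suc n))"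
    proof
      assume "?E 0 (Suc 0)"
      then show "?E (Suc n) (Suc (Suc n))" by (rule shift) (use False in simp)
    next
      assume "?E (Suc n) (Suc (Suc n))"
      then show "?E 0 (Suc 0)" by (rule shift) (use False in simp)
    qed
    ultimately show ?thesis by simp
  qed
qed

text \<open>A chain member that is closer to \<open>u\<close> than \<open>0\<close> is cannot be orthogonal to \<open>u\<close>.\<close>

lemma orthogonal_to_chains_imp_zero:
  assumes u: "u \<in> mean_zero_L2 n" and orth: "\<And>x. smooth_chain x \<Longrightarrow> (\<integral>t. u t * x n t \<partial>meas n) = 0"
  shows "AE t in meas n. u t = 0"
proof (rule L2_norm_eq_0_AE[OF L2_sq_integrable[OF mean_zero_L2D(1)[OF u]]], rule ccontr)
  let ?N = "L2_norm (meas n)"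
  assume "?N u \<noteq> 0"
  then have pos: "0 < ?N u" by (simp add: less_le)
  from smooth_chains_dense[OF u pos] obtain x where x: "smooth_chain x" "?N (\<lambda>t. u t - x n t) < ?N u" by blast
  have xn: "x n \<in> mean_zero_L2 n" by (rule regular_mean_zero_L2[OF smooth_chain_strong(3)[OF x(1)]])
  have "(?N u)\<^sup>2 = (\<integral>t. u t * u t \<partial>meas n)"
    unfolding L2_norm_power2 unfolding power2_eq_square ..
  also have "\<dots> = (\<integral>t. u t * u t - u t * x n t \<partial>meas n)"
    using L2_mult[OF mean_zero_L2D(1)[OF u] mean_zero_L2D(1)[OF u]]
      L2_mult[OF mean_zero_L2D(1)[OF u] mean_zero_L2D(1)[OF xn]] orth[OF x(1)] by simp
  also have "\<dots> = (\<integral>t. u t * (u t - x n t) \<partial>meas n)" by (simp add: right_diff_distrib)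
  also have "\<dots> \<le> ?N u * ?N (\<lambda>t. u t - x n t)"
    using L2_Cauchy_Schwarz[of u "meas n" "\<lambda>t. u t - x n t"] u xn
    by (simp add: L2_sq_integrable L2_diff mean_zero_L2D abs_le_iff)
  also have "\<dots> < ?N u * ?N u" using x(2) pos by simp
  finally show False by (simp add: power2_eq_square)
qed

text \<open>This is the lemma of du Bois-Reymond. Testing with constants shows that \<open>F\<close> has mean zero. After
  integration by parts, the weak derivative relation says that \<open>f\<close> minus the primitive of \<open>F\<close> is orthogonal
  to all chain members; so is its mean-zero part, which therefore vanishes.\<close>

lemma weak_step_imp_primitive:
  assumes w: "weak_step n f F"
  shows "F \<in> mean_zero_L2 (Suc n)" "\<exists>c. AE t in meas n. f t = c + integrate n F t"
proof -
  have f: "f \<in> L2_circle (meas n)" and F: "F \<in> L2_circle (meas (Suc n))"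
    and E: "\<And>c x. smooth_chain x \<Longrightarrow>
      (\<integral>t. f t * x (Suc (Suc n)) t \<partial>meas n) = - (\<integral>t. F t * (c + x (Suc n) t) \<partial>meas (Suc n))"
    using w by (auto simp: weak_step_chain)
  have "(\<lambda>_. 0) \<in> mean_zero_L2 0" using L2_const by (simp add: mean_zero_L2_def)
  from smooth_chains_dense[OF this zero_less_one] obtain x0 where x0: "smooth_chain x0" by blast
  have mz: "x n \<in> mean_zero_L2 n" if "smooth_chain x" for x n
    by (rule regular_mean_zero_L2[OF smooth_chain_strong(3)[OF that]])
  have "(\<integral>t. F t * (1 + x0 (Suc n) t) \<partial>meas (Suc n)) = (\<integral>t. F t * (0 + x0 (Suc n) t) \<partial>meas (Suc n))"
    using E[OF x0, of 1] E[OF x0, of 0] by linarith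
  then have "(\<integral>t. F t \<partial>meas (Suc n)) = 0"
    using L2_integrable[OF F] L2_mult[OF F mean_zero_L2D(1)[OF mz[OF x0]]] by (simp add: distrib_left)
  then show Fm: "F \<in> mean_zero_L2 (Suc n)" using F by (simp add: mean_zero_L2_def)
  note IF = integrate_mean_zero_L2[OF Fm]
  define c where "c = (\<integral>t. f t \<partial>meas n) / mass n"
  define u where "u t = (f t - c) - integrate n F t" for t
  have fc: "(\<lambda>t. f t - c) \<in> mean_zero_L2 n"
    using L2_diff[OF f L2_const[of c]] L2_integrable[OF f] mass_pos[of n]
    by (simp add: mean_zero_L2_def c_def mass_def)
  have u: "u \<in> mean_zero_L2 n" unfolding u_def by (rule mean_zero_L2_diff[OF fc IF])
  have "AE t in meas n. u t = 0"
  proof (rule orthogonal_to_chains_imp_zero[OF u])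
    fix x' assume "smooth_chain x'"
    then obtain x where x: "smooth_chain x" "\<And>j. x (Suc (Suc n) + j) = x' (n + j)"
      using smooth_chain_reindex[of x' "Suc (Suc n)" n] by auto
    let ?g = "x (Suc (Suc n))"
    have g_eq: "?g = x' n" using x(2)[of 0] by simp
    have g: "?g \<in> mean_zero_L2 n" unfolding g_eq by (rule mz) fact
    note gL = mean_zero_L2D(1)[OF g]
    have "(\<integral>t. u t * ?g t \<partial>meas n)
        = (\<integral>t. f t * ?g t \<partial>meas n) - (\<integral>t. c * ?g t \<partial>meas n) - (\<integral>t. integrate n F t * ?g t \<partial>meas n)"
      using L2_mult[OF f gL] L2_integrable[OF gL] L2_mult[OF mean_zero_L2D(1)[OF IF] gL]
      by (simp add: u_def left_diff_distrib)
    also have "(\<integral>t. f t * ?g t \<partial>meas n) = - (\<integral>t. F t * x (Suc n) t \<partial>meas (Suc n))"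
      using E[OF x(1), of 0] by simp
    also have "(\<integral>t. integrate n F t * ?g t \<partial>meas n) = - (\<integral>t. F t * x (Suc n) t \<partial>meas (Suc n))"
      using integrate_by_parts[OF Fm g] x(1) unfolding smooth_chain_def by metis
    also have "(\<integral>t. c * ?g t \<partial>meas n) = 0" using mean_zero_L2D(2)[OF g] by simp
    finally show "(\<integral>t. u t * x' n t \<partial>meas n) = 0" by (simp add: g_eq)
  qed
  then have "AE t in meas n. f t = c + integrate n F t"
    by eventually_elim (simp add: u_def)
  then show "\<exists>c. AE t in meas n. f t = c + integrate n F t" ..
qed

text \<open>The converse is integration by parts alone, as the derivative of a test function has mean zero and so
  annihilates the constant \<open>c\<close>.\<close>

lemma weak_step_primitive:
  assumes f: "f \<in> L2_circle (meas n)" and F: "F \<in> mean_zero_L2 (Suc n)"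
    and ae: "AE t in meas n. f t = c + integrate n F t"
  shows "weak_step n f F"
  unfolding weak_step_chain
proof (intro conjI allI impI)
  show "f \<in> L2_circle (meas n)" by (rule f)
  show FL: "F \<in> L2_circle (meas (Suc n))" by (rule mean_zero_L2D(1)[OF F])
  fix k x assume x: "smooth_chain x"
  have mz: "x m \<in> mean_zero_L2 m" for m
    by (rule regular_mean_zero_L2[OF smooth_chain_strong(3)[OF x]])
  let ?g = "x (Suc (Suc n))"
  have "?g \<in> mean_zero_L2 (Suc (Suc n))" by (rule mz)
  then have g: "?g \<in> mean_zero_L2 n" by (simp add: mean_zero_L2_def kappa_def)
  note gL = mean_zero_L2D(1)[OF g] and IF = mean_zero_L2D(1)[OF integrate_mean_zero_L2[OF F]]
  have meas: "h \<in> borel_measurable (meas n)" if "h \<in> L2_circle (meas n)" for h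
    using that by (simp add: L2_circle_def borel_measurable_meas)
  have "(\<integral>t. f t * ?g t \<partial>meas n) = (\<integral>t. (c + integrate n F t) * ?g t \<partial>meas n)"
    using ae meas[OF f] meas[OF gL] meas[OF IF] by (intro integral_cong_AE) auto
  also have "\<dots> = (\<integral>t. integrate n F t * ?g t \<partial>meas n)"
    using L2_integrable[OF gL] mean_zero_L2D(2)[OF g] L2_mult[OF IF gL] by (simp add: distrib_right)
  also have "\<dots> = - (\<integral>t. F t * x (Suc n) t \<partial>meas (Suc n))"
    using integrate_by_parts[OF F g] x unfolding smooth_chain_def by metis
  also have "(\<integral>t. F t * x (Suc n) t \<partial>meas (Suc n)) = (\<integral>t. F t * (k + x (Suc n) t) \<partial>meas (Suc n))"
    using L2_integrable[OF FL] mean_zero_L2D(2)[OF F] L2_mult[OF FL mean_zero_L2D(1)[OF mz]]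
    by (simp add: distrib_left)
  finally show "(\<integral>t. f t * ?g t \<partial>meas n) = - (\<integral>t. F t * (k + x (Suc n) t) \<partial>meas (Suc n))" .
qed

lemma weak_step_unique:
  assumes w: "weak_step n f F" "weak_step n f' F'" and ae: "AE t in meas n. f t = f' t"
  shows "AE t in meas (Suc n). F t = F' t"
proof -
  have FL: "F \<in> mean_zero_L2 (Suc n)" "F' \<in> mean_zero_L2 (Suc n)"
    using weak_step_imp_primitive(1) w by auto
  have "AE t in meas (Suc n). F t - F' t = 0"
  proof (rule orthogonal_to_chains_imp_zero[OF mean_zero_L2_diff[OF FL]])
    fix x assume x: "smooth_chain x"
    have mz: "x m \<in> L2_circle (meas m)" for m
      by (rule mean_zero_L2D(1)[OF regular_mean_zero_L2[OF smooth_chain_strong(3)[OF x]]])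
    have "(\<integral>t. f t * x (Suc (Suc n)) t \<partial>meas n) = (\<integral>t. f' t * x (Suc (Suc n)) t \<partial>meas n)"
      using ae w mz[of "Suc (Suc n)"]
      by (intro integral_cong_AE) (auto simp: weak_step_chain L2_circle_def intro!: borel_measurable_times borel_measurable_meas)
    moreover have "(\<integral>t. f t * x (Suc (Suc n)) t \<partial>meas n) = - (\<integral>t. F t * (0 + x (Suc n) t) \<partial>meas (Suc n))"
      "(\<integral>t. f' t * x (Suc (Suc n)) t \<partial>meas n) = - (\<integral>t. F' t * (0 + x (Suc n) t) \<partial>meas (Suc n))"
      using w x unfolding weak_step_chain by blast+
    ultimately show "(\<integral>t. (F t - F' t) * x (Suc n) t \<partial>meas (Suc n)) = 0"
      using L2_mult[OF mean_zero_L2D(1)[OF FL(1)] mz] L2_mult[OF mean_zero_L2D(1)[OF FL(2)] mz]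
      by (simp add: left_diff_distrib)
  qed
  then show ?thesis by simp
qed

lemma has_weak_D_iff_sequence:
  "has_weak_D W V n f F \<longleftrightarrow>
    f \<in> L2_circle (meas 0) \<and> (\<exists>G. G 0 = f \<and> G n = F \<and> (\<forall>i<n. weak_step i (G i) (G (Suc i))))"
proof (induction n arbitrary: F)
  case 0
  show ?case by (auto simp: kappa_def)
next
  case (Suc n)
  show ?case
  proof
    assume "has_weak_D W V (Suc n) f F"
    then obtain H where H: "has_weak_D W V n f H" "weak_step n H F"
      by (auto simp: weak_step_def)
    then obtain G where G: "f \<in> L2_circle (meas 0)" "G 0 = f" "G n = H"
      "\<forall>i<n. weak_step i (G i) (G (Suc i))" using Suc by blast
    have "\<forall>i<Suc n. weak_step i ((G(Suc n := F)) i) ((G(Suc n := F)) (Suc i))"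
      using G H(2) by (auto simp: less_Suc_eq)
    with G show "f \<in> L2_circle (meas 0) \<and> (\<exists>G. G 0 = f \<and> G (Suc n) = F \<and>
        (\<forall>i<Suc n. weak_step i (G i) (G (Suc i))))"
      by (intro conjI exI[of _ "G(Suc n := F)"]) auto
  next
    assume "f \<in> L2_circle (meas 0) \<and> (\<exists>G. G 0 = f \<and> G (Suc n) = F \<and>
        (\<forall>i<Suc n. weak_step i (G i) (G (Suc i))))"
    then obtain G where G: "f \<in> L2_circle (meas 0)" "G 0 = f" "G (Suc n) = F"
      "\<And>i. i < Suc n \<Longrightarrow> weak_step i (G i) (G (Suc i))" by blast
    then have "has_weak_D W V n f (G n)" using Suc[of "G n"] by auto
    moreover have "weak_step n (G n) F" using G(3) G(4)[of n] by simp
    ultimately show "has_weak_D W V (Suc n) f F"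
      unfolding has_weak_D.simps weak_step_def by blast
  qed
qed

lemma has_weak_D_L2:
  assumes "has_weak_D W V n f F"
  shows "F \<in> L2_circle (meas n)"
proof (cases n)
  case 0
  then show ?thesis using assms by (simp add: kappa_def)
next
  case (Suc m)
  then obtain G where "weak_step m G F" using assms by (auto simp: weak_step_def)
  then show ?thesis using Suc by (simp add: weak_step_chain)
qed

lemma has_weak_D_unique:
  "has_weak_D W V n f F \<Longrightarrow> has_weak_D W V n f F' \<Longrightarrow> AE t in meas n. F t = F' t"
proof (induction n arbitrary: F F')
  case (Suc n)
  obtain G where G: "has_weak_D W V n f G" "weak_step n G F"
    using Suc.prems(1) by (auto simp: weak_step_def)
  obtain G' where G': "has_weak_D W V n f G'" "weak_step n G' F'"
    using Suc.prems(2) by (auto simp: weak_step_def)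
  show ?case by (rule weak_step_unique[OF G(2) G'(2) Suc.IH[OF G(1) G'(1)]])
qed simp

text \<open>The choice operator may pick any representative of the weak derivative, but the norm does not see which.\<close>

lemma L2_norm_weak_D:
  assumes "has_weak_D W V n f F"
  shows "L2_norm (meas n) (weak_D W V n f) = L2_norm (meas n) F"
proof -
  have w: "has_weak_D W V n f (weak_D W V n f)"
    unfolding weak_D_def by (rule someI[of _ F]) (rule assms)
  show ?thesis
    using has_weak_D_L2[OF w] has_weak_D_L2[OF assms]
    by (intro L2_norm_cong_AE has_weak_D_unique[OF w assms])
      (auto simp: L2_circle_def intro: borel_measurable_meas)
qed

lemma sobolev_iff_sequence:
  "f \<in> sobolev W V k \<longleftrightarrow>
    f \<in> L2_circle (meas 0) \<and> (\<exists>G. G 0 = f \<and> (\<forall>i<k. weak_step i (G i) (G (Suc i))))"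
proof
  assume f: "f \<in> sobolev W V k"
  have "\<exists>F. has_weak_D W V k f F"
  proof (cases "k = 0")
    case True
    then show ?thesis using f by (simp add: sobolev_def)
  next
    case False
    then have "k \<in> {1..k}" by simp
    with f show ?thesis unfolding sobolev_def by blast
  qed
  then show "f \<in> L2_circle (meas 0) \<and> (\<exists>G. G 0 = f \<and> (\<forall>i<k. weak_step i (G i) (G (Suc i))))"
    by (auto simp: has_weak_D_iff_sequence)
next
  assume "f \<in> L2_circle (meas 0) \<and> (\<exists>G. G 0 = f \<and> (\<forall>i<k. weak_step i (G i) (G (Suc i))))"
  then obtain G where G: "f \<in> L2_circle (meas 0)" "G 0 = f" "\<And>i. i < k \<Longrightarrow> weak_step i (G i) (G (Suc i))"
    by blast
  have "has_weak_D W V n f (G n)" if "n \<le> k" for n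
    unfolding has_weak_D_iff_sequence using G that by (auto intro!: exI[of _ G])
  then have "\<forall>n\<in>{1..k}. \<exists>F. has_weak_D W V n f F" by (meson atLeastAtMost_iff)
  then show "f \<in> sobolev W V k" using G(1) by (simp add: sobolev_def kappa_def)
qed

section \<open>Density of smooth functions\<close>

lemma smooth_in_sobolev:
  assumes "h \<in> Cinf_WV W V"
  shows "h \<in> sobolev W V k"
proof -
  obtain c x where x: "smooth_chain x" and h: "h = (\<lambda>t. c + x 0 t)"
    using assms by (auto simp: Cinf_WV_iff)
  have mz: "x n \<in> mean_zero_L2 n" for n
    by (rule regular_mean_zero_L2[OF smooth_chain_strong(3)[OF x]])
  have hL: "h \<in> L2_circle (meas 0)"
    unfolding h by (rule L2_add[OF L2_const mean_zero_L2D(1)[OF mz]])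
  let ?G = "x(0 := h)"
  have "weak_step i (?G i) (?G (Suc i))" for i
  proof (rule weak_step_primitive)
    show "?G i \<in> L2_circle (meas i)" using hL mean_zero_L2D(1)[OF mz] by auto
    show "?G (Suc i) \<in> mean_zero_L2 (Suc i)" using mz by simp
    have "x i = integrate i (x (Suc i))" using x unfolding smooth_chain_def by blast
    then have "?G i t = (if i = 0 then c else 0) + integrate i (?G (Suc i)) t" for t
      by (cases i) (simp_all add: h)
    then show "AE t in meas i. ?G i t = (if i = 0 then c else 0) + integrate i (?G (Suc i)) t" by simp
  qed
  then show ?thesis using hL unfolding sobolev_iff_sequence by (auto intro!: exI[of _ ?G])
qed

text \<open>Only the \<open>k\<close>-th derivative has to be approximated: the lower ones are obtained from it by integration, on
  the side of \<open>f\<close> as well as on the side of the chain, and integration is bounded.\<close>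

lemma smooth_dense_in_sobolev:
  assumes f: "f \<in> sobolev W V k" and e: "0 < e"
  obtains h where "h \<in> Cinf_WV W V" "sobolev_norm W V k (\<lambda>t. h t - f t) < e"
proof -
  obtain G where fL: "f \<in> L2_circle (meas 0)" and G0: "G 0 = f"
    and G: "\<And>i. i < k \<Longrightarrow> weak_step i (G i) (G (Suc i))"
    using f by (auto simp: sobolev_iff_sequence)
  define c where "c = (\<integral>t. f t \<partial>meas 0) / mass 0"
  \<comment> \<open>Moving the mean of \<open>f\<close> into \<open>c\<close> makes the functions at all levels mean-zero; then each is the
    primitive of the next without an additive constant, because primitives have mean zero, too.\<close>
  define F where "F = G(0 := (\<lambda>t. f t - c))"
  have F: "F i \<in> mean_zero_L2 i" if "i \<le> k" for i
  proof (cases i)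
    case 0
    then show ?thesis
      using L2_diff[OF fL L2_const[of c]] L2_integrable[OF fL] mass_pos[of 0]
      by (simp add: F_def mean_zero_L2_def c_def mass_def)
  next
    case (Suc j)
    then show ?thesis using weak_step_imp_primitive(1)[OF G[of j]] that by (simp add: F_def)
  qed
  have F_int: "AE t in meas i. F i t = integrate i (F (Suc i)) t" if i: "i < k" for i
  proof -
    have FS: "F (Suc i) \<in> mean_zero_L2 (Suc i)" and Fi: "F i \<in> mean_zero_L2 i" using F i by auto
    obtain b where "AE t in meas i. G i t = b + integrate i (G (Suc i)) t"
      using weak_step_imp_primitive(2)[OF G[OF i]] by blast
    then obtain b where b: "AE t in meas i. F i t - integrate i (F (Suc i)) t = b"
    proof -
      assume *: "AE t in meas i. G i t = b + integrate i (G (Suc i)) t"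
      have "AE t in meas i. F i t - integrate i (F (Suc i)) t = (if i = 0 then b - c else b)"
        using * by eventually_elim (auto simp: F_def G0)
      then show thesis by (rule that)
    qed
    have d: "(\<lambda>t. F i t - integrate i (F (Suc i)) t) \<in> mean_zero_L2 i"
      by (rule mean_zero_L2_diff[OF Fi integrate_mean_zero_L2[OF FS]])
    have "(\<integral>t. F i t - integrate i (F (Suc i)) t \<partial>meas i) = (\<integral>t. b \<partial>meas i)"
      using b borel_measurable_meas[OF mean_zero_L2_borel[OF d]] by (intro integral_cong_AE) auto
    then have "b = 0" using mean_zero_L2D(2)[OF d] mass_pos[of i] by (simp add: mass_def)
    with b show ?thesis by simp
  qed
  \<comment> \<open>The error grows by at most \<open>bound\<^sup>2\<close> in each of the \<open>k\<close> integrations, and \<open>k + 1\<close> norms are added.\<close>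
  define \<eta> where "\<eta> = e / (2 * (real k + 1) * (bound\<^sup>2) ^ k)"
  have b1: "1 \<le> bound\<^sup>2" using bound_ge_1 by (simp add: one_le_power)
  have bk: "0 < (bound\<^sup>2) ^ k" using bound_ge_1 by (intro zero_less_power) linarith
  have \<eta>: "0 < \<eta>" using e bk by (simp add: \<eta>_def)
  from smooth_chains_dense[OF F[OF order_refl] \<eta>] obtain x
    where x: "smooth_chain x" "L2_norm (meas k) (\<lambda>t. F k t - x k t) < \<eta>" by blast
  have mz: "x n \<in> mean_zero_L2 n" for n
    by (rule regular_mean_zero_L2[OF smooth_chain_strong(3)[OF x(1)]])
  have x_int: "x i = integrate i (x (Suc i))" for i using x(1) unfolding smooth_chain_def by blast
  define H where "H i t = x i t - F i t" for i t
  have H: "H i \<in> mean_zero_L2 i" if "i \<le> k" for i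
    unfolding H_def by (rule mean_zero_L2_diff[OF mz F[OF that]])
  have H_int: "AE t in meas i. H i t = integrate i (H (Suc i)) t" if "i < k" for i
  proof -
    have eq: "integrate i (H (Suc i)) = (\<lambda>t. x i t - integrate i (F (Suc i)) t)"
      unfolding H_def x_int[of i] using that by (intro integrate_diff mz F) simp
    show ?thesis using F_int[OF that] by eventually_elim (simp add: eq H_def[of i])
  qed
  have small: "L2_norm (meas (k - j)) (H (k - j)) \<le> (bound\<^sup>2) ^ j * \<eta>" if "j \<le> k" for j
    using that
  proof (induction j)
    case 0
    then show ?case using x(2) L2_norm_minus_commute[of "meas k" "F k" "x k"] by (simp add: H_def[abs_def])
  next
    case (Suc j)
    define i where "i = k - Suc j"
    have i: "k - j = Suc i" "i < k" using Suc.prems by (auto simp: i_def)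
    have HS: "H (Suc i) \<in> mean_zero_L2 (Suc i)" using i(2) by (intro H) simp
    have "L2_norm (meas i) (H i) = L2_norm (meas i) (integrate i (H (Suc i)))"
      using mean_zero_L2_borel[OF H[of i]] mean_zero_L2_borel[OF integrate_mean_zero_L2[OF HS]]
        H_int[OF i(2)] i(2)
      by (intro L2_norm_cong_AE borel_measurable_meas) auto
    also have "\<dots> \<le> bound\<^sup>2 * L2_norm (meas (Suc i)) (H (Suc i))"
      by (rule integrate_L2_norm_le[OF HS])
    also have "\<dots> \<le> bound\<^sup>2 * ((bound\<^sup>2) ^ j * \<eta>)"
      using Suc i by (intro mult_left_mono) auto
    finally show ?case by (simp add: i_def mult.assoc)
  qed
  define B where "B = (bound\<^sup>2) ^ k * \<eta>"
  have B: "L2_norm (meas i) (H i) \<le> B" if "i \<le> k" for i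
  proof -
    have "L2_norm (meas i) (H i) \<le> (bound\<^sup>2) ^ (k - i) * \<eta>" using small[of "k - i"] that by simp
    also have "\<dots> \<le> B"
      unfolding B_def using b1 \<eta> by (intro mult_right_mono power_increasing) auto
    finally show ?thesis .
  qed
  define h where "h t = c + x 0 t" for t
  have h: "h \<in> Cinf_WV W V" unfolding Cinf_WV_iff h_def using x(1) by blast
  have hf: "(\<lambda>t. h t - f t) = H 0" by (simp add: h_def H_def F_def fun_eq_iff)
  have "weak_step i (H i) (H (Suc i))" if "i < k" for i
    using H[of i] H[of "Suc i"] H_int[OF that] that
    by (intro weak_step_primitive[where c=0]) (auto dest: mean_zero_L2D)
  then have wD: "has_weak_D W V i (H 0) (H i)" if "i \<le> k" for i
    unfolding has_weak_D_iff_sequence using that mean_zero_L2D(1)[OF H[of 0]] by (auto intro!: exI[of _ H])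
  have "(sobolev_norm W V k (\<lambda>t. h t - f t))\<^sup>2
      = (L2_norm (meas 0) (H 0))\<^sup>2 + (\<Sum>i=1..k. (L2_norm (meas i) (weak_D W V i (H 0)))\<^sup>2)"
    unfolding hf sobolev_norm_def by (simp add: sum_nonneg kappa_def)
  also have "(\<Sum>i=1..k. (L2_norm (meas i) (weak_D W V i (H 0)))\<^sup>2) = (\<Sum>i=1..k. (L2_norm (meas i) (H i))\<^sup>2)"
    by (rule sum.cong) (simp_all add: L2_norm_weak_D[OF wD])
  also have "\<dots> \<le> (\<Sum>i=1..k. B\<^sup>2)" by (rule sum_mono) (use B in \<open>simp add: power_mono\<close>)
  also have "(L2_norm (meas 0) (H 0))\<^sup>2 \<le> B\<^sup>2" using B[of 0] by (simp add: power_mono)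
  finally have "(sobolev_norm W V k (\<lambda>t. h t - f t))\<^sup>2 \<le> (real k + 1) * B\<^sup>2" by (simp add: algebra_simps)
  also have "\<dots> \<le> ((real k + 1) * B)\<^sup>2"
    unfolding power_mult_distrib by (intro mult_right_mono self_le_power) auto
  finally have "sobolev_norm W V k (\<lambda>t. h t - f t) \<le> (real k + 1) * B"
  proof (rule power2_le_imp_le)
    have "0 \<le> B" unfolding B_def using \<eta> bk by (intro mult_nonneg_nonneg less_imp_le)
    then show "0 \<le> (real k + 1) * B" by simp
  qed
  also have "\<dots> = e / 2"
  proof -
    have cancel: "r * (d * (e / (2 * r * d))) = e / 2" if "r \<noteq> 0" "d \<noteq> 0" for r d :: real
      using that by (simp add: field_simps)
    show ?thesis
      unfolding B_def \<eta>_def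
    proof (rule cancel)
      show "(bound\<^sup>2) ^ k \<noteq> 0" using bk by (rule less_imp_neq[symmetric])
    qed simp
  qed
  also have "\<dots> < e" using e by simp
  finally show ?thesis using that h by blast
qed

end

theorem corollary24:
  fixes W V :: "real \<Rightarrow> real" and k :: nat
  assumes "strict_mono W" and "strict_mono V"
    and "cadlag W" and "caglad V"
    and "\<And>x. W (x + 1) - W x = W 1 - W 0"
    and "\<And>x. V (x + 1) - V x = V 1 - V 0"
    and "isCont W 0" and "isCont V 0"
    and "W 0 = 0" and "V 0 = 0"
  shows "Cinf_WV W V \<subseteq> sobolev W V k \<and>
    sobolev W V k = sobolev_topology W V k closure_of Cinf_WV W V"
proof -
  interpret circle_pair W V
    using assms(1-6) by unfold_locales
  have "f \<in> sobolev_topology W V k closure_of Cinf_WV W V" if f: "f \<in> sobolev W V k" for f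
    unfolding in_closure_of topspace_sobolev_topology
  proof (intro conjI allI impI f)
    fix U assume "f \<in> U \<and> openin (sobolev_topology W V k) U"
    then obtain e where e: "0 < e"
      "\<And>g. g \<in> sobolev W V k \<Longrightarrow> sobolev_norm W V k (\<lambda>x. g x - f x) < e \<Longrightarrow> g \<in> U"
      unfolding openin_sobolev_topology by blast
    obtain h where "h \<in> Cinf_WV W V" "sobolev_norm W V k (\<lambda>x. h x - f x) < e"
      using smooth_dense_in_sobolev[OF f e(1)] by blast
    then show "\<exists>h. h \<in> Cinf_WV W V \<and> h \<in> U"
      using e(2) smooth_in_sobolev by blast
  qed
  moreover have "sobolev_topology W V k closure_of Cinf_WV W V \<subseteq> sobolev W V k"
    using closure_of_subset_topspace topspace_sobolev_topology by metis
  ultimately show ?thesis using smooth_in_sobolev by blast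
qed

end
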